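(* Let $\diamondsuit\in\{\emptyset,h,s\}$ and let $p=(p_i)_{i\in\mathcal{A}^{\diamondsuit}}$ be a probability vector with all $p_i\in\,]0,1[$ satisfying: $p_1>\cdots>p_n>0$ if $\diamondsuit\in\{\emptyset,s\}$; $p_{\overline m}>\cdots>p_{\overline 1}>0$ and $p_1>\cdots>p_n>0$ if $\diamondsuit=h$. Then the Markov chain $(\mathcal{H}^{\diamondsuit}_\ell)_{\ell\ge 0}$ (the shape process, i.e. the generalized Pitman transform of the one-way simple walk) and the Markov chain $(\mathcal{W}^{\diamondsuit}_\ell)_{\ell\ge 0}$ (the one-way simple walk conditioned to never exit $\mathcal{P}^{\diamondsuit}$) have the same transition matrix on $\mathcal{P}^{\diamondsuit}$.
   Context: **Cases and partitions.** Fix positive integers $n$ (and $m$ when $\diamondsuit=h$). The cases $\diamondsuit=\emptyset,h,s$ correspond to $\mathfrak{gl}(n),\mathfrak{gl}(m,n),\mathfrak{q}(n)$. Put $N=n$ for $\diamondsuit=\emptyset,s$ and $N=m+n$ for $\diamondsuit=h$. Alphabets: $\mathcal{A}^{\emptyset}=\mathcal{A}^{s}=\{1<\cdots<n\}$, $\mathcal{A}^{h}=\{\overline m<\overline{m-1}<\cdots<\overline 1<1<\cdots<n\}$. Coordinates of $\mathbb{Z}^N$ are indexed by $\mathcal{A}^{\diamondsuit}$; $(e_i)_{i\in\mathcal{A}^{\diamondsuit}}$ is the standard basis. - $\mathcal{P}^{\emptyset}=\{\lambda\in\mathbb{Z}^n:\lambda_1\ge\cdots\ge\lambda_n\ge 0\}$,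 with the usual Young diagram. - $\mathcal{P}^{s}=\{\lambda\in\mathcal{P}^{\emptyset}:\lambda_{i+1}>0\Rightarrow\lambda_i>\lambda_{i+1}\}$ (strict partitions), with the shifted Young diagram (row $i$ has $\lambda_i$ boxes and is shifted $i-1$ units to the right). - $\mathcal{P}^{h}$ is the set of hook partitions: partitions $\lambda$ of arbitrary length with $i$-th part at most $n$ for every $i>m$, with the usual Young diagram. Such a $\lambda$ is identified with the vector $(\lambda_{\overline m},\ldots,\lambda_{\overline 1}\mid\lambda_1,\ldots,\lambda_n)\in\mathbb{Z}^{m+n}$, where $\lambda_{\overline m}\ge\cdots\ge\lambda_{\overline 1}$ are its first $m$ parts and, for $1\le j\le n$, $\lambda_j$ is the number of boxes of column $j$ lying strictly below row $m$. **Insertion.** For a tableau $T$ (a filling of a diagram by letters of $\mathcal{A}^{\diamondsuit}$) and a letter $x$, the tableau $x\to T$ is defined recursively; $x\to\emptyset$ is the one-box tableau containing $x$. - $\diamondsuit=\emptyset$: let $T=C_1C_2\cdots C_r$ (columns, left to right). If all letters of $C_1$ are $<x$, add a box containing $x$ at the bottom of $C_1$. Otherwise let $y=\min\{t\in C_1: t\ge x\}$, let $C_1'$ be $C_1$ with $y$ replaced by $x$, and set $x\to T=C_1'(y\to C_2\cdots C_r)$. - $\diamondsuit=h$: let $T=C_1\cdots C_r$ (columns). If $x$ is barred: if all letters of $C_1$ are $<x$, add $x$ at the bottom of $C_1$; otherwise $y=\min\{t\in C_1:t\ge x\}$. If $x$ is unbarred: if all letters of $C_1$ are $\le x$, add $x$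 at the bottom of $C_1$; otherwise $y=\min\{t\in C_1:t>x\}$. In the "otherwise" cases, replace the highest occurrence of $y$ in $C_1$ by $x$ to get $C_1'$ and set $x\to T=C_1'(y\to C_2\cdots C_r)$. - $\diamondsuit=s$: a nonempty word $x_1\cdots x_\ell$ is a hook word if $x_1\ge\cdots\ge x_k<x_{k+1}<\cdots<x_\ell$ for some $1\le k\le \ell$; its decreasing part is $w_\downarrow=x_1\cdots x_k$ and its increasing part is $w_\uparrow=x_{k+1}\cdots x_\ell$ (possibly empty). Let $T=L_1\cdots L_r$ (rows, top to bottom), and let $w=w_\downarrow w_\uparrow$ be the word of $L_1$ read from left to right. If $wx$ is a hook word, add a box containing $x$ at the right end of $L_1$. Otherwise let $y=\min\{t\in w_\uparrow:t\ge x\}$, replace $y$ by $x$ in $w_\uparrow$; let $z=\max\{t\in w_\downarrow:t<y\}$, replace (the leftmost) $z$ by $y$ in $w_\downarrow$; with $L_1'$ the resulting row, $x\to T=L_1'(z\to L_2\cdots L_r)$. For a word $w=x_1\cdots x_\ell$, $P^{\diamondsuit}(w)=x_\ell\to(\cdots(x_2\to(x_1\to\emptyset)))$; its shape lies in $\mathcal{P}^{\diamondsuit}$. **Processes.** On $(\mathcal{A}^{\diamondsuit})^{\mathbb{N}}$ with the product probability $\mathbb{P}=p^{\otimes\mathbb{N}}$, let $x_1,x_2,\ldots$ be the coordinate letters (i.i.d. with law $p$). - The one-way simple walk is $\mathcal{W}_\ell=e_{x_1}+\cdots+e_{x_\ell}$, $\mathcal{W}_0=0$; its transition matrix is $\Pi_{\mathcal{W}}(\alpha,\beta)=p_i$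 if $\beta-\alpha=e_i$, and $0$ otherwise. - $\mathcal{H}^{\diamondsuit}_\ell$ is the shape of $P^{\diamondsuit}(x_1\cdots x_\ell)$, with $\mathcal{H}^{\diamondsuit}_0=0$. The process $\mathcal{H}^{\diamondsuit}$ is a time-homogeneous Markov chain on $\mathcal{P}^{\diamondsuit}$. - The walk conditioned to never exit $\mathcal{P}^{\diamondsuit}$, denoted $\mathcal{W}^{\diamondsuit}$, is the Markov chain on $\mathcal{P}^{\diamondsuit}$ with transition matrix $\Pi_{\mathcal{W}^{\diamondsuit}}(\mu,\lambda)=\Pi_{\mathcal{W}}(\mu,\lambda)\,\dfrac{h(\lambda)}{h(\mu)}$, where $h(\lambda)$ is the probability that the walk started at $\lambda$ stays in $\mathcal{P}^{\diamondsuit}$ at all times. *)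

theory Defs
  imports "HOL-Probability.Probability" "HOL-Library.Function_Algebras"
begin

text \<open>
  The three families: \<open>GL n\<close>, \<open>GLsuper m n\<close> and \<open>Queer n\<close> stand for $gl(n)$, $gl(m,n)$
  and $q(n)$.  Letters are integers: the unbarred letter \<open>i\<close> is \<open>i\<close> and the barred letter
  \<open>i\<close> is \<open>- i\<close>, so that the order of the alphabet is the order of the integers.
\<close>

datatype family = GL nat | GLsuper nat nat | Queer nat

fun positive_ranks :: "family \<Rightarrow> bool" where
  "positive_ranks (GL n) \<longleftrightarrow> 0 < n"
| "positive_ranks (GLsuper m n) \<longleftrightarrow> 0 < m \<and> 0 < n"
| "positive_ranks (Queer n) \<longleftrightarrow> 0 < n"

fun alphabet :: "family \<Rightarrow> int set" where
  "alphabet (GL n) = {1..int n}"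
| "alphabet (GLsuper m n) = {- int m..-1} \<union> {1..int n}"
| "alphabet (Queer n) = {1..int n}"

fun decreasing_weights :: "family \<Rightarrow> (int \<Rightarrow> real) \<Rightarrow> bool" where
  "decreasing_weights (GL n) p \<longleftrightarrow> strict_antimono_on {1..int n} p"
| "decreasing_weights (GLsuper m n) p \<longleftrightarrow>
     strict_antimono_on {- int m..-1} p \<and> strict_antimono_on {1..int n} p"
| "decreasing_weights (Queer n) p \<longleftrightarrow> strict_antimono_on {1..int n} p"


section \<open>Partitions as vectors\<close>

text \<open>
  A vector of $Z^N$ is a function \<open>int \<Rightarrow> int\<close> vanishing outside the alphabet.
\<close>

type_synonym vector = "int \<Rightarrow> int"

definition partition_vectors :: "nat \<Rightarrow> vector set" where
  "partition_vectors n =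
     {v. (\<forall>a. a \<notin> {1..int n} \<longrightarrow> v a = 0) \<and>
         (\<forall>a\<in>{1..<int n}. v a \<ge> v (a + 1)) \<and> v (int n) \<ge> 0}"

definition strict_partition_vectors :: "nat \<Rightarrow> vector set" where
  "strict_partition_vectors n =
     {v \<in> partition_vectors n. \<forall>a\<in>{1..<int n}. v (a + 1) > 0 \<longrightarrow> v a > v (a + 1)}"

text \<open>
  Partitions of arbitrary length, and sequences of row lengths of diagrams in general, are
  finitely supported sequences indexed from \<open>0\<close>: the value at \<open>i\<close> is the \<open>(i + 1)\<close>-st part.
\<close>

definition hook_partitions :: "nat \<Rightarrow> nat \<Rightarrow> (nat \<Rightarrow> nat) set" where
  "hook_partitions m n =
     {lam. antimono lam \<and> finite {i. lam i \<noteq> 0} \<and> (\<forall>i\<ge>m. lam i \<le> n)}"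

text \<open>
  The coordinate at \<open>- int m\<close> is the first part and the one at \<open>-1\<close> is the \<open>m\<close>-th part.
\<close>

definition hook_vector :: "nat \<Rightarrow> nat \<Rightarrow> (nat \<Rightarrow> nat) \<Rightarrow> vector" where
  "hook_vector m n lam = (\<lambda>a.
     if a \<in> {- int m..-1} then int (lam (nat (int m + a)))
     else if a \<in> {1..int n} then int (card {i. m \<le> i \<and> a \<le> int (lam i)})
     else 0)"

definition row_vector :: "nat \<Rightarrow> (nat \<Rightarrow> nat) \<Rightarrow> vector" where
  "row_vector n lam = (\<lambda>a. if a \<in> {1..int n} then int (lam (nat (a - 1))) else 0)"

fun partitions_of :: "family \<Rightarrow> vector set" where
  "partitions_of (GL n) = partition_vectors n"
| "partitions_of (GLsuper m n) = hook_vector m n ` hook_partitions m n"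
| "partitions_of (Queer n) = strict_partition_vectors n"


section \<open>Insertion\<close>

text \<open>
  For \<open>GL\<close> and \<open>GLsuper\<close> a tableau is the list of its columns (left to right, each read from
  top to bottom); for \<open>Queer\<close> it is the list of its rows (top to bottom, each read from left
  to right, the shift being implicit).
\<close>

type_synonym tableau = "int list list"

primrec replace_first :: "'a \<Rightarrow> 'a \<Rightarrow> 'a list \<Rightarrow> 'a list" where
  "replace_first y x [] = []"
| "replace_first y x (c # cs) = (if c = y then x # cs else c # replace_first y x cs)"

fun insert_GL :: "int \<Rightarrow> tableau \<Rightarrow> tableau" where
  "insert_GL x [] = [[x]]"
| "insert_GL x (C # T) =
     (if \<forall>t\<in>set C. t < x then (C @ [x]) # T
      else let y = Min {t \<in> set C. t \<ge> x} in replace_first y x C # insert_GL y T)"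

fun insert_GLsuper :: "int \<Rightarrow> tableau \<Rightarrow> tableau" where
  "insert_GLsuper x [] = [[x]]"
| "insert_GLsuper x (C # T) =
     (if x < 0 then
        if \<forall>t\<in>set C. t < x then (C @ [x]) # T
        else let y = Min {t \<in> set C. t \<ge> x} in replace_first y x C # insert_GLsuper y T
      else
        if \<forall>t\<in>set C. t \<le> x then (C @ [x]) # T
        else let y = Min {t \<in> set C. t > x} in replace_first y x C # insert_GLsuper y T)"

text \<open>
  \<open>hook_at w k\<close> says $x_1 \ge \dots \ge x_k < x_{k+1} < \dots < x_l$ for \<open>w\<close> $= x_1 \dots x_l$;
  such a \<open>k\<close> is unique if it exists.
\<close>

definition hook_at :: "int list \<Rightarrow> nat \<Rightarrow> bool" where
  "hook_at w k \<longleftrightarrow> 1 \<le> k \<and> k \<le> length w \<and>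
     sorted_wrt (\<ge>) (take k w) \<and> sorted_wrt (<) (drop (k - 1) w)"

definition hook_word :: "int list \<Rightarrow> bool" where
  "hook_word w \<longleftrightarrow> (\<exists>k. hook_at w k)"

definition decreasing_part :: "int list \<Rightarrow> int list" where
  "decreasing_part w = take (THE k. hook_at w k) w"

definition increasing_part :: "int list \<Rightarrow> int list" where
  "increasing_part w = drop (THE k. hook_at w k) w"

fun insert_Queer :: "int \<Rightarrow> tableau \<Rightarrow> tableau" where
  "insert_Queer x [] = [[x]]"
| "insert_Queer x (L # T) =
     (if hook_word (L @ [x]) then (L @ [x]) # T
      else let y = Min {t \<in> set (increasing_part L). t \<ge> x};
               z = Max {t \<in> set (decreasing_part L). t < y}
           in (replace_first z y (decreasing_part L) @ replace_first y x (increasing_part L))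
              # insert_Queer z T)"

fun insertion :: "family \<Rightarrow> int \<Rightarrow> tableau \<Rightarrow> tableau" where
  "insertion (GL n) = insert_GL"
| "insertion (GLsuper m n) = insert_GLsuper"
| "insertion (Queer n) = insert_Queer"

definition P_tableau :: "family \<Rightarrow> int list \<Rightarrow> tableau" where
  "P_tableau d w = fold (insertion d) w []"

definition row_lengths_of_columns :: "tableau \<Rightarrow> nat \<Rightarrow> nat" where
  "row_lengths_of_columns T i = length (filter (\<lambda>C. i < length C) T)"

definition row_lengths_of_rows :: "tableau \<Rightarrow> nat \<Rightarrow> nat" where
  "row_lengths_of_rows T i = (if i < length T then length (T ! i) else 0)"

fun shape :: "family \<Rightarrow> tableau \<Rightarrow> vector" where
  "shape (GL n) T = row_vector n (row_lengths_of_columns T)"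
| "shape (GLsuper m n) T = hook_vector m n (row_lengths_of_columns T)"
| "shape (Queer n) T = row_vector n (row_lengths_of_rows T)"


section \<open>Markov chains\<close>

definition stochastic_on :: "'s set \<Rightarrow> ('s \<Rightarrow> 's \<Rightarrow> real) \<Rightarrow> bool" where
  "stochastic_on S Q \<longleftrightarrow> (\<forall>s\<in>S. (\<forall>t\<in>S. 0 \<le> Q s t) \<and> ((\<lambda>t. Q s t) has_sum 1) S)"

definition markov_chain ::
    "'w measure \<Rightarrow> 's set \<Rightarrow> ('s \<Rightarrow> 's \<Rightarrow> real) \<Rightarrow> (nat \<Rightarrow> 'w \<Rightarrow> 's) \<Rightarrow> bool" where
  "markov_chain M S Q X \<longleftrightarrow>
     prob_space M \<and> stochastic_on S Q \<and> (\<forall>l. X l \<in> M \<rightarrow>\<^sub>M count_space S) \<and>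
     (\<forall>l s. \<forall>t\<in>S. (\<forall>k\<le>l. s k \<in> S) \<longrightarrow> \<P>(\<omega> in M. \<forall>k\<le>l. X k \<omega> = s k) > 0 \<longrightarrow>
        \<P>(\<omega> in M. X (Suc l) \<omega> = t \<bar> \<forall>k\<le>l. X k \<omega> = s k) = Q (s l) t)"

text \<open>
  For a time-homogeneous chain the conditional probability of moving from \<open>s\<close> to \<open>t\<close> does not
  depend on the time at which \<open>s\<close> is visited, so it may be read off at the first time at which
  \<open>s\<close> has positive probability.  The row of a state that is never visited is zero (division by
  zero), so such a row is not stochastic.
\<close>

definition transition_matrix ::
    "'w measure \<Rightarrow> (nat \<Rightarrow> 'w \<Rightarrow> 's) \<Rightarrow> 's \<Rightarrow> 's \<Rightarrow> real" where
  "transition_matrix M X s t =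
     (let l = (LEAST l. \<P>(\<omega> in M. X l \<omega> = s) > 0)
      in \<P>(\<omega> in M. X (Suc l) \<omega> = t \<bar> X l \<omega> = s))"


section \<open>The processes\<close>

text \<open>The letter $x_{k+1}$ of the random word \<open>\<omega>\<close> is \<open>\<omega> k\<close>.\<close>

definition word_space :: "family \<Rightarrow> (int \<Rightarrow> real) \<Rightarrow> (nat \<Rightarrow> int) measure" where
  "word_space d p = PiM UNIV (\<lambda>_. point_measure (alphabet d) (\<lambda>i. ennreal (p i)))"

definition unit_vector :: "int \<Rightarrow> vector" where
  "unit_vector i = (\<lambda>a. if a = i then 1 else 0)"

definition walk :: "nat \<Rightarrow> (nat \<Rightarrow> int) \<Rightarrow> vector" where
  "walk l \<omega> = (\<Sum>k<l. unit_vector (\<omega> k))"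

text \<open>At most one summand is nonzero, since the unit vectors are distinct.\<close>

definition walk_matrix :: "family \<Rightarrow> (int \<Rightarrow> real) \<Rightarrow> vector \<Rightarrow> vector \<Rightarrow> real" where
  "walk_matrix d p u v = (\<Sum>i\<in>alphabet d. if v - u = unit_vector i then p i else 0)"

definition survival_prob :: "family \<Rightarrow> (int \<Rightarrow> real) \<Rightarrow> vector \<Rightarrow> real" where
  "survival_prob d p u = \<P>(\<omega> in word_space d p. \<forall>l. u + walk l \<omega> \<in> partitions_of d)"

definition conditioned_walk_matrix ::
    "family \<Rightarrow> (int \<Rightarrow> real) \<Rightarrow> vector \<Rightarrow> vector \<Rightarrow> real" where
  "conditioned_walk_matrix d p u v =
     walk_matrix d p u v * (survival_prob d p v / survival_prob d p u)"

definition shape_process :: "family \<Rightarrow> nat \<Rightarrow> (nat \<Rightarrow> int) \<Rightarrow> vector" where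
  "shape_process d l \<omega> = shape d (P_tableau d (map \<omega> [0..<l]))"

end

theory Submission
  imports Defs
begin

text \<open>
  Both chains are obtained from the walk that is killed when it leaves the set of partitions, by a harmonic function;
  the proof shows that the two harmonic functions are proportional.

  Let $s_v$ be the sum of the weights $p^T$ of all tableaux $T$ of shape $v$ (\<open>schur\<close>).  Insertion is a bijection from
  the pairs of a tableau of shape $v$ and a letter onto the tableaux whose shape has one box more.  By induction, the words
  for which the shapes of the prefixes follow a given trajectory correspond to the tableaux of the last shape of this
  trajectory, with the same weights (\<open>words_with_history_bij\<close>).  So a trajectory that ends in $v$ has the probability
  $s_v$, and the shape process is a Markov chain that moves from $v$ to $t$ with probability $s_t / s_v$.  With
  $g(v) = s_v / p^v$ this equals $p_i g(t) / g(v)$ for $t = v + e_i$, and that these numbers have the sum $1$ means that $g$ is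
  harmonic for the killed walk.

  The survival probability $h$ is harmonic as well.  That $g$ is a multiple of $h$ is derived from the boundedness of $g$
  alone, without a formula for $g$ or $h$ (\<open>killed_harmonic_proportional_survival\<close>): extended by $0$, the function $g$ is
  subharmonic for the free walk, its means increase to a bounded harmonic function, and this is a constant $c$ by the
  theorem of Choquet and Deny (\<open>bounded_harmonic_shift_invariant\<close>).  Hence $g \<le> c$, and the mean of $c - g$ after $l$ steps
  tends to $0$, so that $g$, which is the mean of itself over the paths that survive $l$ steps, equals $c h$.

  It remains to show, for each family, that insertion is a bijection and that $g$ is bounded.

  The bijection is reduced to statements about two consecutive lines (\<open>line_insertion\<close>).  For \<open>GL\<close> and \<open>GLsuper\<close> the
  lines are columns and the tableaux are the semistandard and the hook tableaux; both are instances of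
  \<open>hook_columns\<close>.  For \<open>Queer\<close> the lines are rows and the tableaux are the semistandard decomposition tableaux, described by
  conditions on consecutive rows (\<open>adj_fun\<close>); insertion into two rows preserves and reflects these conditions
  (\<open>adj_fun_bump_bump\<close>, \<open>adj_fun_bump_stops\<close>).

  For the bound, a tableau is coded by numbers that describe its deviation from a tableau of content $v$, and each unit of
  deviation costs a factor less than $1$ because the weights decrease, apart from a bounded number of letters.  The sum over
  all tableaux is then at most a product of geometric series (\<open>sum_weight_lines_le\<close>, \<open>row_weight_le\<close>).
\<close>

section \<open>Bounded harmonic functions of the one-way walk\<close>

locale letter_law =
  fixes A :: "int set" and p :: "int \<Rightarrow> real"
  assumes finite_A: "finite A"
    and p_pos: "a \<in> A \<Longrightarrow> 0 < p a"
    and p_sum: "(\<Sum>a\<in>A. p a) = 1"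
begin

definition mean :: "(vector \<Rightarrow> real) \<Rightarrow> vector \<Rightarrow> real" where
  "mean f v = (\<Sum>a\<in>A. p a * f (v + unit_vector a))"

lemma mean_mono: "(\<And>w. f w \<le> f' w) \<Longrightarrow> mean f v \<le> mean f' v"
  unfolding mean_def by (intro sum_mono mult_left_mono) (auto simp: less_imp_le p_pos)

lemma mean_const [simp]: "mean (\<lambda>_. c) v = c"
  by (simp add: mean_def p_sum flip: sum_distrib_right)

lemma mean_diff: "mean (\<lambda>w. f w - f' w) v = mean f v - mean f' v"
  by (simp add: mean_def algebra_simps sum_subtractf)

text \<open>
  An increment \<open>D\<close> of \<open>F\<close> in the direction \<open>a\<close> is itself harmonic.  If its supremum \<open>s\<close> were positive,
  then at a point where \<open>D\<close> is nearly \<open>s\<close> it would still be nearly \<open>s\<close> after each of many further steps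
  in the direction \<open>a\<close>, and the sum of these increments would exceed the bound on \<open>F\<close>.
\<close>

lemma harmonic_shift_le:
  assumes bnd: "\<And>v. \<bar>F v\<bar> \<le> B" and harm: "\<And>v. mean F v = F v" and a: "a \<in> A"
  shows "F (v + unit_vector a) \<le> F v"
proof (rule ccontr)
  assume gt: "\<not> F (v + unit_vector a) \<le> F v"
  define D where "D w = F (w + unit_vector a) - F w" for w
  define s where "s = (SUP w. D w)"
  have Dle: "D w \<le> 2 * B" for w
    using bnd[of "w + unit_vector a"] bnd[of w] by (auto simp: D_def)
  have bdd: "bdd_above (range D)" using Dle by (auto intro!: bdd_aboveI2)
  have Ds: "D w \<le> s" for w unfolding s_def by (rule cSUP_upper[OF _ bdd]) auto
  have "0 < D v" using gt by (simp add: D_def)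
  then have s: "0 < s" using Ds[of v] by linarith
  have harmD: "D w = mean D w" for w
    unfolding D_def mean_diff using harm[of w] harm[of "w + unit_vector a"]
    by (simp add: mean_def add_ac)
  \<comment> \<open>One step in the direction \<open>a\<close> has probability \<open>p a\<close>, so it multiplies the defect by at most \<open>1 / p a\<close>.\<close>
  have step: "s - D (w + unit_vector a) \<le> (s - D w) / p a" for w
  proof -
    have "p a * (s - D (w + unit_vector a)) \<le> (\<Sum>b\<in>A. p b * (s - D (w + unit_vector b)))"
      by (rule member_le_sum) (use a finite_A Ds p_pos in \<open>auto intro!: mult_nonneg_nonneg simp: less_imp_le\<close>)
    also have "\<dots> = s - D w"
      using mean_diff[of "\<lambda>_. s" D w] harmD[of w] by (simp add: mean_def p_sum flip: sum_distrib_right)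
    finally show ?thesis using p_pos[OF a] by (simp add: field_simps)
  qed
  define sh where "sh k w = ((\<lambda>v. v + unit_vector a) ^^ k) w" for k and w :: vector
  have sh_0: "sh 0 w = w" for w by (simp add: sh_def)
  have sh_Suc: "sh (Suc k) w = sh k w + unit_vector a" for k w by (simp add: sh_def)
  have iter: "s - D (sh k w) \<le> (s - D w) / p a ^ k" for k w
  proof (induction k)
    case (Suc k)
    have "s - D (sh (Suc k) w) \<le> (s - D (sh k w)) / p a" unfolding sh_Suc by (rule step)
    also have "\<dots> \<le> (s - D w) / p a ^ k / p a"
      using Suc p_pos[OF a] by (intro divide_right_mono) auto
    finally show ?case by (simp add: field_simps)
  qed (simp add: sh_0)
  have tele: "F (sh k w) - F w = (\<Sum>i<k. D (sh i w))" for k w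
  proof (induction k)
    case (Suc k)
    then show ?case unfolding sum.lessThan_Suc sh_Suc D_def by linarith
  qed (simp add: sh_0)
  have "p a \<le> 1" using member_le_sum[of a A p] a finite_A p_pos p_sum by (auto intro: less_imp_le)
  \<comment> \<open>A total of \<open>k\<close> increments of size \<open>s / 2\<close> exceeds \<open>2 * B\<close>; the initial defect \<open>s / 2 * p a ^ k\<close> stays below \<open>s / 2\<close> that long.\<close>
  obtain k :: nat where k: "4 * B / s < real k" using reals_Archimedean2 by blast
  have "s - s / 2 * p a ^ k < s" using s p_pos[OF a] by simp
  then obtain w where w: "s - s / 2 * p a ^ k < D w"
    unfolding s_def using less_cSUP_iff[OF _ bdd] by blast
  have "s / 2 \<le> D (sh i w)" if "i < k" for i
  proof -
    have "s - D (sh i w) \<le> (s - D w) / p a ^ i" by (rule iter)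
    also have "\<dots> \<le> (s / 2 * p a ^ k) / p a ^ i"
      using w p_pos[OF a] by (intro divide_right_mono) auto
    also have "\<dots> \<le> s / 2"
      using s p_pos[OF a] that power_decreasing[of i k "p a"] \<open>p a \<le> 1\<close> by (simp add: field_simps)
    finally show ?thesis by simp
  qed
  then have "real k * (s / 2) \<le> F (sh k w) - F w"
    unfolding tele using sum_mono[of "{..<k}" "\<lambda>_. s / 2" "\<lambda>i. D (sh i w)"] by simp
  also have "\<dots> \<le> 2 * B" using bnd[of "sh k w"] bnd[of w] by linarith
  finally show False using k s by (simp add: field_simps)
qed

text \<open>
  The Choquet--Deny theorem for the one-way walk: no increment is positive, and their mean vanishes.
\<close>

theorem bounded_harmonic_shift_invariant:
  assumes bnd: "\<And>v. \<bar>F v\<bar> \<le> B" and harm: "\<And>v. mean F v = F v" and a: "a \<in> A"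
  shows "F (v + unit_vector a) = F v"
proof (rule ccontr)
  assume ne: "F (v + unit_vector a) \<noteq> F v"
  note le = harmonic_shift_le[of F B, OF bnd harm]
  have "mean F v < (\<Sum>b\<in>A. p b * F v)" unfolding mean_def
  proof (rule sum_strict_mono_ex1[OF finite_A])
    show "\<forall>b\<in>A. p b * F (v + unit_vector b) \<le> p b * F v"
      using le p_pos by (auto intro!: mult_left_mono less_imp_le)
    show "\<exists>b\<in>A. p b * F (v + unit_vector b) < p b * F v"
      using ne le[OF a, of v] p_pos[OF a] a by (intro bexI[of _ a]) auto
  qed
  then show False using harm[of v] by (simp add: p_sum flip: sum_distrib_right)
qed

text \<open>
  \<open>stay S l v\<close> is the probability that the walk started at \<open>v\<close> is in \<open>S\<close> at the times \<open>0, ..., l\<close>.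
\<close>

primrec stay :: "vector set \<Rightarrow> nat \<Rightarrow> vector \<Rightarrow> real" where
  "stay S 0 v = (if v \<in> S then 1 else 0)"
| "stay S (Suc l) v = (if v \<in> S then mean (stay S l) v else 0)"

text \<open>
  A bounded harmonic function of the walk killed outside \<open>S\<close>, extended by zero, is subharmonic for the free
  walk.  Its means after \<open>l\<close> steps therefore increase to a bounded harmonic function, which is a
  constant \<open>c\<close> on the reachable points.  So \<open>g \<le> c\<close>, while the mean of \<open>g\<close> after \<open>l\<close> steps tends to \<open>c\<close>: the
  walk ends where \<open>g\<close> is close to \<open>c\<close>, in mean.  Since \<open>g v\<close> is also the mean of \<open>g\<close> after \<open>l\<close> steps over the
  surviving paths alone, it is the limit of \<open>c\<close> times the probability of surviving.
\<close>

theorem killed_harmonic_proportional_survival: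
  assumes S0: "0 \<in> S"
    and reach: "\<And>v. v \<in> S \<Longrightarrow> v \<noteq> 0 \<Longrightarrow> \<exists>a\<in>A. \<exists>u\<in>S. v = u + unit_vector a \<and> rk u < (rk v :: nat)"
    and off: "\<And>v. v \<notin> S \<Longrightarrow> g v = 0"
    and nonneg: "\<And>v. 0 \<le> g v"
    and bnd: "\<And>v. g v \<le> B"
    and harm: "\<And>v. v \<in> S \<Longrightarrow> mean g v = g v"
  shows "\<exists>c. \<forall>v\<in>S. (\<lambda>l. c * stay S l v) \<longlonglongrightarrow> g v"
proof -
  define G where "G l = (mean ^^ l) g" for l
  have G_Suc: "G (Suc l) = mean (G l)" for l by (simp add: G_def)
  have sub: "g v \<le> mean g v" for v
  proof (cases "v \<in> S")
    case False
    have "0 \<le> mean g v" using mean_mono[of "\<lambda>_. 0" g v] nonneg by simp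
    then show ?thesis using off[OF False] by simp
  qed (simp add: harm)
  have inc: "G l v \<le> G (Suc l) v" for l v
  proof (induction l arbitrary: v)
    case (Suc l)
    show ?case
      using mean_mono[of "G l" "G (Suc l)" v, OF Suc] by (simp only: G_Suc)
  qed (use sub in \<open>simp add: G_def\<close>)
  have incs: "incseq (\<lambda>l. G l v)" for v by (rule incseq_SucI) (rule inc)
  have GB: "G l v \<le> B" for l v
  proof (induction l arbitrary: v)
    case (Suc l)
    then show ?case unfolding G_Suc using mean_mono[of "G l" "\<lambda>_. B" v] by simp
  qed (use bnd in \<open>simp add: G_def\<close>)
  have gG: "g v \<le> G l v" for l v
    using incseqD[OF incs, of 0 l v] by (simp add: G_def)
  define F where "F v = lim (\<lambda>l. G l v)" for v
  have lim: "(\<lambda>l. G l v) \<longlonglongrightarrow> F v" for v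
  proof -
    obtain L where "(\<lambda>l. G l v) \<longlonglongrightarrow> L"
      by (rule incseq_convergent[OF incs, of v B]) (use GB in auto)
    then show ?thesis unfolding F_def by (metis limI)
  qed
  have gF: "g v \<le> F v" for v by (rule LIMSEQ_le_const[OF lim]) (use gG in auto)
  have FB: "F v \<le> B" for v by (rule LIMSEQ_le_const2[OF lim]) (use GB in auto)
  have Fharm: "mean F v = F v" for v
  proof -
    have "(\<lambda>l. mean (G l) v) \<longlonglongrightarrow> mean F v"
      unfolding mean_def by (intro tendsto_intros lim)
    moreover have "(\<lambda>l. mean (G l) v) \<longlonglongrightarrow> F v"
      using LIMSEQ_Suc[OF lim[of v]] by (simp add: G_Suc)
    ultimately show ?thesis by (rule LIMSEQ_unique)
  qed
  have abs: "\<bar>F v\<bar> \<le> B" for v using gF[of v] nonneg[of v] FB[of v] by linarith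
  define c where "c = F 0"
  have Fc: "F v = c" if "v \<in> S" for v
    using that
  proof (induction "rk v" arbitrary: v rule: less_induct)
    case less
    show ?case
    proof (cases "v = 0")
      case False
      then obtain a u where "a \<in> A" "u \<in> S" "v = u + unit_vector a" "rk u < rk v"
        using reach[OF less.prems] by blast
      then show ?thesis
        using less.hyps[of u] bounded_harmonic_shift_invariant[of F B a u, OF abs Fharm] by simp
    qed (simp add: c_def)
  qed
  have Gc: "G l v \<le> c" if "F v = c" for l v
    using incseq_le[OF incs lim, of l v] that by simp
  have shift: "F (v + unit_vector a) = c" if "F v = c" "a \<in> A" for v a
    using bounded_harmonic_shift_invariant[of F B, OF abs Fharm that(2)] that(1) by simp
  have c0: "0 \<le> c" using gF[of 0] nonneg[of 0] by (simp add: c_def)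
  \<comment> \<open>The killed mean of \<open>c * 1\<^sub>S - g\<close> lies between \<open>0\<close> and the free mean of \<open>c - g\<close>.\<close>
  have est: "0 \<le> c * stay S l v - g v \<and> c * stay S l v - g v \<le> c - G l v" if "F v = c" for l v
    using that
  proof (induction l arbitrary: v)
    case 0
    then show ?case using off[of v] gF[of v] c0 by (auto simp: G_def)
  next
    case (Suc l)
    show ?case
    proof (cases "v \<in> S")
      case True
      have IH: "0 \<le> c * stay S l (v + unit_vector a) - g (v + unit_vector a) \<and>
          c * stay S l (v + unit_vector a) - g (v + unit_vector a) \<le> c - G l (v + unit_vector a)"
        if "a \<in> A" for a
        using Suc.IH[OF shift[OF Suc.prems that]] .
      have "c * stay S (Suc l) v - g v
          = (\<Sum>a\<in>A. p a * (c * stay S l (v + unit_vector a) - g (v + unit_vector a)))"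
        using True harm[OF True] by (simp add: mean_def sum_distrib_left sum_subtractf algebra_simps)
      moreover have "\<dots> \<le> (\<Sum>a\<in>A. p a * (c - G l (v + unit_vector a)))"
        using IH p_pos by (intro sum_mono mult_left_mono) (auto intro: less_imp_le)
      moreover have "\<dots> = c - G (Suc l) v"
        unfolding G_Suc by (simp add: mean_def sum_subtractf right_diff_distrib p_sum flip: sum_distrib_right)
      moreover have "0 \<le> (\<Sum>a\<in>A. p a * (c * stay S l (v + unit_vector a) - g (v + unit_vector a)))"
        using IH p_pos by (intro sum_nonneg mult_nonneg_nonneg) (auto intro: less_imp_le)
      ultimately show ?thesis by simp
    next
      case False
      then show ?thesis using off[of v] Gc[OF Suc.prems] by auto
    qed
  qed
  have "(\<lambda>l. c * stay S l v) \<longlonglongrightarrow> g v" if "v \<in> S" for v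
  proof -
    have "(\<lambda>l. c - G l v) \<longlonglongrightarrow> c - F v" by (intro tendsto_intros lim)
    then have z: "(\<lambda>l. c - G l v) \<longlonglongrightarrow> 0" using Fc[OF that] by simp
    have "(\<lambda>l. c * stay S l v - g v) \<longlonglongrightarrow> 0"
      by (rule tendsto_sandwich[OF _ _ tendsto_const z]) (use est Fc[OF that] in auto)
    then show ?thesis by (simp add: LIM_zero_iff)
  qed
  then show ?thesis by blast
qed
end


section \<open>Cylinder events and survival\<close>

context letter_law
begin

abbreviation letters :: "int measure" where
  "letters \<equiv> point_measure A (\<lambda>a. ennreal (p a))"

abbreviation sequences :: "(nat \<Rightarrow> int) measure" where
  "sequences \<equiv> PiM UNIV (\<lambda>_. letters)"

definition words :: "nat \<Rightarrow> int list set" where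
  "words l = {w. set w \<subseteq> A \<and> length w = l}"

definition weight :: "int list \<Rightarrow> real" where
  "weight w = prod_list (map p w)"

lemma finite_words: "finite (words l)"
  unfolding words_def by (rule finite_lists_length_eq[OF finite_A])

lemma weight_simps [simp]: "weight [] = 1" "weight (a # w) = p a * weight w"
  "weight (v @ w) = weight v * weight w"
  by (simp_all add: weight_def)

lemma weight_pos: "set w \<subseteq> A \<Longrightarrow> 0 < weight w"
  by (induction w) (auto simp: p_pos)

lemma weight_mset: "mset v = mset w \<Longrightarrow> weight v = weight w"
  by (simp add: weight_def flip: prod_mset_prod_list)

lemma words_0 [simp]: "words 0 = {[]}"
  by (auto simp: words_def)

lemma sum_words_Cons: "(\<Sum>w\<in>words (Suc l). f w) = (\<Sum>a\<in>A. \<Sum>w\<in>words l. f (a # w))"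
proof -
  have "words (Suc l) = (\<lambda>(a, w). a # w) ` (A \<times> words l)"
    by (auto simp: words_def length_Suc_conv)
  then have "(\<Sum>w\<in>words (Suc l). f w) = (\<Sum>(a, w)\<in>A \<times> words l. f (a # w))"
    by (simp add: sum.reindex inj_on_def split_def)
  then show ?thesis by (simp add: sum.cartesian_product)
qed

lemma sum_words_snoc: "(\<Sum>w\<in>words (Suc l). f w) = (\<Sum>w\<in>words l. \<Sum>a\<in>A. f (w @ [a]))"
proof -
  have "words (Suc l) = (\<lambda>(w, a). w @ [a]) ` (words l \<times> A)"
    by (auto simp: words_def length_Suc_conv_rev image_iff)
  then have "(\<Sum>w\<in>words (Suc l). f w) = (\<Sum>(w, a)\<in>words l \<times> A. f (w @ [a]))"
    by (simp add: sum.reindex inj_on_def split_def)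
  then show ?thesis by (simp add: sum.cartesian_product)
qed

sublocale seq: product_prob_space "\<lambda>_. letters" "UNIV :: nat set"
proof -
  interpret prob_space letters
    by (rule prob_space_point_measure)
      (use finite_A p_sum p_pos in \<open>auto simp: sum_ennreal less_imp_le\<close>)
  show "product_prob_space (\<lambda>_. letters)"
    by unfold_locales
qed

lemma space_sequences: "space sequences = {\<omega>. \<forall>i. \<omega> i \<in> A}"
  by (auto simp: space_PiM space_point_measure)

lemma cylinder_eq:
  assumes "length w = l"
  shows "{\<omega> \<in> space sequences. map \<omega> [0..<l] = w} = {\<omega> \<in> space sequences. \<forall>i\<in>{..<l}. \<omega> i \<in> {w ! i}}"
  using assms by (auto simp: list_eq_iff_nth_eq)

lemma cylinder_sets:
  assumes "w \<in> words l"
  shows "{\<omega> \<in> space sequences. map \<omega> [0..<l] = w} \<in> sets sequences"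
proof -
  have "{\<omega> \<in> space sequences. \<forall>i\<in>{..<l}. \<omega> i \<in> {w ! i}} \<in> sets sequences"
  proof (rule sets.sets_Collect_finite_All)
    fix i assume "i \<in> {..<l}"
    then have "{w ! i} \<in> sets letters" using assms by (auto simp: words_def sets_point_measure)
    from measurable_sets[OF measurable_component_singleton[of i UNIV "\<lambda>_. letters"] this]
    show "{\<omega> \<in> space sequences. \<omega> i \<in> {w ! i}} \<in> sets sequences"
      by (simp add: vimage_def Int_def conj_commute)
  qed simp
  then show ?thesis using assms by (subst cylinder_eq) (auto simp: words_def)
qed

lemma cylinder_prob:
  assumes "w \<in> words l"
  shows "\<P>(\<omega> in sequences. map \<omega> [0..<l] = w) = weight w"
proof -
  have w: "length w = l" "\<And>i. i < l \<Longrightarrow> w ! i \<in> A" using assms by (auto simp: words_def)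
  have "emeasure sequences {\<omega> \<in> space sequences. map \<omega> [0..<l] = w} = (\<Prod>i<l. emeasure letters {w ! i})"
    unfolding cylinder_eq[OF w(1)] using w
    by (intro seq.emeasure_PiM_Collect) (auto simp: sets_point_measure)
  also have "\<dots> = (\<Prod>i<l. ennreal (p (w ! i)))"
    using w by (intro prod.cong) (auto simp: emeasure_point_measure_finite[OF finite_A])
  also have "\<dots> = ennreal (\<Prod>i<l. p (w ! i))"
    using w p_pos by (intro prod_ennreal) (auto simp: less_imp_le)
  also have "(\<Prod>i<l. p (w ! i)) = weight w"
    using w(1) by (simp add: weight_def prod.list_conv_set_nth atLeast0LessThan)
  finally show ?thesis
    using weight_pos[of w] assms by (simp add: measure_def words_def)
qed

lemma word_event:
  shows "{\<omega> \<in> space sequences. Q (map \<omega> [0..<l])} \<in> sets sequences" (is ?m)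
    and "\<P>(\<omega> in sequences. Q (map \<omega> [0..<l])) = (\<Sum>w\<in>words l. if Q w then weight w else 0)" (is ?p)
proof -
  let ?C = "\<lambda>w. {\<omega> \<in> space sequences. map \<omega> [0..<l] = w}"
  have eq: "{\<omega> \<in> space sequences. Q (map \<omega> [0..<l])} = (\<Union>w\<in>{w \<in> words l. Q w}. ?C w)"
    by (auto simp: words_def space_sequences)
  show ?m unfolding eq by (intro sets.finite_UN) (auto simp: finite_words cylinder_sets)
  have "measure sequences (\<Union>w\<in>{w \<in> words l. Q w}. ?C w) = (\<Sum>w\<in>{w \<in> words l. Q w}. measure sequences (?C w))"
    by (intro seq.P.finite_measure_finite_Union)
      (auto simp: finite_words disjoint_family_on_def image_subset_iff cylinder_sets)
  also have "\<dots> = (\<Sum>w\<in>{w \<in> words l. Q w}. weight w)"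
    by (intro sum.cong) (auto simp: cylinder_prob)
  finally show ?p unfolding eq by (simp add: sum.inter_filter finite_words)
qed

primrec stays :: "vector set \<Rightarrow> vector \<Rightarrow> int list \<Rightarrow> bool" where
  "stays S u [] \<longleftrightarrow> u \<in> S"
| "stays S u (a # w) \<longleftrightarrow> u \<in> S \<and> stays S (u + unit_vector a) w"

lemma sum_stays: "(\<Sum>w\<in>words l. if stays S u w then weight w else 0) = stay S l u"
proof (induction l arbitrary: u)
  case (Suc l)
  have "(\<Sum>w\<in>words (Suc l). if stays S u w then weight w else 0)
      = (if u \<in> S then \<Sum>a\<in>A. p a * (\<Sum>w\<in>words l. if stays S (u + unit_vector a) w then weight w else 0) else 0)"
    by (auto simp: sum_words_Cons sum_distrib_left intro!: sum.cong)
  then show ?case by (simp only: Suc.IH stay.simps mean_def)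
qed simp

lemma stays_iff: "stays S u (map \<omega> [i..<i + l]) \<longleftrightarrow>
    (\<forall>k\<le>l. u + (\<Sum>j\<in>{i..<i + k}. unit_vector (\<omega> j)) \<in> S)"
proof (induction l arbitrary: u i)
  case (Suc l)
  have "stays S u (map \<omega> [i..<i + Suc l]) \<longleftrightarrow> u \<in> S \<and> stays S (u + unit_vector (\<omega> i)) (map \<omega> [Suc i..<Suc i + l])"
    by (subst upt_conv_Cons) auto
  also have "\<dots> \<longleftrightarrow> u \<in> S \<and> (\<forall>k\<le>l. u + (\<Sum>j\<in>{i..<i + Suc k}. unit_vector (\<omega> j)) \<in> S)"
  proof -
    have "(\<Sum>j\<in>{i..<i + Suc k}. unit_vector (\<omega> j)) =
        unit_vector (\<omega> i) + (\<Sum>j\<in>{Suc i..<Suc i + k}. unit_vector (\<omega> j))" for k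
      using sum.atLeast_Suc_lessThan[of i "i + Suc k" "\<lambda>j. unit_vector (\<omega> j)"] by simp
    then show ?thesis unfolding Suc.IH by (simp only: add.assoc)
  qed
  also have "\<dots> \<longleftrightarrow> (\<forall>k\<le>Suc l. u + (\<Sum>j\<in>{i..<i + k}. unit_vector (\<omega> j)) \<in> S)"
  proof safe
    fix k assume "u \<in> S" "\<forall>k\<le>l. u + (\<Sum>j\<in>{i..<i + Suc k}. unit_vector (\<omega> j)) \<in> S" "k \<le> Suc l"
    then show "u + (\<Sum>j\<in>{i..<i + k}. unit_vector (\<omega> j)) \<in> S" by (cases k) auto
  qed force+
  finally show ?case .
qed simp

text \<open>
  Surviving forever is the decreasing intersection of the events of surviving \<open>l\<close> steps.
\<close>

lemma survival_limit:
  "(\<lambda>l. stay S l u) \<longlonglongrightarrow> \<P>(\<omega> in sequences. \<forall>l. u + walk l \<omega> \<in> S)"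
proof -
  let ?E = "\<lambda>l. {\<omega> \<in> space sequences. stays S u (map \<omega> [0..<l])}"
  have st: "stays S u (map \<omega> [0..<l]) \<longleftrightarrow> (\<forall>k\<le>l. u + walk k \<omega> \<in> S)" for l \<omega>
    using stays_iff[of S u \<omega> 0 l] by (simp add: walk_def atLeast0LessThan)
  have "(\<lambda>l. measure sequences (?E l)) \<longlonglongrightarrow> measure sequences (\<Inter>l. ?E l)"
  proof (rule seq.P.finite_Lim_measure_decseq)
    show "range ?E \<subseteq> sets sequences" using word_event(1) by blast
    show "decseq ?E" unfolding decseq_def st by auto
  qed
  moreover have "(\<Inter>l. ?E l) = {\<omega> \<in> space sequences. \<forall>l. u + walk l \<omega> \<in> S}"
    by (auto simp: st)
  moreover have "measure sequences (?E l) = stay S l u" for l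
    using word_event(2)[of "stays S u" l] sum_stays[of S u l] by simp
  ultimately show ?thesis by simp
qed

end


section \<open>From an insertion bijection to the conditioned walk\<close>

lemma unit_vector_inj: "unit_vector a = unit_vector b \<longleftrightarrow> a = b"
  by (metis unit_vector_def zero_neq_one)

text \<open>
  What the argument needs from an insertion: it is a bijection from the pairs of a tableau of shape \<open>v\<close> and a
  letter onto the tableaux whose shape is obtained from \<open>v\<close> by adding a box, it adds the letter to the content, and
  the weights of the tableaux of shape \<open>v\<close> sum up to at most a constant times the monomial of \<open>v\<close>.
\<close>

locale tableau_insertion = letter_law "alphabet d" p
  for d :: family and p :: "int \<Rightarrow> real" +
  fixes Tab :: "vector \<Rightarrow> tableau set"
  assumes zero_state: "0 \<in> partitions_of d"
    and Tab_zero: "Tab 0 = {[]}"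
    and state_nonneg: "v \<in> partitions_of d \<Longrightarrow> a \<in> alphabet d \<Longrightarrow> 0 \<le> v a"
    and predecessor: "v \<in> partitions_of d \<Longrightarrow> v \<noteq> 0 \<Longrightarrow>
      \<exists>u\<in>partitions_of d. \<exists>a\<in>alphabet d. v = u + unit_vector a"
    and Tab_finite: "v \<in> partitions_of d \<Longrightarrow> finite (Tab v)"
    and Tab_nonempty: "v \<in> partitions_of d \<Longrightarrow> Tab v \<noteq> {}"
    and Tab_shape: "v \<in> partitions_of d \<Longrightarrow> T \<in> Tab v \<Longrightarrow> shape d T = v"
    and Tab_letters: "v \<in> partitions_of d \<Longrightarrow> T \<in> Tab v \<Longrightarrow> set (concat T) \<subseteq> alphabet d"
    and insertion_letters: "v \<in> partitions_of d \<Longrightarrow> T \<in> Tab v \<Longrightarrow> x \<in> alphabet d \<Longrightarrow>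
      mset (concat (insertion d x T)) = mset (concat T) + {#x#}"
    and insertion_closed: "v \<in> partitions_of d \<Longrightarrow> T \<in> Tab v \<Longrightarrow> x \<in> alphabet d \<Longrightarrow>
      \<exists>a\<in>alphabet d. v + unit_vector a \<in> partitions_of d \<and> insertion d x T \<in> Tab (v + unit_vector a)"
    and insertion_inj: "v \<in> partitions_of d \<Longrightarrow> T \<in> Tab v \<Longrightarrow> x \<in> alphabet d \<Longrightarrow>
      T' \<in> Tab v \<Longrightarrow> x' \<in> alphabet d \<Longrightarrow> insertion d x T = insertion d x' T' \<Longrightarrow> T = T' \<and> x = x'"
    and insertion_surj: "v \<in> partitions_of d \<Longrightarrow> a \<in> alphabet d \<Longrightarrow>
      v + unit_vector a \<in> partitions_of d \<Longrightarrow> T' \<in> Tab (v + unit_vector a) \<Longrightarrow>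
      \<exists>T\<in>Tab v. \<exists>x\<in>alphabet d. insertion d x T = T'"
    and weight_bound: "\<exists>K. \<forall>v\<in>partitions_of d.
      (\<Sum>T\<in>Tab v. weight (concat T)) \<le> K * (\<Prod>a\<in>alphabet d. p a ^ nat (v a))"
begin

definition schur :: "vector \<Rightarrow> real" where
  "schur v = (\<Sum>T\<in>Tab v. weight (concat T))"

definition monomial :: "vector \<Rightarrow> real" where
  "monomial v = (\<Prod>a\<in>alphabet d. p a ^ nat (v a))"

definition covers :: "vector \<Rightarrow> vector \<Rightarrow> bool" where
  "covers v t \<longleftrightarrow> t \<in> partitions_of d \<and> (\<exists>a\<in>alphabet d. t = v + unit_vector a)"

lemma schur_pos: "v \<in> partitions_of d \<Longrightarrow> 0 < schur v"
  unfolding schur_def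
  by (intro sum_pos Tab_finite Tab_nonempty weight_pos Tab_letters)

lemma monomial_pos: "0 < monomial v"
  unfolding monomial_def by (intro prod_pos) (simp add: p_pos)

lemma monomial_step:
  assumes "v \<in> partitions_of d" "a \<in> alphabet d"
  shows "monomial (v + unit_vector a) = p a * monomial v"
proof -
  have "monomial (v + unit_vector a) = p a ^ nat (v a + 1) * (\<Prod>b\<in>alphabet d - {a}. p b ^ nat (v b))"
    unfolding monomial_def prod.remove[OF finite_A assms(2)]
    by (intro arg_cong2[of _ _ _ _ "(*)"] prod.cong) (auto simp: unit_vector_def)
  moreover have "nat (v a + 1) = Suc (nat (v a))" using state_nonneg[OF assms] by simp
  ultimately show ?thesis by (simp add: monomial_def prod.remove[OF finite_A assms(2)])
qed

definition boxes :: "vector \<Rightarrow> nat" where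
  "boxes v = nat (\<Sum>a\<in>alphabet d. v a)"

lemma boxes_step:
  assumes "v \<in> partitions_of d" "a \<in> alphabet d"
  shows "boxes (v + unit_vector a) = Suc (boxes v)"
proof -
  have "(\<Sum>b\<in>alphabet d. (v + unit_vector a) b) = (\<Sum>b\<in>alphabet d. v b) + 1"
    using assms(2) finite_A by (simp add: sum.distrib unit_vector_def)
  moreover have "0 \<le> (\<Sum>b\<in>alphabet d. v b)" by (intro sum_nonneg state_nonneg assms)
  ultimately show ?thesis by (simp add: boxes_def)
qed

lemma boxes_zero: "boxes 0 = 0"
  by (simp add: boxes_def)

lemma insertion_shape:
  assumes "v \<in> partitions_of d" "T \<in> Tab v" "x \<in> alphabet d"
  shows "covers v (shape d (insertion d x T))" "insertion d x T \<in> Tab (shape d (insertion d x T))"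
  using insertion_closed[OF assms] Tab_shape by (auto simp: covers_def)

lemma weight_insertion:
  assumes "v \<in> partitions_of d" "T \<in> Tab v" "x \<in> alphabet d"
  shows "weight (concat (insertion d x T)) = p x * weight (concat T)"
  using weight_mset[of "concat (insertion d x T)" "x # concat T"] insertion_letters[OF assms] by simp

text \<open>
  The bijection sorted by the shape of the result.  Summing over all shapes gives the rule of Pieri below.
\<close>

lemma pieri_cover:
  assumes v: "v \<in> partitions_of d"
  shows "(\<Sum>T\<in>Tab v. \<Sum>x\<in>alphabet d. if shape d (insertion d x T) = t then p x * weight (concat T) else 0)
    = (if covers v t then schur t else 0)"
proof (cases "covers v t")
  case True
  then obtain a where a: "a \<in> alphabet d" "t = v + unit_vector a" and t: "t \<in> partitions_of d"
    by (auto simp: covers_def)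
  let ?X = "{(T, x). T \<in> Tab v \<and> x \<in> alphabet d \<and> shape d (insertion d x T) = t}"
  let ?f = "\<lambda>(T, x). insertion d x T"
  have inj: "inj_on ?f ?X" using insertion_inj[OF v] by (auto simp: inj_on_def)
  have img: "?f ` ?X = Tab t"
  proof safe
    fix T x assume "T \<in> Tab v" "x \<in> alphabet d"
    then show "insertion d x T \<in> Tab (shape d (insertion d x T))" by (rule insertion_shape[OF v])
  next
    fix T' assume "T' \<in> Tab t"
    then show "T' \<in> ?f ` ?X"
      using insertion_surj[OF v a(1)] a t Tab_shape[OF t] by (force simp: image_iff)
  qed
  have "schur t = (\<Sum>(T, x)\<in>?X. weight (concat (insertion d x T)))"
    unfolding schur_def img[symmetric] by (subst sum.reindex[OF inj]) (simp add: split_def)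
  also have "\<dots> = (\<Sum>(T, x)\<in>?X. p x * weight (concat T))"
    by (intro sum.cong refl) (auto simp: weight_insertion[OF v])
  also have "\<dots> = (\<Sum>(T, x)\<in>Tab v \<times> alphabet d.
      if shape d (insertion d x T) = t then p x * weight (concat T) else 0)"
    by (rule sum.mono_neutral_cong_left)
      (auto intro: finite_cartesian_product Tab_finite[OF v] finite_A split: if_splits)
  finally show ?thesis using True by (simp add: sum.cartesian_product)
next
  case False
  then show ?thesis using insertion_shape(1)[OF v] by (auto intro!: sum.neutral)
qed


definition history :: "int list \<Rightarrow> vector list" where
  "history w = map (\<lambda>k. shape d (P_tableau d (take k w))) [0..<Suc (length w)]"

lemma P_tableau_Nil [simp]: "P_tableau d [] = []"
  by (simp add: P_tableau_def)

lemma P_tableau_snoc [simp]: "P_tableau d (w @ [x]) = insertion d x (P_tableau d w)"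
  by (simp add: P_tableau_def)

lemma shape_Nil: "shape d [] = 0"
  using Tab_shape[OF zero_state] Tab_zero by simp

lemma zero_Tab: "[] \<in> Tab 0"
  by (simp add: Tab_zero)

lemma history_Nil [simp]: "history [] = [0]"
  by (simp add: history_def shape_Nil)

lemma history_snoc: "history (w @ [x]) = history w @ [shape d (P_tableau d (w @ [x]))]"
proof -
  have "map (\<lambda>k. shape d (P_tableau d (take k (w @ [x])))) [0..<Suc (length w)] = history w"
    unfolding history_def by (intro map_cong) auto
  then show ?thesis unfolding history_def by simp
qed

lemma history_last: "last (history w) = shape d (P_tableau d w)"
  by (simp add: history_def)

lemma words_snoc_iff: "w @ [x] \<in> words (Suc l) \<longleftrightarrow> w \<in> words l \<and> x \<in> alphabet d"
  by (auto simp: words_def)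

lemma words_Suc_cases:
  assumes "w \<in> words (Suc l)"
  obtains u x where "w = u @ [x]" "u \<in> words l" "x \<in> alphabet d"
  using assms by (cases w rule: rev_exhaust) (auto simp: words_def)

lemma P_tableau_in_Tab:
  assumes "w \<in> words l"
  shows "shape d (P_tableau d w) \<in> partitions_of d" "P_tableau d w \<in> Tab (shape d (P_tableau d w))"
    and "boxes (shape d (P_tableau d w)) = l"
proof -
  have "shape d (P_tableau d w) \<in> partitions_of d \<and> P_tableau d w \<in> Tab (shape d (P_tableau d w))
    \<and> boxes (shape d (P_tableau d w)) = l"
    using assms
  proof (induction l arbitrary: w)
    case 0
    then have "w = []" by simp
    show ?case unfolding \<open>w = []\<close> P_tableau_Nil shape_Nil
      using zero_state zero_Tab boxes_zero by blast
  next
    case (Suc l)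
    from words_Suc_cases[OF Suc.prems] obtain u x
      where u: "w = u @ [x]" "u \<in> words l" "x \<in> alphabet d" .
    have IH: "shape d (P_tableau d u) \<in> partitions_of d"
      "P_tableau d u \<in> Tab (shape d (P_tableau d u))" "boxes (shape d (P_tableau d u)) = l"
      using Suc.IH[OF u(2)] by auto
    note ins = insertion_shape[OF IH(1,2) u(3)]
    obtain a where a: "a \<in> alphabet d"
      "shape d (insertion d x (P_tableau d u)) = shape d (P_tableau d u) + unit_vector a"
      using ins(1) by (auto simp: covers_def)
    have "boxes (shape d (insertion d x (P_tableau d u))) = Suc l"
      unfolding a(2) boxes_step[OF IH(1) a(1)] IH(3) ..
    then show ?case using ins u(1) by (auto simp: covers_def)
  qed
  then show "shape d (P_tableau d w) \<in> partitions_of d" "P_tableau d w \<in> Tab (shape d (P_tableau d w))"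
    "boxes (shape d (P_tableau d w)) = l" by auto
qed

text \<open>
  A tableau together with the trajectory of its shape determines the word, because each letter can be extracted
  again when the box that it added is known.  This replaces the recording tableau.
\<close>

theorem words_with_history_bij:
  assumes "w0 \<in> words l"
  shows "bij_betw (P_tableau d) {w \<in> words l. history w = history w0} (Tab (shape d (P_tableau d w0)))"
  using assms
proof (induction l arbitrary: w0)
  case 0
  have "{w \<in> words 0. history w = history w0} = {[]}" using 0 by auto
  moreover have "w0 = []" using 0 by simp
  ultimately show ?case by (simp only: P_tableau_Nil shape_Nil Tab_zero) (simp add: bij_betw_def)
next
  case (Suc l)
  from words_Suc_cases[OF Suc.prems] obtain u0 x0
    where u0: "w0 = u0 @ [x0]" "u0 \<in> words l" "x0 \<in> alphabet d" .
  define v where "v = shape d (P_tableau d u0)"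
  define t where "t = shape d (P_tableau d w0)"
  have v: "v \<in> partitions_of d" using P_tableau_in_Tab[OF u0(2)] by (simp add: v_def)
  note IH = Suc.IH[OF u0(2), folded v_def]
  have cov: "covers v t"
    using insertion_shape(1)[OF v _ u0(3)] P_tableau_in_Tab[OF u0(2)] u0(1) by (simp add: v_def t_def)
  have hist: "history (u @ [x]) = history w0 \<longleftrightarrow> history u = history u0 \<and> shape d (P_tableau d (u @ [x])) = t" for u x
    by (auto simp: u0(1) history_snoc t_def)
  have inTab: "P_tableau d u \<in> Tab v" if "u \<in> words l" "history u = history u0" for u
    using IH that by (auto simp: bij_betw_def)
  show ?case unfolding bij_betw_def t_def[symmetric]
  proof
    show "inj_on (P_tableau d) {w \<in> words (Suc l). history w = history w0}"
    proof (rule inj_onI, clarify)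
      fix w w' assume w: "w \<in> words (Suc l)" "history w = history w0"
        and w': "w' \<in> words (Suc l)" "history w' = history w0" and eq: "P_tableau d w = P_tableau d w'"
      from words_Suc_cases[OF w(1)] obtain u x where u: "w = u @ [x]" "u \<in> words l" "x \<in> alphabet d" .
      from words_Suc_cases[OF w'(1)] obtain u' x' where u': "w' = u' @ [x']" "u' \<in> words l" "x' \<in> alphabet d" .
      have h: "history u = history u0" "history u' = history u0" using w w' u u' hist by auto
      have "P_tableau d u = P_tableau d u' \<and> x = x'"
        using insertion_inj[OF v inTab[OF u(2) h(1)] u(3) inTab[OF u'(2) h(2)] u'(3)] eq u u' by simp
      moreover have "inj_on (P_tableau d) {w \<in> words l. history w = history u0}"
        using IH by (simp add: bij_betw_def)
      ultimately show "w = w'" using u u' h by (auto dest: inj_onD)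
    qed
    show "P_tableau d ` {w \<in> words (Suc l). history w = history w0} = Tab t"
    proof safe
      fix w assume w: "w \<in> words (Suc l)" "history w = history w0"
      have "shape d (P_tableau d w) = t" using w(2) history_last[of w] history_last[of w0] by (simp add: t_def)
      then show "P_tableau d w \<in> Tab t" using P_tableau_in_Tab[OF w(1)] by simp
    next
      fix T' assume T': "T' \<in> Tab t"
      obtain a where a: "a \<in> alphabet d" "t = v + unit_vector a" "t \<in> partitions_of d"
        using cov by (auto simp: covers_def)
      obtain T x where T: "T \<in> Tab v" "x \<in> alphabet d" "insertion d x T = T'"
        using insertion_surj[OF v a(1)] a T' by metis
      obtain u where u: "u \<in> words l" "history u = history u0" "P_tableau d u = T"
        using T(1) unfolding bij_betw_imp_surj_on[OF IH, symmetric] by blast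
      have "u @ [x] \<in> words (Suc l)" "history (u @ [x]) = history w0" "P_tableau d (u @ [x]) = T'"
        using u T Tab_shape[OF a(3) T'] by (auto simp: words_snoc_iff hist)
      then show "T' \<in> P_tableau d ` {w \<in> words (Suc l). history w = history w0}" by blast
    qed
  qed
qed

lemma weight_P_tableau: "w \<in> words l \<Longrightarrow> weight (concat (P_tableau d w)) = weight w"
proof (induction l arbitrary: w)
  case (Suc l)
  from words_Suc_cases[OF Suc.prems] obtain u x where u: "w = u @ [x]" "u \<in> words l" "x \<in> alphabet d" .
  then show ?case using weight_insertion[OF P_tableau_in_Tab(1,2)[OF u(2)] u(3)] Suc.IH by simp
qed simp

text \<open>
  A trajectory has a probability that depends on its last shape only, which makes the shape process a Markov
  chain.
\<close>

lemma history_sums: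
  assumes "w0 \<in> words l"
  defines "v \<equiv> shape d (P_tableau d w0)"
  shows "(\<Sum>w | w \<in> words l \<and> history w = history w0. weight w) = schur v"
    and "(\<Sum>w | w \<in> words l \<and> history w = history w0.
        \<Sum>x\<in>alphabet d. if shape d (P_tableau d (w @ [x])) = t then weight (w @ [x]) else 0)
      = (if covers v t then schur t else 0)"
proof -
  have v: "v \<in> partitions_of d" using P_tableau_in_Tab[OF assms(1)] by (simp add: v_def)
  note bij = words_with_history_bij[OF assms(1), folded v_def]
  show "(\<Sum>w | w \<in> words l \<and> history w = history w0. weight w) = schur v"
    unfolding schur_def sum.reindex_bij_betw[OF bij, symmetric]
    by (intro sum.cong) (auto simp: weight_P_tableau)
  show "(\<Sum>w | w \<in> words l \<and> history w = history w0.
        \<Sum>x\<in>alphabet d. if shape d (P_tableau d (w @ [x])) = t then weight (w @ [x]) else 0)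
      = (if covers v t then schur t else 0)"
    unfolding pieri_cover[OF v, symmetric] sum.reindex_bij_betw[OF bij, symmetric]
    by (intro sum.cong) (auto simp: weight_P_tableau)
qed

definition shape_matrix :: "vector \<Rightarrow> vector \<Rightarrow> real" where
  "shape_matrix v t = (if covers v t then schur t / schur v else 0)"

abbreviation X :: "nat \<Rightarrow> (nat \<Rightarrow> int) \<Rightarrow> vector" where
  "X \<equiv> shape_process d"

lemma event_now:
  "\<P>(\<omega> in sequences. Q (map \<omega> [0..<l])) = (\<Sum>w | w \<in> words l \<and> Q w. weight w)"
  by (simp add: word_event(2) sum.inter_filter finite_words)

lemma event_next:
  "\<P>(\<omega> in sequences. X (Suc l) \<omega> = t \<and> Q (map \<omega> [0..<l]))
    = (\<Sum>w | w \<in> words l \<and> Q w. \<Sum>x\<in>alphabet d.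
        if shape d (P_tableau d (w @ [x])) = t then weight (w @ [x]) else 0)"
proof -
  let ?R = "\<lambda>w. shape d (P_tableau d w) = t \<and> Q (butlast w)"
  have "\<P>(\<omega> in sequences. X (Suc l) \<omega> = t \<and> Q (map \<omega> [0..<l])) = \<P>(\<omega> in sequences. ?R (map \<omega> [0..<Suc l]))"
    by (simp add: shape_process_def)
  also have "\<dots> = (\<Sum>w\<in>words l. \<Sum>x\<in>alphabet d. if ?R (w @ [x]) then weight (w @ [x]) else 0)"
    unfolding word_event(2)[of ?R "Suc l"] sum_words_snoc ..
  also have "\<dots> = (\<Sum>w\<in>words l. if Q w then (\<Sum>x\<in>alphabet d.
        if shape d (P_tableau d (w @ [x])) = t then weight (w @ [x]) else 0) else 0)"
    by (intro sum.cong) auto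
  finally show ?thesis by (simp add: sum.inter_filter finite_words del: P_tableau_snoc)
qed

lemma process_history: "(\<forall>k\<le>l. X k \<omega> = s k) \<longleftrightarrow> history (map \<omega> [0..<l]) = map s [0..<Suc l]"
proof -
  have "history (map \<omega> [0..<l]) = map (\<lambda>k. X k \<omega>) [0..<Suc l]"
    unfolding history_def shape_process_def
    by (auto simp: take_map simp del: upt_Suc intro!: map_cong)
  then show ?thesis by (auto simp: list_eq_iff_nth_eq less_Suc_eq_le simp del: upt_Suc)
qed

lemma conditional_on_history:
  assumes pos: "0 < \<P>(\<omega> in sequences. \<forall>k\<le>l. X k \<omega> = s k)"
  shows "\<P>(\<omega> in sequences. X (Suc l) \<omega> = t \<bar> \<forall>k\<le>l. X k \<omega> = s k) = shape_matrix (s l) t"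
proof -
  let ?h = "map s [0..<Suc l]"
  have "{w. w \<in> words l \<and> history w = ?h} \<noteq> {}"
  proof
    assume "{w. w \<in> words l \<and> history w = ?h} = {}"
    then show False using pos
      unfolding process_history event_now[of "\<lambda>w. history w = ?h"] by (simp only: sum.empty)
  qed
  then obtain w0 where w0: "w0 \<in> words l" "history w0 = ?h" by auto
  have last: "shape d (P_tableau d w0) = s l" using history_last[of w0] w0 by simp
  show ?thesis
    unfolding cond_prob_def process_history event_now[of "\<lambda>w. history w = ?h"]
      event_next[of l t "\<lambda>w. history w = ?h"]
    using history_sums[OF w0(1)] w0(2) by (simp add: last shape_matrix_def)
qed

text \<open>
  A state is visited at exactly one time, its number of boxes.  So the least time in the definition of the
  transition matrix exists and is this number.
\<close>

lemma visited:
  assumes "v \<in> partitions_of d"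
  shows "\<exists>w\<in>words (boxes v). shape d (P_tableau d w) = v"
  using assms
proof (induction "boxes v" arbitrary: v)
  case (0 v)
  have "v = 0"
  proof (rule ccontr)
    assume "v \<noteq> 0"
    then obtain u a where "u \<in> partitions_of d" "a \<in> alphabet d" "v = u + unit_vector a"
      using predecessor[OF 0(2)] by blast
    then show False using boxes_step 0(1) by (metis nat.distinct(1))
  qed
  then have "shape d (P_tableau d []) = v" by (simp only: P_tableau_Nil shape_Nil)
  moreover have "[] \<in> words (boxes v)" using 0(1) by simp
  ultimately show ?case by blast
next
  case (Suc l v)
  have "v \<noteq> 0" using Suc(2) boxes_zero by auto
  then obtain u a where u: "u \<in> partitions_of d" "a \<in> alphabet d" "v = u + unit_vector a"
    using predecessor[OF Suc(3)] by blast
  then have l: "boxes u = l" using boxes_step Suc(2) by simp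
  obtain w where w: "w \<in> words l" "shape d (P_tableau d w) = u" using Suc(1)[of u] u l by auto
  obtain T' where T': "T' \<in> Tab v" using Tab_nonempty[OF Suc(3)] by blast
  obtain T x where T: "T \<in> Tab u" "x \<in> alphabet d" "insertion d x T = T'"
    using insertion_surj[OF u(1,2)] u(3) Suc(3) T' by metis
  have "T \<in> P_tableau d ` {w' \<in> words l. history w' = history w}"
    using T(1) bij_betw_imp_surj_on[OF words_with_history_bij[OF w(1)]] w(2) by simp
  then obtain w' where w': "w' \<in> words l" "P_tableau d w' = T" by blast
  have "w' @ [x] \<in> words (Suc l)" using w'(1) T(2) by (simp only: words_snoc_iff)
  moreover have "shape d (P_tableau d (w' @ [x])) = v"
    unfolding P_tableau_snoc w'(2) T(3) by (rule Tab_shape[OF Suc(3) T'])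
  ultimately have "\<exists>w\<in>words (Suc l). shape d (P_tableau d w) = v" by blast
  then show ?case unfolding Suc(2) .
qed

text \<open>
  Both the event of being at \<open>v\<close> and the event of moving from \<open>v\<close> to \<open>t\<close> split according to the trajectory.  All
  trajectories that end in \<open>v\<close> contribute equally, so their number cancels in the conditional probability.
\<close>

lemma shape_law:
  assumes v: "v \<in> partitions_of d"
  shows "0 < \<P>(\<omega> in sequences. X l \<omega> = v) \<longleftrightarrow> l = boxes v"
    and "0 < \<P>(\<omega> in sequences. X l \<omega> = v) \<Longrightarrow>
      \<P>(\<omega> in sequences. X (Suc l) \<omega> = t \<bar> X l \<omega> = v) = shape_matrix v t"
proof -
  let ?Q = "\<lambda>w. shape d (P_tableau d w) = v"
  let ?W = "{w. w \<in> words l \<and> ?Q w}"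
  have fin: "finite ?W" using finite_words by simp
  have X: "X l \<omega> = v \<longleftrightarrow> ?Q (map \<omega> [0..<l])" for \<omega> by (simp add: shape_process_def)
  have same_history: "{w \<in> ?W. history w = history w0} = {w. w \<in> words l \<and> history w = history w0}"
    if "w0 \<in> ?W" for w0
    using that history_last by (auto; metis)
  have by_history: "(\<Sum>w\<in>?W. f w) = real (card (history ` ?W)) * c"
    if "\<And>w0. w0 \<in> ?W \<Longrightarrow> (\<Sum>w | w \<in> words l \<and> history w = history w0. f w) = c" for f c
  proof -
    have "(\<Sum>w\<in>?W. f w) = (\<Sum>h\<in>history ` ?W. \<Sum>w\<in>{w \<in> ?W. history w = h}. f w)"
      by (rule sum.image_gen[OF fin])
    also have "\<dots> = (\<Sum>h\<in>history ` ?W. c)"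
    proof (rule sum.cong[OF refl])
      fix h assume "h \<in> history ` ?W"
      then obtain w0 where w0: "w0 \<in> ?W" "h = history w0" by blast
      show "(\<Sum>w\<in>{w \<in> ?W. history w = h}. f w) = c"
        unfolding w0(2) same_history[OF w0(1)] by (rule that[OF w0(1)])
    qed
    finally show ?thesis by simp
  qed
  have now: "\<P>(\<omega> in sequences. X l \<omega> = v) = real (card (history ` ?W)) * schur v"
    unfolding X event_now[of ?Q] by (rule by_history) (auto simp: history_sums)
  have "\<P>(\<omega> in sequences. X (Suc l) \<omega> = t \<and> X l \<omega> = v)
      = real (card (history ` ?W)) * (if covers v t then schur t else 0)"
    unfolding X event_next[of l t ?Q]
    by (rule by_history) (auto simp: history_sums simp del: P_tableau_snoc)
  then show "0 < \<P>(\<omega> in sequences. X l \<omega> = v) \<Longrightarrow>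
      \<P>(\<omega> in sequences. X (Suc l) \<omega> = t \<bar> X l \<omega> = v) = shape_matrix v t"
    unfolding cond_prob_def now by (auto simp: shape_matrix_def zero_less_mult_iff)
  have "?W \<noteq> {} \<longleftrightarrow> l = boxes v"
    using visited[OF v] P_tableau_in_Tab(3) by blast
  then show "0 < \<P>(\<omega> in sequences. X l \<omega> = v) \<longleftrightarrow> l = boxes v"
    unfolding now using fin schur_pos[OF v] by (simp add: zero_less_mult_iff card_gt_0_iff)
qed

lemma transition_matrix_eq:
  assumes "v \<in> partitions_of d"
  shows "transition_matrix sequences X v t = shape_matrix v t"
proof -
  have L: "(LEAST l. 0 < \<P>(\<omega> in sequences. X l \<omega> = v)) = boxes v"
    unfolding shape_law(1)[OF assms] by (rule Least_equality) auto
  show ?thesis unfolding transition_matrix_def Let_def L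
    using shape_law[OF assms] by blast
qed

lemma pieri:
  assumes v: "v \<in> partitions_of d"
  shows "(\<Sum>a\<in>alphabet d. if v + unit_vector a \<in> partitions_of d then schur (v + unit_vector a) else 0) = schur v"
proof -
  have "schur v = (\<Sum>T\<in>Tab v. \<Sum>x\<in>alphabet d. p x * weight (concat T))"
    by (simp add: schur_def p_sum flip: sum_distrib_right)
  also have "\<dots> = (\<Sum>T\<in>Tab v. \<Sum>x\<in>alphabet d. \<Sum>a\<in>alphabet d.
      if shape d (insertion d x T) = v + unit_vector a then p x * weight (concat T) else 0)"
  proof (intro sum.cong refl)
    fix T x assume "T \<in> Tab v" "x \<in> alphabet d"
    then obtain b where "b \<in> alphabet d" "shape d (insertion d x T) = v + unit_vector b"
      using insertion_shape(1)[OF v] by (auto simp: covers_def)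
    then show "p x * weight (concat T) = (\<Sum>a\<in>alphabet d.
        if shape d (insertion d x T) = v + unit_vector a then p x * weight (concat T) else 0)"
      by (simp add: unit_vector_inj finite_A)
  qed
  also have "\<dots> = (\<Sum>a\<in>alphabet d. \<Sum>T\<in>Tab v. \<Sum>x\<in>alphabet d.
      if shape d (insertion d x T) = v + unit_vector a then p x * weight (concat T) else 0)"
    by (subst sum.swap[of _ "alphabet d" "alphabet d"], subst sum.swap[of _ "alphabet d" "Tab v"]) simp
  also have "\<dots> = (\<Sum>a\<in>alphabet d. if v + unit_vector a \<in> partitions_of d then schur (v + unit_vector a) else 0)"
    unfolding pieri_cover[OF v] by (intro sum.cong) (auto simp: covers_def)
  finally show ?thesis by simp
qed

lemma shape_matrix_stochastic: "stochastic_on (partitions_of d) shape_matrix"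
  unfolding stochastic_on_def
proof (intro ballI conjI)
  fix v t assume v: "v \<in> partitions_of d" and "t \<in> partitions_of d"
  then show "0 \<le> shape_matrix v t" by (auto simp: shape_matrix_def schur_pos less_imp_le)
next
  fix v assume v: "v \<in> partitions_of d"
  let ?B = "{a \<in> alphabet d. v + unit_vector a \<in> partitions_of d}"
  let ?F = "(\<lambda>a. v + unit_vector a) ` ?B"
  have inj: "inj_on (\<lambda>a. v + unit_vector a) ?B" by (auto simp: inj_on_def unit_vector_inj)
  have "(\<Sum>t\<in>?F. shape_matrix v t) = (\<Sum>a\<in>?B. schur (v + unit_vector a) / schur v)"
    unfolding sum.reindex[OF inj] by (intro sum.cong) (auto simp: shape_matrix_def covers_def)
  also have "\<dots> = 1"
    using pieri[OF v] schur_pos[OF v] by (simp add: sum.inter_filter finite_A flip: sum_divide_distrib)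
  finally have "(shape_matrix v has_sum 1) ?F"
    using has_sum_finite[of ?F "shape_matrix v"] finite_A by simp
  moreover have "(shape_matrix v has_sum 1) (partitions_of d) \<longleftrightarrow> (shape_matrix v has_sum 1) ?F"
    by (rule has_sum_cong_neutral) (auto simp: shape_matrix_def covers_def)
  ultimately show "(shape_matrix v has_sum 1) (partitions_of d)" by simp
qed

text \<open>
  By the rule of Pieri, \<open>schur v / monomial v\<close> is harmonic for the walk killed outside the set of partitions, and it is
  bounded.
\<close>

theorem schur_survival:
  "\<exists>c. \<forall>v\<in>partitions_of d. schur v = c * monomial v * \<P>(\<omega> in sequences. \<forall>l. v + walk l \<omega> \<in> partitions_of d)"
proof -
  define g where "g v = (if v \<in> partitions_of d then schur v / monomial v else 0)" for v
  obtain K where K: "\<forall>v\<in>partitions_of d. schur v \<le> K * monomial v"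
    using weight_bound by (auto simp: schur_def monomial_def)
  have "\<exists>c. \<forall>v\<in>partitions_of d. (\<lambda>l. c * stay (partitions_of d) l v) \<longlonglongrightarrow> g v"
  proof (rule killed_harmonic_proportional_survival[where rk = boxes and B = "max K 0"])
    fix v assume v: "v \<in> partitions_of d"
    show "\<exists>a\<in>alphabet d. \<exists>u\<in>partitions_of d. v = u + unit_vector a \<and> boxes u < boxes v" if "v \<noteq> 0"
      using predecessor[OF v that] boxes_step by fastforce
    have "mean g v = (\<Sum>a\<in>alphabet d. (if v + unit_vector a \<in> partitions_of d then schur (v + unit_vector a) else 0) / monomial v)"
      unfolding mean_def
      by (intro sum.cong) (auto simp: g_def monomial_step[OF v] dest: p_pos)
    then show "mean g v = g v" using pieri[OF v] v by (simp add: g_def flip: sum_divide_distrib)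
  next
    fix v show "g v \<le> max K 0" "0 \<le> g v"
      using K monomial_pos[of v] schur_pos[of v]
      by (auto simp: g_def field_simps le_max_iff_disj intro: less_imp_le)
  qed (auto simp: g_def zero_state)
  then obtain c where c: "\<And>v. v \<in> partitions_of d \<Longrightarrow> (\<lambda>l. c * stay (partitions_of d) l v) \<longlonglongrightarrow> g v" by blast
  have "schur v = c * monomial v * \<P>(\<omega> in sequences. \<forall>l. v + walk l \<omega> \<in> partitions_of d)"
    if v: "v \<in> partitions_of d" for v
  proof -
    have "g v = c * \<P>(\<omega> in sequences. \<forall>l. v + walk l \<omega> \<in> partitions_of d)"
      by (rule LIMSEQ_unique[OF c[OF v]]) (intro tendsto_intros survival_limit)
    then show ?thesis using monomial_pos[of v] v by (simp add: g_def field_simps)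
  qed
  then show ?thesis by blast
qed

lemma conditioned_walk_matrix_eq:
  assumes v: "v \<in> partitions_of d" and t: "t \<in> partitions_of d"
  shows "conditioned_walk_matrix d p v t = shape_matrix v t"
proof -
  have ws: "word_space d p = sequences" by (simp add: word_space_def)
  obtain c where c: "\<And>v. v \<in> partitions_of d \<Longrightarrow> schur v = c * monomial v * survival_prob d p v"
    using schur_survival unfolding survival_prob_def ws by blast
  have pos: "c \<noteq> 0" "survival_prob d p v \<noteq> 0" using c[OF v] schur_pos[OF v] by auto
  show ?thesis
  proof (cases "covers v t")
    case True
    then obtain a where a: "a \<in> alphabet d" "t = v + unit_vector a" by (auto simp: covers_def)
    have "walk_matrix d p v t = p a"
      using a finite_A by (simp add: walk_matrix_def unit_vector_inj)
    then show ?thesis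
      using True pos monomial_pos[of v] monomial_step[OF v a(1)] c[OF v] c[OF t] a(2)
      by (simp add: conditioned_walk_matrix_def shape_matrix_def field_simps)
  next
    case False
    have "t - v \<noteq> unit_vector a" if "a \<in> alphabet d" for a
    proof
      assume "t - v = unit_vector a"
      then have "t = v + unit_vector a" by (metis add.commute diff_add_cancel)
      then show False using False t that by (auto simp: covers_def)
    qed
    then have "walk_matrix d p v t = 0" by (simp add: walk_matrix_def)
    then show ?thesis using False by (simp add: conditioned_walk_matrix_def shape_matrix_def)
  qed
qed

lemma shape_process_measurable: "X l \<in> sequences \<rightarrow>\<^sub>M count_space (partitions_of d)"
proof (rule measurableI)
  fix \<omega> assume "\<omega> \<in> space sequences"
  then have "map \<omega> [0..<l] \<in> words l" by (auto simp: words_def space_sequences)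
  from P_tableau_in_Tab(1)[OF this] show "X l \<omega> \<in> space (count_space (partitions_of d))"
    by (simp add: shape_process_def)
next
  fix B assume "B \<in> sets (count_space (partitions_of d))"
  have "X l -` B \<inter> space sequences = {\<omega> \<in> space sequences. shape d (P_tableau d (map \<omega> [0..<l])) \<in> B}"
    by (auto simp: shape_process_def)
  then show "X l -` B \<inter> space sequences \<in> sets sequences"
    using word_event(1)[of "\<lambda>w. shape d (P_tableau d w) \<in> B" l] by simp
qed

theorem shape_process_is_conditioned_walk:
  "markov_chain (word_space d p) (partitions_of d)
     (transition_matrix (word_space d p) (shape_process d)) (shape_process d)
   \<and> stochastic_on (partitions_of d) (conditioned_walk_matrix d p)
   \<and> (\<forall>u\<in>partitions_of d. \<forall>v\<in>partitions_of d.
        transition_matrix (word_space d p) (shape_process d) u v = conditioned_walk_matrix d p u v)"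
proof (intro conjI)
  have ws: "word_space d p = sequences" by (simp add: word_space_def)
  have st: "stochastic_on (partitions_of d) Q"
    if "\<And>v t. v \<in> partitions_of d \<Longrightarrow> t \<in> partitions_of d \<Longrightarrow> Q v t = shape_matrix v t" for Q
    using shape_matrix_stochastic that unfolding stochastic_on_def
    by (simp cong: has_sum_cong)
  show "stochastic_on (partitions_of d) (conditioned_walk_matrix d p)"
    by (rule st) (rule conditioned_walk_matrix_eq)
  show "\<forall>u\<in>partitions_of d. \<forall>v\<in>partitions_of d.
        transition_matrix (word_space d p) (shape_process d) u v = conditioned_walk_matrix d p u v"
    by (simp add: ws transition_matrix_eq conditioned_walk_matrix_eq)
  show "markov_chain (word_space d p) (partitions_of d)
     (transition_matrix (word_space d p) (shape_process d)) (shape_process d)"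
    unfolding markov_chain_def ws
    using seq.P.prob_space_axioms st[of "transition_matrix sequences X"] shape_process_measurable
    by (auto simp: transition_matrix_eq conditional_on_history)
qed

end


section \<open>Insertion along the lines of a tableau\<close>

text \<open>
  A shape is the list of its line lengths.  The index \<open>length ls\<close> opens a new line of length \<open>1\<close>.
\<close>

definition grow :: "nat \<Rightarrow> nat list \<Rightarrow> nat list" where
  "grow j ls = (if j < length ls then ls[j := Suc (ls ! j)] else ls @ [1])"

lemma grow_Nil [simp]: "grow j [] = [1]"
  by (simp add: grow_def)

lemma grow_Cons_0 [simp]: "grow 0 (a # ls) = Suc a # ls"
  by (simp add: grow_def)

lemma grow_Cons_Suc [simp]: "grow (Suc j) (a # ls) = a # grow j ls"
  by (simp add: grow_def)

text \<open>
  All three insertions pass along the lines of a tableau (its columns, or its rows): a line either accepts the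
  letter at its end or exchanges it for another one, which goes to the next line.  A tableau is a sequence of good
  lines in which consecutive lines are related by \<open>adj\<close>.  The assumptions concern at most two consecutive lines; they
  say that the exchange can be undone exactly when the result is related to the line that received the letter,
  and that \<open>adj\<close> for the old lines amounts to \<open>adj\<close> for the new ones.
\<close>

locale line_insertion =
  fixes A :: "int set"
    and good :: "int list \<Rightarrow> bool"
    and fits :: "nat \<Rightarrow> nat \<Rightarrow> bool"
    and adj :: "int list \<Rightarrow> int list \<Rightarrow> bool"
    and stops :: "int \<Rightarrow> int list \<Rightarrow> bool"
    and bump :: "int \<Rightarrow> int list \<Rightarrow> int list \<times> int"
    and ins :: "int \<Rightarrow> tableau \<Rightarrow> tableau"
  assumes ins_Nil: "ins x [] = [[x]]"
    and ins_Cons: "good C \<Longrightarrow> x \<in> A \<Longrightarrow> ins x (C # T) =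
      (if stops x C then (C @ [x]) # T else fst (bump x C) # ins (snd (bump x C)) T)"
    and good_letters: "good C \<Longrightarrow> C \<noteq> [] \<and> set C \<subseteq> A"
    and good_single: "x \<in> A \<Longrightarrow> good [x]"
    and good_snoc: "C \<noteq> [] \<Longrightarrow> x \<in> A \<Longrightarrow> good (C @ [x]) \<longleftrightarrow> good C \<and> stops x C"
    and bump_good: "good C \<Longrightarrow> x \<in> A \<Longrightarrow> \<not> stops x C \<Longrightarrow> bump x C = (C', y) \<Longrightarrow>
      good C' \<and> length C' = length C \<and> mset C' + {#y#} = mset C + {#x#}"
    and bump_inj: "good C \<Longrightarrow> x \<in> A \<Longrightarrow> \<not> stops x C \<Longrightarrow>
      good C2 \<Longrightarrow> x2 \<in> A \<Longrightarrow> \<not> stops x2 C2 \<Longrightarrow> bump x C = bump x2 C2 \<Longrightarrow> C = C2 \<and> x = x2"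
    and adj_fits: "adj C D \<Longrightarrow> fits (length C) (length D)"
    and adj_snoc: "good (C @ [x]) \<Longrightarrow> good D \<Longrightarrow> fits (length C) (length D) \<Longrightarrow> adj (C @ [x]) D \<longleftrightarrow> adj C D"
    and adj_bump_single: "good C \<Longrightarrow> x \<in> A \<Longrightarrow> \<not> stops x C \<Longrightarrow> bump x C = (C', y) \<Longrightarrow> adj C' [y]"
    and adj_bump_stops: "good C \<Longrightarrow> x \<in> A \<Longrightarrow> \<not> stops x C \<Longrightarrow> bump x C = (C', y) \<Longrightarrow>
      good D \<Longrightarrow> stops y D \<Longrightarrow> adj C D \<Longrightarrow> adj C' (D @ [y])"
    and adj_bump_bump: "good C \<Longrightarrow> x \<in> A \<Longrightarrow> \<not> stops x C \<Longrightarrow> bump x C = (C', y) \<Longrightarrow>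
      good D \<Longrightarrow> \<not> stops y D \<Longrightarrow> bump y D = (D', z) \<Longrightarrow> adj C D \<Longrightarrow> adj C' D'"
    and unbump_single: "good C' \<Longrightarrow> y \<in> A \<Longrightarrow> adj C' [y] \<Longrightarrow>
      \<exists>C x. good C \<and> x \<in> A \<and> \<not> stops x C \<and> bump x C = (C', y)"
    and unbump_stops: "good C' \<Longrightarrow> y \<in> A \<Longrightarrow> good D \<Longrightarrow> stops y D \<Longrightarrow> adj C' (D @ [y]) \<Longrightarrow>
      \<exists>C x. good C \<and> x \<in> A \<and> \<not> stops x C \<and> bump x C = (C', y) \<and> adj C D"
    and unbump_bump: "good C' \<Longrightarrow> y \<in> A \<Longrightarrow> good D \<Longrightarrow> \<not> stops y D \<Longrightarrow> bump y D = (D', z) \<Longrightarrow> adj C' D' \<Longrightarrow>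
      \<exists>C x. good C \<and> x \<in> A \<and> \<not> stops x C \<and> bump x C = (C', y) \<and> adj C D"
begin

definition tab :: "tableau \<Rightarrow> bool" where
  "tab T \<longleftrightarrow> (\<forall>C\<in>set T. good C) \<and> successively adj T"

definition admissible :: "nat list \<Rightarrow> bool" where
  "admissible ls \<longleftrightarrow> 0 \<notin> set ls \<and> successively fits ls"

lemma tab_Nil [simp]: "tab []"
  by (simp add: tab_def)

lemma tab_Cons: "tab (C # T) \<longleftrightarrow> good C \<and> tab T \<and> (T \<noteq> [] \<longrightarrow> adj C (hd T))"
  by (auto simp: tab_def successively_Cons)

lemma admissible_Nil [simp]: "admissible []"
  by (simp add: admissible_def)

lemma admissible_Cons:
  "admissible (a # ls) \<longleftrightarrow> 0 < a \<and> admissible ls \<and> (ls \<noteq> [] \<longrightarrow> fits a (hd ls))"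
  by (auto simp: admissible_def successively_Cons)

lemma tab_admissible: "tab T \<Longrightarrow> admissible (map length T)"
  by (induction T) (auto simp: tab_Cons admissible_Cons hd_map good_letters intro: adj_fits)

lemma bump_letter:
  assumes "good C" "x \<in> A" "\<not> stops x C" "bump x C = (C', y)"
  shows "y \<in> A"
proof -
  have "y \<in># mset C + {#x#}"
    using bump_good[OF assms] by (metis union_iff union_single_eq_member)
  then show ?thesis using assms(1,2) good_letters by auto
qed

lemma finite_tabs:
  assumes "finite A"
  shows "finite {T. tab T \<and> map length T = ls}"
proof (rule finite_subset)
  let ?C = "\<Union>k\<le>sum_list ls. {C. set C \<subseteq> A \<and> length C = k}"
  show "{T. tab T \<and> map length T = ls} \<subseteq> {T. set T \<subseteq> ?C \<and> length T = length ls}"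
  proof
    fix T assume "T \<in> {T. tab T \<and> map length T = ls}"
    then have T: "tab T" and ls: "ls = map length T" by auto
    have "C \<in> ?C" if "C \<in> set T" for C
    proof -
      have "length C \<le> sum_list ls" unfolding ls using that by (intro member_le_sum_list) auto
      moreover have "set C \<subseteq> A" using T that good_letters by (auto simp: tab_def)
      ultimately show ?thesis by auto
    qed
    then show "T \<in> {T. set T \<subseteq> ?C \<and> length T = length ls}" by (auto simp: ls)
  qed
  show "finite {T. set T \<subseteq> ?C \<and> length T = length ls}"
    by (intro finite_lists_length_eq finite_UN_I finite_atMost assms)
qed

theorem tab_ins:
  assumes "tab T" "x \<in> A"
  shows "tab (ins x T)" "\<exists>j\<le>length T. map length (ins x T) = grow j (map length T)"
    and "mset (concat (ins x T)) = mset (concat T) + {#x#}"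
proof -
  have "tab (ins x T) \<and> (\<exists>j\<le>length T. map length (ins x T) = grow j (map length T))
      \<and> mset (concat (ins x T)) = mset (concat T) + {#x#}"
    using assms
  proof (induction T arbitrary: x)
    case Nil
    then show ?case by (auto simp: ins_Nil tab_Cons good_single)
  next
    case (Cons C T)
    have C: "good C" and T: "tab T" and CT: "T \<noteq> [] \<Longrightarrow> adj C (hd T)"
      using Cons.prems by (auto simp: tab_Cons)
    show ?case
    proof (cases "stops x C")
      case True
      have ne: "C \<noteq> []" using good_letters[OF C] by simp
      have "good (C @ [x])" using good_snoc[OF ne] C True Cons.prems by blast
      moreover have "T \<noteq> [] \<Longrightarrow> good (hd T)" using T by (cases T) (auto simp: tab_Cons)
      ultimately have "tab ((C @ [x]) # T)"
        using T CT adj_snoc adj_fits by (auto simp: tab_Cons)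
      then show ?thesis
        using True Cons.prems C by (auto simp: ins_Cons intro!: exI[of _ 0])
    next
      case False
      obtain C' y where b: "bump x C = (C', y)" by fastforce
      have g: "good C'" "length C' = length C" "mset C' + {#y#} = mset C + {#x#}"
        using bump_good[OF C Cons.prems(2) False b] by auto
      have y: "y \<in> A" using bump_letter[OF C Cons.prems(2) False b] .
      note IH = Cons.IH[OF T y]
      have "adj C' (hd (ins y T))"
      proof (cases T)
        case Nil
        then show ?thesis using adj_bump_single[OF C Cons.prems(2) False b] by (simp add: ins_Nil)
      next
        case (Cons D R)
        have D: "good D" "adj C D" using T CT Cons by (auto simp: tab_Cons)
        show ?thesis
        proof (cases "stops y D")
          case True
          then show ?thesis using adj_bump_stops[OF C \<open>x \<in> A\<close> False b D(1) True D(2)] Cons D y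
            by (simp add: ins_Cons)
        next
          case nst: False
          obtain D' z where b': "bump y D = (D', z)" by fastforce
          then show ?thesis using adj_bump_bump[OF C \<open>x \<in> A\<close> False b D(1) nst b' D(2)] Cons D y nst
            by (simp add: ins_Cons)
        qed
      qed
      then have "tab (C' # ins y T)" using g IH by (auto simp: tab_Cons)
      moreover obtain j where "j \<le> length T" "map length (ins y T) = grow j (map length T)"
        using IH by auto
      then have "Suc j \<le> length (C # T)"
          "map length (C' # ins y T) = grow (Suc j) (map length (C # T))" using g by auto
      moreover have "mset (concat (C' # ins y T)) = mset (concat (C # T)) + {#x#}"
      proof -
        have "mset (concat (C' # ins y T)) = (mset C' + {#y#}) + mset (concat T)"
          using IH by simp
        then show ?thesis using g(3) by simp
      qed
      ultimately show ?thesis using False b C Cons.prems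
        by (auto simp: ins_Cons)
    qed
  qed
  then show "tab (ins x T)" "\<exists>j\<le>length T. map length (ins x T) = grow j (map length T)"
    "mset (concat (ins x T)) = mset (concat T) + {#x#}" by auto
qed

theorem ins_inj:
  assumes "tab T" "x \<in> A" "tab T2" "x2 \<in> A" "map length T = map length T2" "ins x T = ins x2 T2"
  shows "T = T2 \<and> x = x2"
  using assms
proof (induction T arbitrary: x T2 x2)
  case Nil
  then show ?case by (simp add: ins_Nil)
next
  case (Cons C T)
  then obtain D R where T2: "T2 = D # R" by (cases T2) auto
  have C: "good C" and D: "good D" and T: "tab T" and R: "tab R"
    using Cons.prems T2 by (auto simp: tab_Cons)
  have len: "length C = length D" "map length T = map length R" using Cons.prems T2 by auto
  obtain C' y where b: "bump x C = (C', y)" by fastforce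
  obtain D' z where b2: "bump x2 D = (D', z)" by fastforce
  note eq = \<open>ins x (C # T) = ins x2 T2\<close>[unfolded T2 ins_Cons[OF C \<open>x \<in> A\<close>] ins_Cons[OF D \<open>x2 \<in> A\<close>] b b2 fst_conv snd_conv]
  have st: "stops x C \<longleftrightarrow> stops x2 D"
    using eq len bump_good[OF C \<open>x \<in> A\<close> _ b] bump_good[OF D \<open>x2 \<in> A\<close> _ b2]
    by (auto split: if_splits)
  show ?case
  proof (cases "stops x C")
    case True
    then show ?thesis using eq st len T2 by auto
  next
    case False
    then have F2: "\<not> stops x2 D" using st by simp
    have e: "C' = D'" "ins y T = ins z R" using eq False F2 by auto
    have "T = R \<and> y = z"
      using Cons.IH[OF T bump_letter[OF C \<open>x \<in> A\<close> False b] R bump_letter[OF D \<open>x2 \<in> A\<close> F2 b2] len(2) e(2)] .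
    then show ?thesis using bump_inj[OF C \<open>x \<in> A\<close> False D \<open>x2 \<in> A\<close> F2] b b2 e T2 by auto
  qed
qed

text \<open>
  Extraction: the last letter of line \<open>j\<close> is removed and passed back through the lines before it.  The list \<open>ls\<close> has to
  be an admissible shape for this, since the shortened line must still fit before its successor.
\<close>

theorem ins_surj:
  assumes "tab T'" "admissible ls" "j \<le> length ls" "map length T' = grow j ls"
  shows "\<exists>x\<in>A. \<exists>T. tab T \<and> map length T = ls \<and> ins x T = T'"
  using assms
proof (induction ls arbitrary: j T')
  case Nil
  then obtain C where "T' = [C]" "length C = 1" by auto
  moreover obtain x where "C = [x]" using \<open>length C = 1\<close> by (cases C) auto
  ultimately show ?case using Nil.prems good_letters[of C]
    by (intro bexI[of _ x] exI[of _ "[]"]) (auto simp: tab_Cons ins_Nil)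
next
  case (Cons a ls)
  have a: "0 < a" and ls: "admissible ls" and als: "ls \<noteq> [] \<Longrightarrow> fits a (hd ls)"
    using Cons.prems(2) by (auto simp: admissible_Cons)
  show ?case
  proof (cases j)
    case 0
    then obtain C' R where T': "T' = C' # R" "length C' = Suc a" "map length R = ls"
      using Cons.prems(4) by (cases T') auto
    then obtain C x where C': "C' = C @ [x]" by (cases C' rule: rev_exhaust) auto
    have ne: "C \<noteq> []" and lC: "length C = a" using T' C' a by auto
    have x: "x \<in> A" and gC': "good C'"
      using good_letters[of C'] T' C' Cons.prems(1) by (auto simp: tab_Cons)
    have C: "good C" "stops x C" using good_snoc[OF ne x] gC' C' by auto
    have "adj C (hd R)" if "R \<noteq> []"
    proof -
      have "good (hd R)" "adj C' (hd R)"
        using that T' Cons.prems(1) by (cases R; auto simp: tab_Cons)+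
      moreover have "fits (length C) (length (hd R))"
        using als that T'(3) lC by (metis hd_map map_is_Nil_conv)
      ultimately show ?thesis using adj_snoc gC' C' by auto
    qed
    then have "tab (C # R)" using C T' Cons.prems(1) by (auto simp: tab_Cons)
    moreover have "ins x (C # R) = T'" using C x T' C' by (simp add: ins_Cons)
    ultimately show ?thesis using x T' C' by (intro bexI[of _ x] exI[of _ "C # R"]) auto
  next
    case (Suc i)
    then obtain C' R' where T': "T' = C' # R'" "length C' = a" "map length R' = grow i ls"
      using Cons.prems(4) by (cases T') auto
    have gC': "good C'" and R': "tab R'" and adj': "R' \<noteq> [] \<Longrightarrow> adj C' (hd R')"
      using T' Cons.prems(1) by (auto simp: tab_Cons)
    obtain y R where y: "y \<in> A" and R: "tab R" "map length R = ls" "ins y R = R'"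
      using Cons.IH[OF R' ls _ T'(3)] Suc Cons.prems(3) by auto
    have "\<exists>C x. good C \<and> x \<in> A \<and> \<not> stops x C \<and> bump x C = (C', y) \<and> (R \<noteq> [] \<longrightarrow> adj C (hd R))"
    proof (cases R)
      case Nil
      then have "adj C' [y]" using adj' R by (auto simp: ins_Nil)
      then show ?thesis using unbump_single[OF gC' y] Nil by auto
    next
      case (Cons D Q)
      have D: "good D" using R Cons by (auto simp: tab_Cons)
      obtain D' z where b: "bump y D = (D', z)" by fastforce
      show ?thesis
      proof (cases "stops y D")
        case True
        then have "adj C' (D @ [y])" using adj' R Cons D y by (auto simp: ins_Cons)
        then show ?thesis using unbump_stops[OF gC' y D True] Cons by auto
      next
        case False
        then have "adj C' D'" using adj' R Cons D y b by (auto simp: ins_Cons)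
        then show ?thesis using unbump_bump[OF gC' y D False b] Cons by auto
      qed
    qed
    then obtain C x where C: "good C" "x \<in> A" "\<not> stops x C" "bump x C = (C', y)"
      "R \<noteq> [] \<longrightarrow> adj C (hd R)" by blast
    have "tab (C # R)" using C R by (auto simp: tab_Cons)
    moreover have "ins x (C # R) = T'" using C R T' by (simp add: ins_Cons)
    moreover have "length C = a" using bump_good[OF C(1-4)] T' by simp
    ultimately show ?thesis using C R by (intro bexI[of _ x] exI[of _ "C # R"]) auto
  qed
qed

end


section \<open>Shapes as vectors\<close>

definition part :: "nat list \<Rightarrow> nat \<Rightarrow> nat" where
  "part ls j = (if j < length ls then ls ! j else 0)"

lemma part_pos_iff: "0 \<notin> set ls \<Longrightarrow> 0 < part ls j \<longleftrightarrow> j < length ls"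
  by (auto simp: part_def) (metis nth_mem gr0I)

lemma part_inj:
  assumes "0 \<notin> set ls" "0 \<notin> set ls'" "part ls = part ls'"
  shows "ls = ls'"
proof -
  have "{j. j < length ls} = {j. j < length ls'}"
    using part_pos_iff[OF assms(1)] part_pos_iff[OF assms(2)] assms(3) by metis
  then have len: "length ls = length ls'"
    by (metis card_lessThan lessThan_def)
  show ?thesis
  proof (rule nth_equalityI[OF len])
    show "ls ! i = ls' ! i" if "i < length ls" for i
      using fun_cong[OF assms(3), of i] that len by (simp add: part_def)
  qed
qed

lemma part_grow: "j \<le> length ls \<Longrightarrow> part (grow j ls) = (part ls)(j := Suc (part ls j))"
  by (rule ext) (auto simp: part_def grow_def nth_list_update nth_append)

lemma grow_nonzero: "0 \<notin> set ls \<Longrightarrow> 0 \<notin> set (grow j ls)"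
  using set_update_subset_insert[of ls j "Suc (ls ! j)"] by (auto simp: grow_def)

text \<open>
  An added box never leaves a gap: the new sequence has no zero before a positive entry.
\<close>

lemma part_eq_growE:
  assumes "0 \<notin> set ls" "0 \<notin> set ls'" "part ls' = (part ls)(j := Suc (part ls j))"
  shows "j \<le> length ls \<and> ls' = grow j ls"
proof -
  have "j \<le> length ls"
  proof (rule ccontr)
    assume j: "\<not> j \<le> length ls"
    then have "0 < part ls' j" "\<not> 0 < part ls' (length ls)"
      using part_pos_iff[OF assms(1), of "length ls"] by (auto simp: assms(3))
    then show False
      using part_pos_iff[OF assms(2), of j] part_pos_iff[OF assms(2), of "length ls"] j by linarith
  qed
  then show ?thesis
    using part_inj[OF assms(2) grow_nonzero[OF assms(1)]] part_grow assms(3) by metis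
qed

lemma ex_part:
  assumes "antimono w" "finite {i. w i \<noteq> 0}"
  shows "\<exists>ls. 0 \<notin> set ls \<and> part ls = w"
proof -
  have ex: "\<exists>l. w l = 0" using assms(2) by (metis (mono_tags, lifting) UNIV_I finite_subset infinite_UNIV_nat mem_Collect_eq subsetI)
  define l where "l = (LEAST l. w l = 0)"
  have "w l = 0" unfolding l_def by (rule LeastI_ex[OF ex])
  then have zero: "w i = 0" if "l \<le> i" for i using antimonoD[OF assms(1) that] by simp
  have pos: "w i \<noteq> 0" if "i < l" for i using not_less_Least[of i "\<lambda>l. w l = 0"] that by (simp add: l_def)
  have "part (map w [0..<l]) = w" by (rule ext) (use zero in \<open>auto simp: part_def\<close>)
  moreover have "0 \<notin> set (map w [0..<l])" using pos by force
  ultimately show ?thesis by blast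
qed

text \<open>
  A line insertion whose shapes are encoded by vectors.  The function \<open>decode\<close> recovers the line lengths and shows that
  adding a unit vector adds one box; \<open>inside\<close> restricts the shapes to those that can be filled with the letters of the
  alphabet.
\<close>

locale shaped_insertion =
  line_insertion "alphabet d" good fits adj stops bump "insertion d" + letter_law "alphabet d" p
  for d :: family and p good fits adj stops bump +
  fixes inside :: "nat list \<Rightarrow> bool" and vec :: "nat list \<Rightarrow> vector" and decode :: "vector \<Rightarrow> nat \<Rightarrow> nat"
  assumes states: "partitions_of d = vec ` {ls. admissible ls \<and> inside ls}"
    and tab_inside: "tab T \<Longrightarrow> inside (map length T)"
    and tab_shape: "tab T \<Longrightarrow> shape d T = vec (map length T)"
    and tab_exists: "admissible ls \<Longrightarrow> inside ls \<Longrightarrow> \<exists>T. tab T \<and> map length T = ls"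
    and vec_grow: "admissible ls \<Longrightarrow> inside ls \<Longrightarrow> j \<le> length ls \<Longrightarrow> admissible (grow j ls) \<Longrightarrow>
      inside (grow j ls) \<Longrightarrow> \<exists>a\<in>alphabet d. vec (grow j ls) = vec ls + unit_vector a"
    and decode_vec: "admissible ls \<Longrightarrow> inside ls \<Longrightarrow> decode (vec ls) = part ls"
    and decode_step: "admissible ls \<Longrightarrow> inside ls \<Longrightarrow> a \<in> alphabet d \<Longrightarrow>
      \<exists>j. decode (vec ls + unit_vector a) = (part ls)(j := Suc (part ls j))"
    and vec_nonneg: "0 \<le> vec ls a"
    and vec_Nil: "vec [] = 0"
    and shrink: "admissible ls \<Longrightarrow> inside ls \<Longrightarrow> ls \<noteq> [] \<Longrightarrow>
      \<exists>ls0 j. admissible ls0 \<and> inside ls0 \<and> j \<le> length ls0 \<and> ls = grow j ls0"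
    and weight_le: "\<exists>K. \<forall>ls. admissible ls \<and> inside ls \<longrightarrow>
      (\<Sum>T | tab T \<and> map length T = ls. weight (concat T)) \<le> K * (\<Prod>a\<in>alphabet d. p a ^ nat (vec ls a))"
begin

definition tableaux :: "vector \<Rightarrow> tableau set" where
  "tableaux v = {T. tab T \<and> vec (map length T) = v}"

lemma inside_Nil: "inside []"
  using tab_inside[of "[]"] by simp

lemma vec_inj:
  assumes "admissible ls" "inside ls" "admissible ls'" "inside ls'" "vec ls = vec ls'"
  shows "ls = ls'"
  using part_inj[of ls ls'] decode_vec[OF assms(1,2)] decode_vec[OF assms(3,4)] assms(1,3,5)
  by (simp add: admissible_def)

lemma tableaux_vec:
  assumes "admissible ls" "inside ls"
  shows "tableaux (vec ls) = {T. tab T \<and> map length T = ls}"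
  using vec_inj[OF _ _ assms] tab_admissible tab_inside by (auto simp: tableaux_def)

lemma vec_state: "admissible ls \<Longrightarrow> inside ls \<Longrightarrow> vec ls \<in> partitions_of d"
  by (auto simp: states)

lemma stateE:
  assumes "v \<in> partitions_of d"
  obtains ls where "admissible ls" "inside ls" "v = vec ls" "tableaux v = {T. tab T \<and> map length T = ls}"
  proof -
  obtain ls where ls: "admissible ls" "inside ls" "v = vec ls" using assms unfolding states by blast
  then show thesis using that[OF ls] tableaux_vec[OF ls(1,2)] by blast
qed

sublocale tableau_insertion d p tableaux
proof
  show "0 \<in> partitions_of d" using vec_state[OF admissible_Nil inside_Nil] unfolding vec_Nil .
  have "{T. tab T \<and> map length T = []} = {[]}" by auto
  with tableaux_vec[OF admissible_Nil inside_Nil] show "tableaux 0 = {[]}"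
    unfolding vec_Nil by (rule trans)
  show "0 \<le> v a" if "v \<in> partitions_of d" for v a
    using that vec_nonneg by (auto simp: states)
  show "\<exists>u\<in>partitions_of d. \<exists>a\<in>alphabet d. v = u + unit_vector a" if v: "v \<in> partitions_of d" "v \<noteq> 0" for v
  proof -
    obtain ls where ls: "admissible ls" "inside ls" "v = vec ls" using v(1) by (rule stateE)
    then have "ls \<noteq> []" using v(2) vec_Nil by metis
    then obtain ls0 j where ls0: "admissible ls0" "inside ls0" "j \<le> length ls0" "ls = grow j ls0"
      using shrink ls by blast
    show ?thesis
      using vec_grow[OF ls0(1-3)] vec_state[OF ls0(1,2)] ls ls0(4) by blast
  qed
  show "finite (tableaux v)" if "v \<in> partitions_of d" for v
    using that finite_tabs[OF finite_A] by (metis stateE)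
  show "tableaux v \<noteq> {}" if v: "v \<in> partitions_of d" for v
  proof -
    obtain ls where ls: "admissible ls" "inside ls" "tableaux v = {T. tab T \<and> map length T = ls}"
      using v by (rule stateE)
    then show ?thesis using tab_exists[OF ls(1,2)] by auto
  qed
  show "shape d T = v" if "T \<in> tableaux v" for v T
    using that tab_shape by (auto simp: tableaux_def)
  show "set (concat T) \<subseteq> alphabet d" if "T \<in> tableaux v" for v T
    using that good_letters by (fastforce simp: tableaux_def tab_def)
  show "mset (concat (insertion d x T)) = mset (concat T) + {#x#}"
    if "T \<in> tableaux v" "x \<in> alphabet d" for v T x
    using that tab_ins(3) by (auto simp: tableaux_def)
  show "\<exists>a\<in>alphabet d. v + unit_vector a \<in> partitions_of d \<and> insertion d x T \<in> tableaux (v + unit_vector a)"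
    if v: "v \<in> partitions_of d" and T: "T \<in> tableaux v" and x: "x \<in> alphabet d" for v T x
  proof -
    have tab: "tab T" and vT: "v = vec (map length T)" using T by (auto simp: tableaux_def)
    let ?T = "insertion d x T"
    have tab': "tab ?T" using tab_ins(1)[OF tab x] .
    obtain j where j: "j \<le> length T" "map length ?T = grow j (map length T)"
      using tab_ins(2)[OF tab x] by blast
    obtain a where a: "a \<in> alphabet d" "vec (map length ?T) = v + unit_vector a"
      using vec_grow[of "map length T" j] tab_admissible tab_inside tab tab' j vT by (metis length_map)
    then have "?T \<in> tableaux (v + unit_vector a)" using tab' by (simp add: tableaux_def)
    moreover have "v + unit_vector a \<in> partitions_of d"
      unfolding a(2)[symmetric] by (intro vec_state tab_admissible tab_inside tab')
    ultimately show ?thesis using a(1) by blast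
  qed
  show "T = T' \<and> x = x'"
    if v: "v \<in> partitions_of d" and T: "T \<in> tableaux v" "x \<in> alphabet d" "T' \<in> tableaux v" "x' \<in> alphabet d"
      and eq: "insertion d x T = insertion d x' T'" for v T x T' x'
  proof -
    obtain ls where ls: "tableaux v = {T. tab T \<and> map length T = ls}" using v by (rule stateE)
    then have "tab T" "tab T'" "map length T = map length T'" using T by auto
    then show ?thesis using ins_inj[OF _ T(2) _ T(4) _ eq] by blast
  qed
  show "\<exists>T\<in>tableaux v. \<exists>x\<in>alphabet d. insertion d x T = T'"
    if v: "v \<in> partitions_of d" and a: "a \<in> alphabet d" and v': "v + unit_vector a \<in> partitions_of d"
      and T': "T' \<in> tableaux (v + unit_vector a)" for v a T'
  proof -
    obtain ls where ls: "admissible ls" "inside ls" "v = vec ls" "tableaux v = {T. tab T \<and> map length T = ls}"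
      using v by (rule stateE)
    obtain ls' where ls': "admissible ls'" "inside ls'" "v + unit_vector a = vec ls'"
      "tableaux (v + unit_vector a) = {T. tab T \<and> map length T = ls'}"
      using v' by (rule stateE)
    obtain j where "decode (vec ls + unit_vector a) = (part ls)(j := Suc (part ls j))"
      using decode_step[OF ls(1,2) a] by blast
    then have "part ls' = (part ls)(j := Suc (part ls j))"
      using decode_vec[OF ls'(1,2)] ls'(3) ls(3) by metis
    then have j: "j \<le> length ls" "ls' = grow j ls"
      using part_eq_growE[of ls ls' j] ls(1) ls'(1) by (auto simp: admissible_def)
    have "tab T'" "map length T' = grow j ls" using T' ls'(4) j(2) by auto
    then obtain x T where "x \<in> alphabet d" "tab T" "map length T = ls" "insertion d x T = T'"
      using ins_surj[OF _ ls(1) j(1)] by blast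
    then show ?thesis using ls(4) by auto
  qed
  obtain K where K: "\<And>ls. admissible ls \<Longrightarrow> inside ls \<Longrightarrow>
      (\<Sum>T | tab T \<and> map length T = ls. weight (concat T)) \<le> K * (\<Prod>a\<in>alphabet d. p a ^ nat (vec ls a))"
    using weight_le by blast
  have "(\<Sum>T\<in>tableaux v. weight (concat T)) \<le> K * (\<Prod>a\<in>alphabet d. p a ^ nat (v a))" if "v \<in> partitions_of d" for v
  proof -
    obtain ls where ls: "admissible ls" "inside ls" "v = vec ls" "tableaux v = {T. tab T \<and> map length T = ls}"
      using \<open>v \<in> partitions_of d\<close> by (rule stateE)
    show ?thesis using K[OF ls(1,2)] unfolding ls(4) unfolding ls(3) .
  qed
  then show "\<exists>K. \<forall>v\<in>partitions_of d.
      (\<Sum>T\<in>tableaux v. weight (concat T)) \<le> K * (\<Prod>a\<in>alphabet d. p a ^ nat (v a))" by blast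
qed

end


section \<open>Column insertion\<close>

lemma replace_first_nth:
  assumes "k < length C" "\<And>i. i < k \<Longrightarrow> C ! i \<noteq> C ! k"
  shows "replace_first (C ! k) x C = C[k := x]"
  using assms
proof (induction C arbitrary: k)
  case (Cons c C)
  show ?case
  proof (cases k)
    case (Suc j)
    then have "c \<noteq> C ! j" using Cons.prems(2)[of 0] by simp
    moreover have "replace_first (C ! j) x C = C[j := x]"
      using Cons.IH[of j] Cons.prems Suc by fastforce
    ultimately show ?thesis using Suc by simp
  qed simp
qed simp

lemma mset_bump:
  assumes "k < length C"
  shows "mset (C[k := x]) + {#C ! k#} = mset C + {#x#}"
  using assms by (simp add: mset_update add_mset_diff_bothsides)


text \<open>
  Letters that satisfy \<open>weak\<close> may be repeated in a column and not in a row; the other letters may be repeated in a row and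
  not in a column.  Ordinary tableaux have only letters of the second kind, hook tableaux have both.
  The relation \<open>below a b\<close> says that \<open>b\<close> may stand below \<open>a\<close>; its negation with exchanged arguments says that \<open>a\<close> may stand to
  the left of \<open>b\<close>.
\<close>

locale column_letters =
  fixes A :: "int set" and weak :: "int \<Rightarrow> bool"
begin

definition below :: "int \<Rightarrow> int \<Rightarrow> bool" where
  "below a b \<longleftrightarrow> a < b \<or> a = b \<and> weak a"

definition column :: "int list \<Rightarrow> bool" where
  "column C \<longleftrightarrow> C \<noteq> [] \<and> set C \<subseteq> A \<and> sorted_wrt below C"

definition column_adj :: "int list \<Rightarrow> int list \<Rightarrow> bool" where
  "column_adj C D \<longleftrightarrow> length D \<le> length C \<and> (\<forall>i<length D. \<not> below (D ! i) (C ! i))"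

definition column_stops :: "int \<Rightarrow> int list \<Rightarrow> bool" where
  "column_stops x C \<longleftrightarrow> (\<forall>t\<in>set C. below t x)"

definition column_bump :: "int \<Rightarrow> int list \<Rightarrow> int list \<times> int" where
  "column_bump x C = (let y = Min {t \<in> set C. \<not> below t x} in (replace_first y x C, y))"

lemma column_nth: "column C \<Longrightarrow> i < j \<Longrightarrow> j < length C \<Longrightarrow> below (C ! i) (C ! j)"
  by (simp add: column_def sorted_wrt_iff_nth_less)

lemma columnI:
  "C \<noteq> [] \<Longrightarrow> set C \<subseteq> A \<Longrightarrow> (\<And>i j. i < j \<Longrightarrow> j < length C \<Longrightarrow> below (C ! i) (C ! j)) \<Longrightarrow> column C"
  by (simp add: column_def sorted_wrt_iff_nth_less)

lemma column_bump_at: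
  assumes C: "column C" and k: "k < length C" and before: "\<And>i. i < k \<Longrightarrow> below (C ! i) x"
    and at: "\<not> below (C ! k) x"
  shows "column_bump x C = (C[k := x], C ! k)"
proof -
  have "Min {t \<in> set C. \<not> below t x} = C ! k"
  proof (rule Min_eqI)
    fix t assume "t \<in> {t \<in> set C. \<not> below t x}"
    then obtain i where i: "i < length C" "t = C ! i" "\<not> below t x" by (auto simp: in_set_conv_nth)
    then have "k \<le> i" using before[of i] by (cases "i < k") auto
    then show "C ! k \<le> t"
      using column_nth[OF C, of k i] i by (cases "k = i") (auto simp: below_def)
  qed (use k at in auto)
  moreover have "replace_first (C ! k) x C = C[k := x]"
    using before at by (intro replace_first_nth[OF k]) metis
  ultimately show ?thesis by (simp add: column_bump_def)
qed

lemma column_bumpE: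
  assumes "column C" "\<not> column_stops x C"
  obtains k where "k < length C" "\<And>i. i < k \<Longrightarrow> below (C ! i) x" "\<not> below (C ! k) x"
    "column_bump x C = (C[k := x], C ! k)"
proof -
  have ex: "\<exists>k. k < length C \<and> \<not> below (C ! k) x"
    using assms(2) by (auto simp: column_stops_def in_set_conv_nth)
  define k where "k = (LEAST k. k < length C \<and> \<not> below (C ! k) x)"
  have k: "k < length C" "\<not> below (C ! k) x"
    using LeastI_ex[OF ex] by (auto simp: k_def)
  moreover have "below (C ! i) x" if "i < k" for i
    using not_less_Least[OF that[unfolded k_def]] that k(1) by auto
  ultimately show thesis using that column_bump_at[OF assms(1)] by blast
qed

text \<open>
  The entry that was inserted is the last one that may stand to the left of the ejected letter \<open>y\<close>: the entries after it
  were below \<open>y\<close>.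
\<close>

lemma column_unbump:
  assumes C': "column C'" and i: "i < length C'" "\<not> below y (C' ! i)" and y: "y \<in> A"
  obtains k where "i \<le> k" "k < length C'" "\<not> below y (C' ! k)"
    "column (C'[k := y])" "C' ! k \<in> A"
    "\<not> column_stops (C' ! k) (C'[k := y])"
    "column_bump (C' ! k) (C'[k := y]) = (C', y)"
proof -
  let ?P = "\<lambda>k. k < length C' \<and> \<not> below y (C' ! k)"
  define k where "k = (GREATEST k. ?P k)"
  have bound: "\<And>k. ?P k \<Longrightarrow> k \<le> length C'" by simp
  have P: "?P k" unfolding k_def by (rule GreatestI_nat[of ?P i, OF _ bound]) (use i in simp)
  have ik: "i \<le> k" unfolding k_def by (rule Greatest_le_nat[of ?P i, OF _ bound]) (use i in simp)
  have after: "below y (C' ! j)" if "k < j" "j < length C'" for j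
  proof (rule ccontr)
    assume "\<not> below y (C' ! j)"
    then have "j \<le> k" unfolding k_def by (intro Greatest_le_nat[of ?P j, OF _ bound]) (use that in simp)
    then show False using that by simp
  qed
  have before: "below (C' ! j) (C' ! k)" if "j < k" for j
    using column_nth[OF C' that] P by simp
  have nb: "\<not> below y (C' ! k)" using P by simp
  have col: "column (C'[k := y])"
  proof (rule columnI)
    show "C'[k := y] \<noteq> []" using P by auto
    show "set (C'[k := y]) \<subseteq> A" using C' y set_update_subset_insert[of C' k y] by (auto simp: column_def)
    fix a b assume ab: "a < b" "b < length (C'[k := y])"
    have "below (C' ! a) (C' ! b)" using column_nth[OF C', of a b] ab by simp
    then show "below (C'[k := y] ! a) (C'[k := y] ! b)"
      using ab after[of b] before[of a] nb P
      by (cases "a = k"; cases "b = k") (auto simp: below_def)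
  qed
  have st: "\<not> column_stops (C' ! k) (C'[k := y])"
    using nb P by (auto simp: column_stops_def set_update_memI intro!: bexI[of _ y])
  have "column_bump (C' ! k) (C'[k := y]) = ((C'[k := y])[k := C' ! k], (C'[k := y]) ! k)"
    by (rule column_bump_at[OF col]) (use P before in auto)
  then have bu: "column_bump (C' ! k) (C'[k := y]) = (C', y)" using P by simp
  have "C' ! k \<in> A" using C' P by (auto simp: column_def)
  then show thesis using that ik P nb col st bu by blast
qed

lemma bump_column:
  assumes C: "column C" and x: "x \<in> A" and k: "k < length C"
    and before: "\<And>i. i < k \<Longrightarrow> below (C ! i) x" and at: "\<not> below (C ! k) x"
  shows "column (C[k := x])"
proof (rule columnI)
  show "C[k := x] \<noteq> []" using k by auto
  show "set (C[k := x]) \<subseteq> A" using C x set_update_subset_insert[of C k x] by (auto simp: column_def)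
  fix a b assume ab: "a < b" "b < length (C[k := x])"
  then have "below (C ! a) (C ! b)" using column_nth[OF C] by simp
  then show "below (C[k := x] ! a) (C[k := x] ! b)"
    using ab before[of a] at k by (cases "a = k"; cases "b = k") (auto simp: below_def)
qed

lemma column_bump_inj:
  assumes C: "column C" "\<not> column_stops x C" and D: "column D" "\<not> column_stops x' D"
    and eq: "column_bump x C = column_bump x' D"
  shows "C = D \<and> x = x'"
proof -
  obtain k where k: "k < length C" "\<And>i. i < k \<Longrightarrow> below (C ! i) x" "\<not> below (C ! k) x"
    "column_bump x C = (C[k := x], C ! k)" using column_bumpE[OF C] by blast
  obtain l where l: "l < length D" "\<And>i. i < l \<Longrightarrow> below (D ! i) x'" "\<not> below (D ! l) x'"
    "column_bump x' D = (D[l := x'], D ! l)" using column_bumpE[OF D] by blast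
  have e: "C[k := x] = D[l := x']" "C ! k = D ! l" using eq k(4) l(4) by auto
  have len: "length C = length D" using e(1) by (metis length_list_update)
  have "\<not> k < l"
  proof
    assume "k < l"
    then have "below (C ! k) (C ! l)" "C ! l = x'"
      using column_nth[OF C(1), of k l] l(1) len e(1) by (auto, metis nth_list_update_eq nth_list_update_neq nat_neq_iff)
    then show False using l(3) e(2) by simp
  qed
  moreover have "\<not> l < k"
  proof
    assume "l < k"
    then have "below (D ! l) (D ! k)" "D ! k = x"
      using column_nth[OF D(1), of l k] k(1) len e(1) by (auto, metis nth_list_update_eq nth_list_update_neq nat_neq_iff)
    then show False using k(3) e(2) by simp
  qed
  ultimately have "k = l" by simp
  then show ?thesis
    using e k(1) l(1) by (metis list_update_id list_update_overwrite nth_list_update_eq)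
qed

end

locale column_insertion = column_letters +
  fixes ins :: "int \<Rightarrow> tableau \<Rightarrow> tableau"
  assumes column_ins_Nil: "ins x [] = [[x]]"
    and column_ins_Cons: "column C \<Longrightarrow> x \<in> A \<Longrightarrow> ins x (C # T) =
      (if column_stops x C then (C @ [x]) # T
       else fst (column_bump x C) # ins (snd (column_bump x C)) T)"
begin

sublocale line_insertion A column "\<lambda>a b. b \<le> a" column_adj column_stops column_bump ins
proof
  show "ins x [] = [[x]]" for x by (rule column_ins_Nil)
  show "ins x (C # T) = (if column_stops x C then (C @ [x]) # T
       else fst (column_bump x C) # ins (snd (column_bump x C)) T)" if "column C" "x \<in> A" for C x T
    by (rule column_ins_Cons[OF that])
  show "C \<noteq> [] \<and> set C \<subseteq> A" if "column C" for C
    using that by (simp add: column_def)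
  show "column [x]" if "x \<in> A" for x using that by (simp add: column_def)
  show "column (C @ [x]) \<longleftrightarrow> column C \<and> column_stops x C" if "C \<noteq> []" "x \<in> A" for C x
    using that by (auto simp: column_def sorted_wrt_append column_stops_def)
  show "length D \<le> length C" if "column_adj C D" for C D
    using that by (simp add: column_adj_def)
  show "column_adj (C @ [x]) D \<longleftrightarrow> column_adj C D" if "length D \<le> length C" for C D x
    using that by (auto simp: column_adj_def nth_append)
next
  fix C C' x y assume C: "column C" "x \<in> A" "\<not> column_stops x C" "column_bump x C = (C', y)"
  obtain k where k: "k < length C" "\<And>i. i < k \<Longrightarrow> below (C ! i) x" "\<not> below (C ! k) x"
    "C' = C[k := x]" "y = C ! k" using column_bumpE[OF C(1,3)] C(4) by (metis fst_conv snd_conv)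
  show "column C' \<and> length C' = length C \<and> mset C' + {#y#} = mset C + {#x#}"
    using bump_column[OF C(1,2) k(1-3)] mset_bump[OF k(1)] by (simp add: k(4,5))
  have early: "\<not> below y (C' ! i)" if "i \<le> k" for i
    using k(1,3) k(2)[of i] that by (cases "i = k") (auto simp: k(4,5) below_def)
  show "column_adj C' [y]" using early[of 0] k(1) by (auto simp: column_adj_def k(4))
  show "column_adj C' (D @ [y])" if D: "column D" "column_stops y D" "column_adj C D" for D
  proof -
    \<comment> \<open>The letter \<open>y\<close> stood to the left of the entry of \<open>D\<close> in its row, so \<open>D\<close> could not accept it if it reached that row.\<close>
    have "length D \<le> k"
    proof (rule ccontr)
      assume "\<not> length D \<le> k"
      then have "below (D ! k) y" "\<not> below (D ! k) (C ! k)"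
        using D(2,3) by (auto simp: column_adj_def column_stops_def)
      then show False by (simp add: k(5))
    qed
    then show ?thesis using D(3) k(1) early[of "length D"]
      by (auto simp: column_adj_def nth_append less_Suc_eq k(4))
  qed
  show "column_adj C' D'"
    if D: "column D" "\<not> column_stops y D" "column_bump y D = (D', z)" "column_adj C D" for D D' z
  proof -
    obtain l where l: "l < length D" "\<And>i. i < l \<Longrightarrow> below (D ! i) y" "\<not> below (D ! l) y"
      "D' = D[l := y]" using column_bumpE[OF D(1,2)] D(3) by (metis fst_conv)
    have adj: "\<not> below (D ! i) (C ! i)" if "i < length D" for i
      using D(4) that by (simp add: column_adj_def)
    \<comment> \<open>The ejected letter enters the next column weakly above the row that it left.\<close>
    have lk: "l \<le> k" using l(1) l(2)[of k] adj[of k] by (force simp: k(5))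
    have "\<not> below (D' ! i) (C' ! i)" if "i < length D" for i
      using adj[OF that] that early[of l] lk l(3) k(1,3)
      by (cases "i = l"; cases "i = k") (auto simp: l(4) k(4,5) below_def)
    then show ?thesis using D(4) by (simp add: column_adj_def l(4) k(4))
  qed
next
  fix C x D x'
  assume "column C" "\<not> column_stops x C" "column D" "\<not> column_stops x' D" "column_bump x C = column_bump x' D"
  then show "C = D \<and> x = x'" by (rule column_bump_inj)
next
  fix C' y assume C': "column C'" and y: "y \<in> A"
  show "\<exists>C x. column C \<and> x \<in> A \<and> \<not> column_stops x C \<and> column_bump x C = (C', y)"
    if adj: "column_adj C' [y]"
  proof -
    have "0 < length C'" "\<not> below y (C' ! 0)" using adj by (auto simp: column_adj_def)
    then show ?thesis by (rule column_unbump[OF C' _ _ y]) blast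
  qed
  show "\<exists>C x. column C \<and> x \<in> A \<and> \<not> column_stops x C \<and> column_bump x C = (C', y) \<and> column_adj C D"
    if D: "column D" "column_stops y D" "column_adj C' (D @ [y])" for D
  proof -
    have i: "length D < length C'" "\<not> below y (C' ! length D)"
      using D(3) by (auto simp: column_adj_def)
    obtain k where k: "length D \<le> k" "k < length C'"
      "column (C'[k := y])" "C' ! k \<in> A" "\<not> column_stops (C' ! k) (C'[k := y])"
      "column_bump (C' ! k) (C'[k := y]) = (C', y)"
      by (rule column_unbump[OF C' i y]) blast
    have "\<not> below (D ! i) (C' ! i)" if "i < length D" for i
      using D(3) that by (auto simp: column_adj_def nth_append dest: spec[of _ i])
    then have "column_adj (C'[k := y]) D" using k(1) i(1) by (auto simp: column_adj_def)
    then show ?thesis using k by blast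
  qed
  show "\<exists>C x. column C \<and> x \<in> A \<and> \<not> column_stops x C \<and> column_bump x C = (C', y) \<and> column_adj C D"
    if D: "column D" "\<not> column_stops y D" "column_bump y D = (D', z)" "column_adj C' D'" for D D' z
  proof -
    obtain l where l: "l < length D" "\<And>i. i < l \<Longrightarrow> below (D ! i) y" "\<not> below (D ! l) y"
      "D' = D[l := y]" using column_bumpE[OF D(1,2)] D(3) by (metis fst_conv)
    have len: "length D \<le> length C'" and adj: "\<And>i. i < length D \<Longrightarrow> \<not> below (D' ! i) (C' ! i)"
      using D(4) by (auto simp: column_adj_def l(4))
    have i: "l < length C'" "\<not> below y (C' ! l)" using len l(1) adj[OF l(1)] by (auto simp: l(4))
    obtain k where k: "l \<le> k" "k < length C'"
      "column (C'[k := y])" "C' ! k \<in> A" "\<not> column_stops (C' ! k) (C'[k := y])"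
      "column_bump (C' ! k) (C'[k := y]) = (C', y)"
      by (rule column_unbump[OF C' i y]) blast
    have "\<not> below (D ! j) (C'[k := y] ! j)" if "j < length D" for j
      using adj[OF that] l(3) i(2) k(1,2) column_nth[OF D(1), of l j] that
      by (cases "j = l"; cases "j = k") (auto simp: l(4) below_def)
    then have "column_adj (C'[k := y]) D" using len by (auto simp: column_adj_def)
    then show ?thesis using k by blast
  qed
qed

end


section \<open>Bounding sums of tableau weights\<close>

text \<open>
  If the elements of \<open>X\<close> are determined by families of numbers and their weights are bounded by products over such a family,
  then the sum over \<open>X\<close> is at most the sum over all families, which factorizes.
\<close>

lemma sum_le_prod_of_code:
  fixes w :: "'x \<Rightarrow> real" and f :: "'i \<Rightarrow> nat \<Rightarrow> real"
  assumes X: "finite X" and I: "finite I"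
    and inj: "\<And>x y. x \<in> X \<Longrightarrow> y \<in> X \<Longrightarrow> (\<And>i. i \<in> I \<Longrightarrow> e x i = e y i) \<Longrightarrow> x = y"
    and le: "\<And>x. x \<in> X \<Longrightarrow> w x \<le> c * (\<Prod>i\<in>I. f i (e x i))"
    and f: "\<And>i k. i \<in> I \<Longrightarrow> 0 \<le> f i k" and c: "0 \<le> c"
    and B: "\<And>i M. i \<in> I \<Longrightarrow> (\<Sum>k\<le>M. f i k) \<le> B i"
  shows "(\<Sum>x\<in>X. w x) \<le> c * (\<Prod>i\<in>I. B i)"
proof -
  define M where "M = Max (insert 0 ((\<lambda>(x, i). e x i) ` (X \<times> I)))"
  have M: "e x i \<le> M" if "x \<in> X" "i \<in> I" for x i
    unfolding M_def using that X I by (intro Max_ge) force+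
  let ?r = "\<lambda>x. restrict (e x) I"
  have injr: "inj_on ?r X"
  proof (rule inj_onI)
    fix x y assume "x \<in> X" "y \<in> X" "?r x = ?r y"
    then show "x = y" using inj by (metis restrict_apply')
  qed
  have "(\<Sum>x\<in>X. w x) \<le> (\<Sum>x\<in>X. c * (\<Prod>i\<in>I. f i (e x i)))" by (rule sum_mono) (rule le)
  also have "\<dots> = c * (\<Sum>g\<in>?r ` X. \<Prod>i\<in>I. f i (g i))"
    by (simp add: sum_distrib_left sum.reindex[OF injr])
  also have "(\<Sum>g\<in>?r ` X. \<Prod>i\<in>I. f i (g i)) \<le> (\<Sum>g\<in>PiE I (\<lambda>_. {..M}). \<Prod>i\<in>I. f i (g i))"
    using M I f by (intro sum_mono2 finite_PiE) (auto intro!: prod_nonneg)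
  also have "\<dots> = (\<Prod>i\<in>I. \<Sum>k\<le>M. f i k)" using I by (subst prod_sum_PiE) auto
  also have "\<dots> \<le> (\<Prod>i\<in>I. B i)" using B f by (intro prod_mono) (auto intro!: sum_nonneg)
  finally show ?thesis using c by (simp add: mult_left_mono)
qed

lemma geometric_sum_le:
  fixes x :: real
  assumes "0 \<le> x" "x < 1"
  shows "(\<Sum>k\<le>M. x ^ k) \<le> 1 / (1 - x)"
  using assms by (simp add: sum_gp0 divide_right_mono)

context letter_law
begin

lemma weight_count: "set w \<subseteq> A \<Longrightarrow> weight w = (\<Prod>a\<in>A. p a ^ count (mset w) a)"
proof (induction w)
  case (Cons x w)
  have "(\<Prod>a\<in>A. p a ^ count (mset (x # w)) a) = (\<Prod>a\<in>A. (if a = x then p a else 1) * p a ^ count (mset w) a)"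
    by (intro prod.cong) auto
  also have "\<dots> = p x * (\<Prod>a\<in>A. p a ^ count (mset w) a)"
    using Cons.prems finite_A by (simp add: prod.distrib)
  finally show ?case using Cons by simp
qed simp

lemma length_count: "set w \<subseteq> A \<Longrightarrow> length w = (\<Sum>a\<in>A. count (mset w) a)"
  using sum.mono_neutral_left[of A "set w" "count (mset w)"] finite_A
  by (simp add: size_multiset_overloaded_eq count_eq_zero_iff flip: size_mset)

text \<open>
  Suppose that a tableau is determined by sorted words, one for each letter \<open>c\<close>, of lengths \<open>N c\<close>.  Relative to the weight of
  the words that consist of copies of \<open>c\<close>, a letter \<open>a\<close> in the word of \<open>c\<close> contributes the factor \<open>p a / p c\<close>.  If this is
  less than \<open>1\<close>, the sum over the multiplicity of \<open>a\<close> is a geometric series; otherwise the multiplicity is at most \<open>1\<close>.  The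
  multiplicity of \<open>c\<close> itself is determined by the length, so it is left out of the code.  The constant does not depend
  on \<open>N\<close>.
\<close>

theorem sum_weight_lines_le:
  "\<exists>K. \<forall>(X :: tableau set) (line :: tableau \<Rightarrow> int \<Rightarrow> int list) N. finite X \<longrightarrow>
     (\<forall>T\<in>X. \<forall>T'\<in>X. (\<forall>c\<in>A. line T c = line T' c) \<longrightarrow> T = T') \<longrightarrow>
     (\<forall>T\<in>X. weight (concat T) = (\<Prod>c\<in>A. weight (line T c))) \<longrightarrow>
     (\<forall>T\<in>X. \<forall>c\<in>A. length (line T c) = N c \<and> sorted (line T c) \<and> set (line T c) \<subseteq> A \<and>
        (\<forall>a\<in>set (line T c). a = c \<or> p a < p c \<or> count (mset (line T c)) a \<le> 1)) \<longrightarrow>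
     (\<Sum>T\<in>X. weight (concat T)) \<le> K * (\<Prod>c\<in>A. p c ^ N c)"
proof (rule exI, intro allI impI)
  define I where "I = (SIGMA c:A. A - {c})"
  define \<rho> where "\<rho> = (\<lambda>(c, a). p a / p c)"
  define f where "f = (\<lambda>i k. if \<rho> i < 1 \<or> k \<le> 1 then \<rho> i ^ k else 0)"
  define B where "B = (\<lambda>i. if \<rho> i < 1 then 1 / (1 - \<rho> i) else 1 + \<rho> i)"
  fix X :: "tableau set" and line N
  assume X: "finite X"
    and inj: "\<forall>T\<in>X. \<forall>T'\<in>X. (\<forall>c\<in>A. line T c = line T' c) \<longrightarrow> T = T'"
    and wt: "\<forall>T\<in>X. weight (concat T) = (\<Prod>c\<in>A. weight (line T c))"
    and "\<forall>T\<in>X. \<forall>c\<in>A. length (line T c) = N c \<and> sorted (line T c) \<and> set (line T c) \<subseteq> A \<and>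
        (\<forall>a\<in>set (line T c). a = c \<or> p a < p c \<or> count (mset (line T c)) a \<le> 1)"
  then have len: "\<And>T c. T \<in> X \<Longrightarrow> c \<in> A \<Longrightarrow> length (line T c) = N c"
    and srt: "\<And>T c. T \<in> X \<Longrightarrow> c \<in> A \<Longrightarrow> sorted (line T c)"
    and sub: "\<And>T c. T \<in> X \<Longrightarrow> c \<in> A \<Longrightarrow> set (line T c) \<subseteq> A"
    and cnt: "\<And>T c a. T \<in> X \<Longrightarrow> c \<in> A \<Longrightarrow> a \<in> set (line T c) \<Longrightarrow>
        a = c \<or> p a < p c \<or> count (mset (line T c)) a \<le> 1" by blast+
  define e where "e = (\<lambda>T (c, a). count (mset (line T c)) a)"
  have \<rho>_pos: "0 < \<rho> i" if "i \<in> I" for i using that p_pos by (auto simp: \<rho>_def I_def)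
  have diag: "count (mset (line T c)) c + (\<Sum>a\<in>A - {c}. e T (c, a)) = N c" if "T \<in> X" "c \<in> A" for T c
    using length_count[OF sub[OF that]] len[OF that] that finite_A
    by (simp add: e_def sum.remove[OF finite_A that(2)])
  show "(\<Sum>T\<in>X. weight (concat T)) \<le> (\<Prod>i\<in>I. B i) * (\<Prod>c\<in>A. p c ^ N c)"
  proof (subst mult.commute, rule sum_le_prod_of_code[where e = e and f = f, OF X])
    show "finite I" unfolding I_def using finite_A by auto
    show "0 \<le> f i k" if "i \<in> I" for i k using \<rho>_pos[OF that] by (simp add: f_def)
    show "0 \<le> (\<Prod>c\<in>A. p c ^ N c)" by (intro prod_nonneg) (simp add: p_pos less_imp_le)
    show "(\<Sum>k\<le>M. f i k) \<le> B i" if "i \<in> I" for i M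
    proof (cases "\<rho> i < 1")
      case True
      then show ?thesis using geometric_sum_le[of "\<rho> i" M] \<rho>_pos[OF that] by (simp add: f_def B_def)
    next
      case False
      have "(\<Sum>k\<le>M. f i k) \<le> (\<Sum>k\<le>max M 1. f i k)"
        using \<rho>_pos[OF that] by (intro sum_mono2) (auto simp: f_def)
      also have "\<dots> = (\<Sum>k\<in>{0, 1}. f i k)"
        using False by (intro sum.mono_neutral_right) (auto simp: f_def)
      finally show ?thesis using False by (simp add: f_def B_def)
    qed
    show "T = T'" if T: "T \<in> X" "T' \<in> X" and eq: "\<And>i. i \<in> I \<Longrightarrow> e T i = e T' i" for T T'
    proof -
      have "line T c = line T' c" if c: "c \<in> A" for c
      proof -
        have off: "e T (c, a) = e T' (c, a)" if "a \<in> A - {c}" for a using eq[of "(c, a)"] that c by (simp add: I_def)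
        have "count (mset (line T c)) a = count (mset (line T' c)) a" for a
        proof (cases "a = c")
          case True
          have "(\<Sum>a\<in>A - {c}. e T (c, a)) = (\<Sum>a\<in>A - {c}. e T' (c, a))" using off by (intro sum.cong) auto
          then show ?thesis using diag[OF T(1) c] diag[OF T(2) c] True by simp
        next
          case False
          show ?thesis
          proof (cases "a \<in> A")
            case True
            then show ?thesis using off[of a] False by (simp add: e_def)
          next
            case False
            then have "a \<notin> set (line T c)" "a \<notin> set (line T' c)" using sub T c by blast+
            then show ?thesis by (metis count_eq_zero_iff set_mset_mset)
          qed
        qed
        then have "mset (line T c) = mset (line T' c)" by (rule multiset_eqI)
        then show ?thesis using srt T c by (metis properties_for_sort)
      qed
      then show ?thesis using inj T by blast
    qed
    show "weight (concat T) \<le> (\<Prod>c\<in>A. p c ^ N c) * (\<Prod>i\<in>I. f i (e T i))" if T: "T \<in> X" for T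
    proof -
      have "weight (line T c) = p c ^ N c * (\<Prod>a\<in>A - {c}. f (c, a) (e T (c, a)))" if c: "c \<in> A" for c
      proof -
        have pc: "p c \<noteq> 0" using p_pos[OF c] by simp
        have f: "f (c, a) (e T (c, a)) = (p a / p c) ^ e T (c, a)" if "a \<in> A - {c}" for a
        proof (cases "a \<in> set (line T c)")
          case True
          then show ?thesis using cnt[OF T c True] that p_pos[OF c] by (auto simp: f_def \<rho>_def e_def)
        next
          case False
          then have "e T (c, a) = 0" by (simp add: e_def count_eq_zero_iff flip: set_mset_mset)
          then show ?thesis by (simp add: f_def)
        qed
        have "weight (line T c) = p c ^ count (mset (line T c)) c * (\<Prod>a\<in>A - {c}. p a ^ e T (c, a))"
          unfolding weight_count[OF sub[OF T c]] prod.remove[OF finite_A c] by (simp add: e_def)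
        also have "(\<Prod>a\<in>A - {c}. p a ^ e T (c, a))
            = (\<Prod>a\<in>A - {c}. p c ^ e T (c, a) * f (c, a) (e T (c, a)))"
          using pc by (intro prod.cong refl) (simp add: f power_divide)
        also have "\<dots> = p c ^ (\<Sum>a\<in>A - {c}. e T (c, a)) * (\<Prod>a\<in>A - {c}. f (c, a) (e T (c, a)))"
          by (simp add: prod.distrib power_sum)
        finally show ?thesis using diag[OF T c] by (simp flip: power_add)
      qed
      then have "(\<Prod>c\<in>A. weight (line T c)) = (\<Prod>c\<in>A. p c ^ N c) * (\<Prod>c\<in>A. \<Prod>a\<in>A - {c}. f (c, a) (e T (c, a)))"
        by (simp add: prod.distrib)
      also have "(\<Prod>c\<in>A. \<Prod>a\<in>A - {c}. f (c, a) (e T (c, a))) = (\<Prod>i\<in>I. f i (e T i))"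
        unfolding I_def using finite_A by (subst prod.Sigma) (auto simp: split_def)
      finally show ?thesis using wt T by simp
    qed
  qed
qed

end


section \<open>Hook shapes and their column lengths\<close>

definition conjugate :: "nat list \<Rightarrow> nat \<Rightarrow> nat" where
  "conjugate ls i = length (filter (\<lambda>c. i < c) ls)"

text \<open>
  The box in row \<open>i\<close> and column \<open>j\<close> belongs to the diagram if it lies in the row, or if it lies in the column.
\<close>

lemma less_conjugate_iff:
  assumes "successively (\<lambda>a b. b \<le> a) ls"
  shows "j < conjugate ls i \<longleftrightarrow> i < part ls j"
proof -
  have srt: "sorted_wrt (\<lambda>a b. b \<le> a) ls"
    using assms successively_conv_sorted_wrt[of "\<lambda>a b :: nat. b \<le> a" ls] by (auto simp: transp_def)
  show ?thesis using srt unfolding conjugate_def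
  proof (induction ls arbitrary: j)
    case (Cons a ls)
    show ?case
    proof (cases "i < a")
      case True
      then show ?thesis using Cons by (cases j) (auto simp: part_def)
    next
      case False
      then have "filter (\<lambda>c. i < c) ls = []" using Cons.prems by (auto simp: filter_empty_conv)
      moreover have "part (a # ls) j \<le> a" using Cons.prems nth_mem by (cases j) (auto simp: part_def)
      ultimately show ?thesis using False by auto
    qed
  qed (simp add: part_def)
qed

lemma row_lengths_conjugate: "row_lengths_of_columns T = conjugate (map length T)"
  by (rule ext) (simp add: row_lengths_of_columns_def conjugate_def filter_map o_def)

lemma conjugate_grow:
  assumes "j \<le> length ls"
  shows "conjugate (grow j ls) i = conjugate ls i + (if i = part ls j then 1 else 0)"
proof (cases "j < length ls")
  case True
  define P Q where "P = take j ls" and "Q = drop (Suc j) ls"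
  have "ls = P @ ls ! j # Q" using True by (simp add: P_def Q_def id_take_nth_drop)
  moreover have "grow j ls = P @ Suc (ls ! j) # Q"
    using True by (simp add: grow_def upd_conv_take_nth_drop P_def Q_def)
  moreover have "conjugate (P @ Suc c # Q) i = conjugate (P @ c # Q) i + (if i = c then 1 else 0)" for c
    by (auto simp: conjugate_def)
  ultimately have "conjugate (grow j ls) i = conjugate ls i + (if i = ls ! j then 1 else 0)"
    by metis
  then show ?thesis using True by (auto simp: part_def split: if_splits)
next
  case False
  then show ?thesis using assms by (auto simp: conjugate_def grow_def part_def)
qed

lemma ex_conjugate:
  assumes lam: "antimono lam" "finite {i. lam i \<noteq> 0}"
  shows "\<exists>ls. 0 \<notin> set ls \<and> successively (\<lambda>a b. b \<le> a) ls \<and> conjugate ls = lam"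
proof -
  have down: "\<exists>k. {i. j < lam i} = {..<k}" for j
  proof -
    have "finite {i. j < lam i}" by (rule finite_subset[OF _ lam(2)]) auto
    then obtain k where "{i. j < lam i} \<subseteq> {..<k}" using finite_nat_iff_bounded by blast
    then have ex: "\<not> j < lam k" by auto
    define l where "l = (LEAST l. \<not> j < lam l)"
    have "\<not> j < lam l" unfolding l_def by (rule LeastI[of "\<lambda>l. \<not> j < lam l", OF ex])
    then have "i < l" if "j < lam i" for i using antimonoD[OF lam(1), of l i] that by (metis leI less_le_trans)
    moreover have "j < lam i" if "i < l" for i using not_less_Least[of i "\<lambda>l. \<not> j < lam l"] that by (simp add: l_def)
    ultimately show ?thesis by auto
  qed
  then obtain w where w: "\<And>j. {i. j < lam i} = {..<w j}" by metis
  have w': "i < w j \<longleftrightarrow> j < lam i" for i j using w[of j] by auto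
  have "antimono w"
  proof (rule antimonoI)
    fix x y :: nat assume "x \<le> y"
    then have "i < w x" if "i < w y" for i using that by (simp add: w')
    then show "w y \<le> w x" by (meson leI less_irrefl)
  qed
  moreover have "finite {j. w j \<noteq> 0}"
  proof (rule finite_subset)
    show "{j. w j \<noteq> 0} \<subseteq> {..<lam 0}" using w'[of 0] by auto
  qed simp
  ultimately obtain ls where ls: "0 \<notin> set ls" "part ls = w" using ex_part by blast
  have desc: "successively (\<lambda>a b. b \<le> a) ls"
    unfolding successively_conv_nth
  proof (intro allI impI)
    fix i assume "Suc i < length ls"
    then have "ls ! i = w i" "ls ! Suc i = w (Suc i)" by (auto simp: part_def simp flip: ls(2))
    then show "ls ! Suc i \<le> ls ! i" using \<open>antimono w\<close> by (simp add: antimonoD)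
  qed
  have "conjugate ls i = lam i" for i
  proof -
    have "j < conjugate ls i \<longleftrightarrow> j < lam i" for j
      unfolding less_conjugate_iff[OF desc] ls(2) by (rule w')
    then show ?thesis by (meson less_irrefl linorder_neqE_nat)
  qed
  then show ?thesis using ls(1) desc by blast
qed

lemma partition_vectors_eq:
  "partition_vectors n = row_vector n ` {w. antimono w \<and> (\<forall>i\<ge>n. w i = 0)}"
proof safe
  fix v assume "v \<in> partition_vectors n"
  then have zero: "\<And>a. a \<notin> {1..int n} \<Longrightarrow> v a = 0" and step: "\<And>a. a \<in> {1..<int n} \<Longrightarrow> v (a + 1) \<le> v a"
    and end_nonneg: "0 \<le> v (int n)" unfolding partition_vectors_def by blast+
  define w where "w j = (if j < n then nat (v (int j + 1)) else 0)" for j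
  have "w (Suc j) \<le> w j" for j
    using step[of "int j + 1"] by (simp add: w_def add.commute nat_mono)
  then have "antimono w" by (intro antimonoI) (simp add: lift_Suc_antimono_le)
  moreover have "v = row_vector n w"
  proof
    fix a
    have nonneg: "0 \<le> v (int (n - Suc l) + 1)" if "l < n" for l
      using that
    proof (induction l)
      case 0
      then show ?case using end_nonneg by simp
    next
      case (Suc l)
      have "int (n - Suc (Suc l)) + 1 + 1 = int (n - Suc l) + 1" using Suc.prems by simp
      moreover have "int (n - Suc (Suc l)) + 1 \<in> {1..<int n}" using Suc.prems by simp
      ultimately show ?case using step[of "int (n - Suc (Suc l)) + 1"] Suc by simp
    qed
    show "v a = row_vector n w a"
    proof (cases "a \<in> {1..int n}")
      case True
      then have range: "1 \<le> a" "a \<le> int n" by simp_all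
      have "int (nat (a - 1)) = a - 1" by (rule nat_0_le) (use range in linarith)
      then have a: "nat (a - 1) < n" "int (nat (a - 1)) + 1 = a" using range by linarith+
      have "n - Suc (n - Suc (nat (a - 1))) = nat (a - 1)" "n - Suc (nat (a - 1)) < n" using a(1) by auto
      then have "0 \<le> v a" using nonneg[of "n - Suc (nat (a - 1))"] a(2) by simp
      moreover have "w (nat (a - 1)) = nat (v a)" using a(1) by (simp only: w_def if_True a(2))
      moreover have "row_vector n w a = int (w (nat (a - 1)))" using True by (simp only: row_vector_def if_True)
      ultimately show ?thesis by simp
    next
      case False
      then have "row_vector n w a = 0" unfolding row_vector_def by (simp only: if_False)
      then show ?thesis using zero[OF False] by simp
    qed
  qed
  ultimately show "v \<in> row_vector n ` {w. antimono w \<and> (\<forall>i\<ge>n. w i = 0)}" by (auto simp: w_def)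
next
  fix w :: "nat \<Rightarrow> nat" assume w: "antimono w" "\<forall>i\<ge>n. w i = 0"
  have "row_vector n w (a + 1) \<le> row_vector n w a" if "a \<in> {1..<int n}" for a
    using that antimonoD[OF w(1), of "nat (a - 1)" "nat a"] by (simp add: row_vector_def)
  then show "row_vector n w \<in> partition_vectors n"
    unfolding partition_vectors_def by (simp add: row_vector_def)
qed

text \<open>
  The coordinates of a hook shape, with the \<open>m\<close> strict letters starting at an arbitrary \<open>b\<close>.  For \<open>b = - int m\<close> this is the vector
  of a hook partition, and for \<open>b = 1\<close> and \<open>n = 0\<close> it is the vector of a partition with at most \<open>m\<close> parts.
\<close>

definition hook_coordinates :: "int \<Rightarrow> nat \<Rightarrow> nat \<Rightarrow> (nat \<Rightarrow> nat) \<Rightarrow> vector" where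
  "hook_coordinates b m n lam = (\<lambda>a.
     if a \<in> {b..<b + int m} then int (lam (nat (a - b)))
     else if a \<in> {1..int n} then int (card {i. m \<le> i \<and> a \<le> int (lam i)})
     else 0)"

lemma conjugate_antimono: "antimono (conjugate ls)"
proof (rule antimonoI)
  show "conjugate ls y \<le> conjugate ls x" if "x \<le> y" for x y
    using that by (induction ls) (auto simp: conjugate_def)
qed

lemma conjugate_finite: "finite {i. conjugate ls i \<noteq> 0}"
proof (rule finite_subset)
  show "{i. conjugate ls i \<noteq> 0} \<subseteq> {..<Max (insert 0 (set ls))}"
  proof
    fix i assume "i \<in> {i. conjugate ls i \<noteq> 0}"
    then obtain c where "c \<in> set ls" "i < c" by (auto simp: conjugate_def filter_empty_conv)
    then show "i \<in> {..<Max (insert 0 (set ls))}" by (auto simp: less_max_iff_disj Max_gr_iff)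
  qed
qed simp

lemma arm_leg_count:
  assumes "successively (\<lambda>a b. b \<le> a) ls" "1 \<le> a"
  shows "card {i. m \<le> i \<and> a \<le> int (conjugate ls i)} = part ls (nat (a - 1)) - m"
proof -
  have "{i. m \<le> i \<and> a \<le> int (conjugate ls i)} = {m..<part ls (nat (a - 1))}"
  proof -
    have iff: "a \<le> int (conjugate ls i) \<longleftrightarrow> i < part ls (nat (a - 1))" for i
      using less_conjugate_iff[OF assms(1), of "nat (a - 1)" i] assms(2) by linarith
    show ?thesis unfolding iff by auto
  qed
  then show ?thesis by simp
qed

text \<open>
  The families \<open>GL\<close> and \<open>GLsuper\<close> at once: \<open>m\<close> letters that are strict in columns, followed by the \<open>n\<close> letters \<open>1, ..., n\<close> that are
  strict in rows.
\<close>

locale hook_columns = letter_law "alphabet d" p +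
  column_insertion "alphabet d" "\<lambda>a. b + int m \<le> a" "insertion d"
  for d :: family and p :: "int \<Rightarrow> real" and b :: int and m n :: nat +
  assumes alphabet_eq: "alphabet d = {b..<b + int m} \<union> {1..int n}"
    and m_pos: "0 < m"
    and gap: "b + int m \<le> 1 \<or> n = 0"
    and anti_strict: "strict_antimono_on {b..<b + int m} p"
    and anti_weak: "strict_antimono_on {1..int n} p"
    and partitions_eq: "partitions_of d = hook_coordinates b m n ` hook_partitions m n"
    and shape_eq: "shape d T = hook_coordinates b m n (row_lengths_of_columns T)"
begin

lemma disjoint_letters: "a \<in> {1..int n} \<Longrightarrow> a \<notin> {b..<b + int m}"
  using gap by auto

lemma above_iff: "a \<in> alphabet d \<Longrightarrow> b + int m \<le> a \<longleftrightarrow> a \<in> {1..int n}"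
  using gap by (auto simp: alphabet_eq)

abbreviation right_of :: "int \<Rightarrow> int \<Rightarrow> bool" where
  "right_of a c \<equiv> \<not> below c a"

lemma right_of_trans: "right_of x y \<Longrightarrow> right_of y z \<Longrightarrow> right_of x z"
  by (auto simp: below_def)

lemma column_adj_trans: "transp column_adj"
proof (rule transpI)
  fix C D E assume CD: "column_adj C D" and DE: "column_adj D E"
  have "right_of (C ! i) (E ! i)" if "i < length E" for i
    using CD DE that right_of_trans unfolding column_adj_def by (metis order_less_le_trans)
  then show "column_adj C E" using CD DE by (simp add: column_adj_def)
qed

lemma tab_sorted: "tab T \<Longrightarrow> sorted_wrt column_adj T"
  using successively_conv_sorted_wrt[OF column_adj_trans] by (simp add: tab_def)

lemma tab_row:
  assumes "tab T" "j < k" "k < length T" "i < length (T ! k)"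
  shows "i < length (T ! j)" "right_of (T ! j ! i) (T ! k ! i)"
proof -
  have "column_adj (T ! j) (T ! k)"
    using tab_sorted[OF assms(1)] assms(2,3) by (simp add: sorted_wrt_iff_nth_less)
  then show "i < length (T ! j)" "right_of (T ! j ! i) (T ! k ! i)"
    using assms(4) by (auto simp: column_adj_def)
qed

lemma column_entry_ge:
  assumes "column C" "i < length C" "i \<le> m"
  shows "b + int i \<le> C ! i"
  using assms
proof (induction i)
  case 0
  then have "C ! 0 \<in> alphabet d" by (auto simp: column_def)
  then show ?case using gap by (auto simp: alphabet_eq)
next
  case (Suc i)
  then have "b + int i \<le> C ! i" by simp
  moreover have "below (C ! i) (C ! Suc i)" using column_nth[OF Suc.prems(1)] Suc.prems by simp
  moreover have "int i + 1 \<le> int m" using Suc.prems by simp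
  ultimately show ?case by (auto simp: below_def)
qed

lemma column_tail:
  assumes "column C" "m \<le> i" "i < length C"
  shows "C ! i \<in> {1..int n}"
proof -
  have "b + int m \<le> C ! m" using column_entry_ge[OF assms(1), of m] assms by simp
  also have "C ! m \<le> C ! i"
    using column_nth[OF assms(1), of m i] assms by (cases "m = i") (auto simp: below_def)
  finally have "b + int m \<le> C ! i" .
  moreover have "C ! i \<in> alphabet d" using assms nth_mem by (auto simp: column_def)
  ultimately show ?thesis using above_iff by blast
qed

text \<open>
  Below row \<open>m\<close> all letters are of the second kind, and these increase strictly along rows.
\<close>

lemma tail_entry_ge:
  assumes "tab T" "j < length T" "m \<le> i" "i < length (T ! j)"
  shows "int j + 1 \<le> T ! j ! i"
  using assms
proof (induction j)
  case 0
  then show ?case using column_tail[of "T ! 0" i] by (auto simp: tab_def)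
next
  case (Suc j)
  have r: "i < length (T ! j)" "right_of (T ! j ! i) (T ! Suc j ! i)"
    using tab_row[OF Suc.prems(1), of j "Suc j" i] Suc.prems by auto
  have "column (T ! j)" using Suc.prems by (simp add: tab_def)
  then have "T ! j ! i \<in> {1..int n}" using column_tail[OF _ Suc.prems(3) r(1)] by simp
  then have "b + int m \<le> T ! j ! i" using gap by auto
  then have "T ! j ! i < T ! Suc j ! i" using r(2) by (auto simp: below_def)
  then show ?case using Suc.IH Suc.prems r(1) by simp
qed

text \<open>
  By \<open>tail_entry_ge\<close> a row below row \<open>m\<close> has at most \<open>n\<close> boxes, so column \<open>n\<close> (counted from \<open>0\<close>) has at most \<open>m\<close> boxes.
\<close>

definition inside :: "nat list \<Rightarrow> bool" where
  "inside ls \<longleftrightarrow> part ls n \<le> m"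

definition vec :: "nat list \<Rightarrow> vector" where
  "vec ls = hook_coordinates b m n (conjugate ls)"

text \<open>
  The length of column \<open>j\<close>: the boxes in the first \<open>m\<close> rows, counted by the row coordinates, plus those further below.
\<close>

definition decode :: "vector \<Rightarrow> nat \<Rightarrow> nat" where
  "decode v j = card {i. i < m \<and> j < nat (v (b + int i))} + (if j < n then nat (v (int j + 1)) else 0)"

lemma admissible_desc: "admissible ls \<Longrightarrow> successively (\<lambda>a b. b \<le> a) ls"
  by (simp add: admissible_def)

lemma part_antimono:
  assumes "admissible ls" "i \<le> j"
  shows "part ls j \<le> part ls i"
proof (rule ccontr)
  assume "\<not> part ls j \<le> part ls i"
  then have "j < conjugate ls (part ls i)"
    using less_conjugate_iff[OF admissible_desc[OF assms(1)]] by simp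
  then have "i < conjugate ls (part ls i)" using assms(2) by simp
  then show False using less_conjugate_iff[OF admissible_desc[OF assms(1)]] by simp
qed

lemma tab_inside: 
  assumes "tab T"
  shows "inside (map length T)"
proof (rule ccontr)
  assume "\<not> inside (map length T)"
  then have n: "n < length T" "m < length (T ! n)" by (auto simp: inside_def part_def split: if_splits)
  then have "int n + 1 \<le> T ! n ! m" using tail_entry_ge[OF assms] by simp
  moreover have "T ! n ! m \<in> {1..int n}"
    using column_tail[of "T ! n" m] assms n by (simp add: tab_def)
  ultimately show False by simp
qed

lemma vec_strict: "i < m \<Longrightarrow> vec ls (b + int i) = int (conjugate ls i)"
  by (simp add: vec_def hook_coordinates_def)

lemma vec_weak: "admissible ls \<Longrightarrow> j < n \<Longrightarrow> vec ls (int j + 1) = int (part ls j - m)"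
proof -
  assume ls: "admissible ls" and j: "j < n"
  then have "int j + 1 \<in> {1..int n}" by simp
  moreover from this have "int j + 1 \<notin> {b..<b + int m}" by (rule disjoint_letters)
  ultimately show ?thesis
    using arm_leg_count[OF admissible_desc[OF ls], of "int j + 1" m]
    unfolding vec_def hook_coordinates_def by (simp del: atLeastAtMost_iff atLeastLessThan_iff)
qed

lemma vec_outside:
  assumes "a \<notin> alphabet d"
  shows "vec ls a = 0"
proof -
  have "a \<notin> {b..<b + int m}" "a \<notin> {1..int n}" using assms unfolding alphabet_eq by blast+
  then show ?thesis unfolding vec_def hook_coordinates_def by (simp only: if_False)
qed

lemma letter_cases:
  assumes "a \<in> alphabet d"
  obtains i where "i < m" "a = b + int i" | j where "j < n" "a = int j + 1"
proof (cases "a \<in> {b..<b + int m}")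
  case True
  then have range: "b \<le> a" "a < b + int m" unfolding atLeastLessThan_iff by blast+
  have "int (nat (a - b)) = a - b" by (rule nat_0_le) (use range in linarith)
  then have "nat (a - b) < m" "a = b + int (nat (a - b))" using range by linarith+
  then show thesis by (rule that(1))
next
  case False
  then have "a \<in> {1..int n}" using assms unfolding alphabet_eq by blast
  then have range: "1 \<le> a" "a \<le> int n" unfolding atLeastAtMost_iff by blast+
  have "int (nat (a - 1)) = a - 1" by (rule nat_0_le) (use range in linarith)
  then have "nat (a - 1) < n" "a = int (nat (a - 1)) + 1" using range by linarith+
  then show thesis by (rule that(2))
qed

lemma letter_distinct: "i < m \<Longrightarrow> j < n \<Longrightarrow> b + int i \<noteq> int j + 1"
  using gap by auto

lemma decode_vec:
  assumes "admissible ls" "inside ls"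
  shows "decode (vec ls) = part ls"
proof
  fix j
  have "{i. i < m \<and> j < nat (vec ls (b + int i))} = {..<min m (part ls j)}"
    using less_conjugate_iff[OF admissible_desc[OF assms(1)]] by (auto simp: vec_strict)
  then have strict: "card {i. i < m \<and> j < nat (vec ls (b + int i))} = min m (part ls j)" by simp
  show "decode (vec ls) j = part ls j"
  proof (cases "j < n")
    case True
    then show ?thesis unfolding decode_def strict vec_weak[OF assms(1) True] by simp
  next
    case False
    then have "part ls j \<le> m"
      using part_antimono[OF assms(1), of n j] assms(2) by (simp add: inside_def)
    then show ?thesis unfolding decode_def strict using False by simp
  qed
qed

lemma vec_nonneg: "0 \<le> vec ls a"
  by (simp add: vec_def hook_coordinates_def)

lemma decode_step:
  assumes "admissible ls" "inside ls" "a \<in> alphabet d"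
  shows "\<exists>j. decode (vec ls + unit_vector a) = (part ls)(j := Suc (part ls j))"
  using assms(3)
proof (cases rule: letter_cases)
  case (1 r)
  let ?N = "\<lambda>i. nat (vec ls (b + int i))"
  have "decode (vec ls + unit_vector a) j = ((part ls)(?N r := Suc (part ls (?N r)))) j" for j
  proof -
    have "{i. i < m \<and> j < nat ((vec ls + unit_vector a) (b + int i))}
        = {i. i < m \<and> j < ?N i} \<union> (if j = ?N r then {r} else {})"
      using 1 vec_nonneg[of ls "b + int r"] by (auto simp: unit_vector_def nat_add_distrib less_Suc_eq split: if_splits)
    then have "card {i. i < m \<and> j < nat ((vec ls + unit_vector a) (b + int i))}
        = card {i. i < m \<and> j < ?N i} + (if j = ?N r then 1 else 0)" by auto
    moreover have "(vec ls + unit_vector a) (int j + 1) = vec ls (int j + 1)" if "j < n"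
      using letter_distinct[OF 1(1) that] 1 by (simp add: unit_vector_def)
    ultimately have "decode (vec ls + unit_vector a) j = decode (vec ls) j + (if j = ?N r then 1 else 0)"
      by (simp add: decode_def)
    then show ?thesis using fun_cong[OF decode_vec[OF assms(1,2)], of j] by simp
  qed
  then show ?thesis by blast
next
  case (2 k)
  have "decode (vec ls + unit_vector a) j = ((part ls)(k := Suc (part ls k))) j" for j
  proof -
    have "(vec ls + unit_vector a) (b + int i) = vec ls (b + int i)" if "i < m" for i
      using letter_distinct[OF that 2(1)] 2 by (simp add: unit_vector_def)
    then have "{i. i < m \<and> j < nat ((vec ls + unit_vector a) (b + int i))} = {i. i < m \<and> j < nat (vec ls (b + int i))}"
      by auto
    moreover have "nat ((vec ls + unit_vector a) (int j + 1)) = nat (vec ls (int j + 1)) + (if j = k then 1 else 0)"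
      using 2 vec_nonneg[of ls "int j + 1"] by (simp add: unit_vector_def nat_add_distrib)
    ultimately have "decode (vec ls + unit_vector a) j = decode (vec ls) j + (if j = k then 1 else 0)"
      using 2(1) by (simp add: decode_def)
    then show ?thesis using fun_cong[OF decode_vec[OF assms(1,2)], of j] by simp
  qed
  then show ?thesis by blast
qed

lemma vec_grow:
  assumes "admissible ls" "inside ls" "j \<le> length ls" "admissible (grow j ls)" "inside (grow j ls)"
  shows "\<exists>a\<in>alphabet d. vec (grow j ls) = vec ls + unit_vector a"
proof -
  let ?r = "part ls j"
  have strict: "vec (grow j ls) (b + int i) = vec ls (b + int i) + (if i = ?r then 1 else 0)" if "i < m" for i
    by (simp add: vec_strict[OF that] conjugate_grow[OF assms(3)])
  have weak: "vec (grow j ls) (int k + 1) = vec ls (int k + 1) + (if k = j \<and> m \<le> ?r then 1 else 0)" if "k < n" for k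
    by (simp add: vec_weak[OF assms(1) that] vec_weak[OF assms(4) that] part_grow[OF assms(3)])
  have eqI: "vec (grow j ls) = vec ls + unit_vector a"
    if a: "a \<in> alphabet d"
      and "\<And>i. i < m \<Longrightarrow> vec (grow j ls) (b + int i) = vec ls (b + int i) + unit_vector a (b + int i)"
      and "\<And>k. k < n \<Longrightarrow> vec (grow j ls) (int k + 1) = vec ls (int k + 1) + unit_vector a (int k + 1)" for a
  proof
    fix c
    have "vec (grow j ls) c = vec ls c + unit_vector a c"
    proof (cases "c \<in> alphabet d")
      case True
      then show ?thesis by (cases rule: letter_cases) (use that in blast)+
    next
      case False
      then have "c \<noteq> a" using a by blast
      then show ?thesis unfolding vec_outside[OF False] unit_vector_def by simp
    qed
    then show "vec (grow j ls) c = (vec ls + unit_vector a) c" by simp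
  qed
  show ?thesis
  proof (cases "?r < m")
    case True
    have "vec (grow j ls) = vec ls + unit_vector (b + int ?r)"
    proof (rule eqI)
      show "b + int ?r \<in> alphabet d" using True by (simp add: alphabet_eq)
      show "vec (grow j ls) (b + int i) = vec ls (b + int i) + unit_vector (b + int ?r) (b + int i)"
        if "i < m" for i by (simp add: strict[OF that] unit_vector_def)
      show "vec (grow j ls) (int k + 1) = vec ls (int k + 1) + unit_vector (b + int ?r) (int k + 1)"
        if "k < n" for k
        using letter_distinct[OF True that] True weak[OF that] by (simp add: unit_vector_def)
    qed
    moreover have "b + int ?r \<in> alphabet d" using True by (simp add: alphabet_eq)
    ultimately show ?thesis by blast
  next
    case False
    have "j < n"
    proof (rule ccontr)
      assume "\<not> j < n"
      then have "part (grow j ls) j \<le> m"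
        using part_antimono[OF assms(4), of n j] assms(5) by (simp add: inside_def)
      then show False using False by (simp add: part_grow[OF assms(3)])
    qed
    then have a: "int j + 1 \<in> alphabet d" by (simp add: alphabet_eq)
    have "vec (grow j ls) = vec ls + unit_vector (int j + 1)"
    proof (rule eqI[OF a])
      show "vec (grow j ls) (b + int i) = vec ls (b + int i) + unit_vector (int j + 1) (b + int i)"
        if "i < m" for i
        using strict[OF that] False that letter_distinct[OF that \<open>j < n\<close>] by (auto simp: unit_vector_def)
      show "vec (grow j ls) (int k + 1) = vec ls (int k + 1) + unit_vector (int j + 1) (int k + 1)"
        if "k < n" for k
        using weak[OF that] False by (simp add: unit_vector_def)
    qed
    then show ?thesis using a by blast
  qed
qed

lemma states: "partitions_of d = vec ` {ls. admissible ls \<and> inside ls}"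
proof -
  have inside_iff: "inside ls \<longleftrightarrow> (\<forall>i\<ge>m. conjugate ls i \<le> n)" if "admissible ls" for ls
  proof -
    have "conjugate ls i \<le> n \<longleftrightarrow> part ls n \<le> i" for i
      using less_conjugate_iff[OF admissible_desc[OF that], of n i] by linarith
    then show ?thesis by (auto simp: inside_def intro: order_trans)
  qed
  have "hook_partitions m n = conjugate ` {ls. admissible ls \<and> inside ls}"
  proof safe
    fix lam assume "lam \<in> hook_partitions m n"
    then have lam: "antimono lam" "finite {i. lam i \<noteq> 0}" "\<And>i. m \<le> i \<Longrightarrow> lam i \<le> n"
      by (auto simp: hook_partitions_def)
    obtain ls where ls: "0 \<notin> set ls" "successively (\<lambda>a b. b \<le> a) ls" "conjugate ls = lam"
      using ex_conjugate[OF lam(1,2)] by blast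
    then have "admissible ls" by (simp add: admissible_def)
    then show "lam \<in> conjugate ` {ls. admissible ls \<and> inside ls}"
      using inside_iff[of ls] lam(3) ls(3) by blast
  next
    fix ls assume "admissible ls" "inside ls"
    then show "conjugate ls \<in> hook_partitions m n"
      using inside_iff[of ls] conjugate_antimono conjugate_finite by (simp add: hook_partitions_def)
  qed
  then show ?thesis unfolding partitions_eq vec_def by (simp add: image_image)
qed

lemma tab_shape: "shape d T = vec (map length T)"
  unfolding shape_eq vec_def row_lengths_conjugate ..

lemma vec_Nil: "vec [] = 0"
  by (rule ext) (simp add: vec_def hook_coordinates_def conjugate_def)

lemma shrink:
  assumes "admissible ls" "inside ls" "ls \<noteq> []"
  shows "\<exists>ls0 j. admissible ls0 \<and> inside ls0 \<and> j \<le> length ls0 \<and> ls = grow j ls0"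
proof -
  obtain ks c where ks: "ls = ks @ [c]" using assms(3) by (cases ls rule: rev_exhaust) auto
  have c: "0 < c" and adm: "0 \<notin> set ks" "successively (\<lambda>a b. b \<le> a) ks" "ks \<noteq> [] \<Longrightarrow> c \<le> last ks"
    using assms(1) by (auto simp: ks admissible_def successively_append_iff)
  show ?thesis
  proof (cases "c = 1")
    case True
    then have "grow (length ks) ks = ls" by (simp add: grow_def ks)
    moreover have "inside ks" using assms(2) by (auto simp: inside_def part_def ks nth_append split: if_splits)
    ultimately show ?thesis using adm by (intro exI[of _ ks] exI[of _ "length ks"]) (simp add: admissible_def)
  next
    case False
    let ?ks = "ks @ [c - 1]"
    have "grow (length ks) ?ks = ls" using c by (simp add: grow_def ks)
    moreover have "inside ?ks" using assms(2) by (auto simp: inside_def part_def ks nth_append split: if_splits)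
    moreover have "ks \<noteq> [] \<Longrightarrow> c - 1 \<le> last ks" using adm(3) by fastforce
    then have "admissible ?ks" using adm(1,2) c False by (auto simp: admissible_def successively_append_iff)
    ultimately show ?thesis by (intro exI[of _ ?ks] exI[of _ "length ks"]) simp
  qed
qed

text \<open>
  The filling whose content is the vector of the shape: row \<open>i\<close> consists of the \<open>i\<close>-th strict letter, and below row \<open>m\<close> column
  \<open>j\<close> consists of the \<open>j\<close>-th of the other letters.
\<close>

lemma tab_exists:
  assumes "admissible ls" "inside ls"
  shows "\<exists>T. tab T \<and> map length T = ls"
proof -
  define C where "C j = map (\<lambda>i. if i < m then b + int i else int j + 1) [0..<ls ! j]" for j
  let ?T = "map C [0..<length ls]"
  have len: "length (C j) = ls ! j" for j by (simp add: C_def)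
  have pos: "0 < ls ! j" if "j < length ls" for j using assms(1) that by (metis admissible_def gr0I nth_mem)
  have jn: "j < n" if "j < length ls" "m < ls ! j" for j
  proof (rule ccontr)
    assume "\<not> j < n"
    then have "part ls j \<le> m"
      using part_antimono[OF assms(1), of n j] assms(2) by (simp add: inside_def)
    then show False using that by (simp add: part_def)
  qed
  have col: "column (C j)" if j: "j < length ls" for j
  proof (rule columnI)
    show "C j \<noteq> []" using pos[OF j] by (simp add: C_def)
    show "set (C j) \<subseteq> alphabet d" using jn[OF j] by (auto simp: C_def alphabet_eq)
    show "below (C j ! x) (C j ! y)" if "x < y" "y < length (C j)" for x y
      using that gap jn[OF j] by (auto simp: C_def below_def)
  qed
  have "successively column_adj ?T" unfolding successively_conv_nth
  proof (intro allI impI)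
    fix j assume j: "Suc j < length ?T"
    then have le: "ls ! Suc j \<le> ls ! j"
      using assms(1) by (simp add: admissible_def successively_conv_nth)
    have "right_of (C j ! i) (C (Suc j) ! i)" if "i < ls ! Suc j" for i
      using that le gap jn[of "Suc j"] j by (auto simp: C_def below_def)
    then show "column_adj (?T ! j) (?T ! Suc j)" using le j by (simp add: column_adj_def len)
  qed
  then have "tab ?T" using col by (auto simp: tab_def)
  moreover have "map length ?T = ls" by (intro nth_equalityI) (auto simp: len)
  ultimately show ?thesis by blast
qed

end


context hook_columns
begin

definition tableau_row :: "tableau \<Rightarrow> nat \<Rightarrow> int list" where
  "tableau_row T i = map (\<lambda>C. C ! i) (filter (\<lambda>C. i < length C) T)"

definition tableau_tail :: "tableau \<Rightarrow> nat \<Rightarrow> int list" where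
  "tableau_tail T j = (if j < length T then drop m (T ! j) else [])"

text \<open>
  One sorted word for each letter: row \<open>i\<close> for the \<open>i\<close>-th strict letter, and the part of column \<open>j\<close> below row \<open>m\<close> for the \<open>j\<close>-th
  of the other letters.  Its length is the coordinate of the shape at that letter.
\<close>

definition tableau_line :: "tableau \<Rightarrow> int \<Rightarrow> int list" where
  "tableau_line T c = (if c \<in> {b..<b + int m} then tableau_row T (nat (c - b)) else tableau_tail T (nat (c - 1)))"

lemma line_strict: "i < m \<Longrightarrow> tableau_line T (b + int i) = tableau_row T i"
  by (simp add: tableau_line_def)

lemma line_weak:
  assumes "j < n"
  shows "tableau_line T (int j + 1) = tableau_tail T j"
proof -
  have "int j + 1 \<notin> {b..<b + int m}" by (rule disjoint_letters) (use assms in simp)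
  then show ?thesis unfolding tableau_line_def by (simp only: if_False) simp
qed

lemma tableau_row_nth:
  assumes "tab T" "j < length T" "i < length (T ! j)"
  shows "j < length (tableau_row T i) \<and> tableau_row T i ! j = T ! j ! i"
  using assms
proof (induction T arbitrary: j)
  case (Cons C T)
  show ?case
  proof (cases j)
    case (Suc k)
    then have "i < length C" using tab_row(1)[OF Cons.prems(1), of 0 j i] Cons.prems by simp
    moreover have "tab T" using Cons.prems by (simp add: tab_Cons)
    ultimately show ?thesis using Cons.IH[of k] Cons.prems Suc by (simp add: tableau_row_def)
  qed (use Cons.prems in \<open>simp add: tableau_row_def\<close>)
qed simp

lemma tableau_row_sorted:
  assumes "tab T"
  shows "sorted_wrt right_of (tableau_row T i)"
proof -
  have "sorted_wrt column_adj (filter (\<lambda>C. i < length C) T)"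
    using tab_sorted[OF assms] by (rule sorted_wrt_filter)
  then have "sorted_wrt (\<lambda>C D. right_of (C ! i) (D ! i)) (filter (\<lambda>C. i < length C) T)"
    by (rule sorted_wrt_mono_rel[rotated]) (auto simp: column_adj_def)
  then show ?thesis by (simp add: tableau_row_def sorted_wrt_map)
qed

lemma right_of_sorted: "sorted_wrt right_of w \<Longrightarrow> sorted w"
  by (erule sorted_wrt_mono_rel[rotated]) (auto simp: below_def)

lemma right_of_count: "sorted_wrt right_of w \<Longrightarrow> b + int m \<le> a \<Longrightarrow> count (mset w) a \<le> 1"
proof (induction w)
  case (Cons x w)
  show ?case
  proof (cases "x = a")
    case True
    then have "a \<notin> set w" using Cons.prems by (auto simp: below_def)
    then have "count (mset w) a = 0" by (metis count_eq_zero_iff set_mset_mset)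
    then show ?thesis using True by simp
  qed (use Cons in simp)
qed simp

lemma tab_columnD: "tab T \<Longrightarrow> C \<in> set T \<Longrightarrow> column C"
  by (simp add: tab_def)

lemma tableau_row_entry:
  assumes "tab T" "a \<in> set (tableau_row T i)" "i < m"
  shows "a \<in> alphabet d" "b + int i \<le> a"
proof -
  obtain C where C: "C \<in> set T" "i < length C" "a = C ! i"
    using assms(2) by (auto simp: tableau_row_def)
  have col: "column C" by (rule tab_columnD[OF assms(1) C(1)])
  show "b + int i \<le> a" using column_entry_ge[OF col C(2)] assms(3) C(3) by simp
  show "a \<in> alphabet d" using col C(2,3) nth_mem by (auto simp: column_def)
qed

lemma tableau_tail_entry:
  assumes "tab T" "a \<in> set (tableau_tail T j)"
  shows "int j + 1 \<le> a" "a \<in> {1..int n}"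
proof -
  have j: "j < length T" using assms(2) by (auto simp: tableau_tail_def split: if_splits)
  then obtain i where i: "i < length (drop m (T ! j))" "a = drop m (T ! j) ! i"
    using assms(2) by (auto simp: tableau_tail_def in_set_conv_nth)
  then have a: "m + i < length (T ! j)" "a = T ! j ! (m + i)" by auto
  show "int j + 1 \<le> a" using tail_entry_ge[OF assms(1) j _ a(1)] a(2) by simp
  show "a \<in> {1..int n}" unfolding a(2)
    by (rule column_tail[OF tab_columnD[OF assms(1)] _ a(1)]) (use j in auto)
qed

lemma line_length:
  assumes T: "tab T" and c: "c \<in> alphabet d"
  shows "length (tableau_line T c) = nat (vec (map length T) c)"
  using c
proof (cases rule: letter_cases)
  case (1 i)
  have "length (tableau_row T i) = conjugate (map length T) i"
    by (simp add: tableau_row_def conjugate_def filter_map o_def)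
  then show ?thesis unfolding 1(2) line_strict[OF 1(1)] vec_strict[OF 1(1)] by simp
next
  case (2 j)
  show ?thesis
    unfolding 2(2) line_weak[OF 2(1)] vec_weak[OF tab_admissible[OF T] 2(1)]
    by (simp add: tableau_tail_def part_def)
qed

lemma line_sorted:
  assumes T: "tab T" and c: "c \<in> alphabet d"
  shows "sorted (tableau_line T c)"
  using c
proof (cases rule: letter_cases)
  case (1 i)
  show ?thesis unfolding 1(2) line_strict[OF 1(1)] by (rule right_of_sorted[OF tableau_row_sorted[OF T]])
next
  case (2 j)
  have "sorted (T ! j)" if "j < length T"
  proof (rule sorted_wrt_mono_rel[of _ below])
    show "sorted_wrt below (T ! j)" using T that by (auto simp: tab_def column_def)
  qed (auto simp: below_def)
  then show ?thesis unfolding 2(2) line_weak[OF 2(1)] by (simp add: tableau_tail_def sorted_wrt_drop)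
qed

text \<open>
  A row starts with letters not smaller than its own, which have at most its weight because the weights decrease; a letter
  of the second kind occurs in a row at most once.
\<close>

lemma line_letters:
  assumes T: "tab T" and c: "c \<in> alphabet d" and a: "a \<in> set (tableau_line T c)"
  shows "a \<in> alphabet d" "a = c \<or> p a < p c \<or> count (mset (tableau_line T c)) a \<le> 1"
proof -
  have "a \<in> alphabet d \<and> (a = c \<or> p a < p c \<or> count (mset (tableau_line T c)) a \<le> 1)"
    using c
  proof (cases rule: letter_cases)
    case (1 i)
    have a': "a \<in> set (tableau_row T i)" using a unfolding 1(2) line_strict[OF 1(1)] .
    note e = tableau_row_entry[OF T a' 1(1)]
    show ?thesis
    proof (cases "b + int m \<le> a")
      case True
      then show ?thesis using e(1) right_of_count[OF tableau_row_sorted[OF T]]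
        unfolding 1(2) line_strict[OF 1(1)] by blast
    next
      case False
      have "p a < p c" if "a \<noteq> c"
        by (rule monotone_onD[OF anti_strict]) (use that False e(2) 1 in auto)
      then show ?thesis using e(1) by blast
    qed
  next
    case (2 j)
    have a': "a \<in> set (tableau_tail T j)" using a unfolding 2(2) line_weak[OF 2(1)] .
    note e = tableau_tail_entry[OF T a']
    have "p a < p c" if "a \<noteq> c"
      by (rule monotone_onD[OF anti_weak]) (use that e 2 in auto)
    then show ?thesis using e(2) unfolding alphabet_eq by blast
  qed
  then show "a \<in> alphabet d" "a = c \<or> p a < p c \<or> count (mset (tableau_line T c)) a \<le> 1" by auto
qed

lemma lines_inj:
  assumes T: "tab T" "tab T'" and len: "map length T = map length T'"
    and eq: "\<And>c. c \<in> alphabet d \<Longrightarrow> tableau_line T c = tableau_line T' c"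
  shows "T = T'"
proof (rule nth_equalityI)
  show l: "length T = length T'" using len by (metis length_map)
  fix j assume j: "j < length T"
  have lj: "length (T ! j) = length (T' ! j)" using len j l by (metis nth_map)
  show "T ! j = T' ! j"
  proof (rule nth_equalityI[OF lj])
    fix i assume i: "i < length (T ! j)"
    show "T ! j ! i = T' ! j ! i"
    proof (cases "i < m")
      case True
      then have "b + int i \<in> alphabet d" by (simp add: alphabet_eq)
      from eq[OF this] have "tableau_row T i = tableau_row T' i" unfolding line_strict[OF True] .
      then show ?thesis
        using tableau_row_nth[OF T(1) j i] tableau_row_nth[OF T(2), of j i] j l i lj by simp
    next
      case False
      then have "T ! j ! m \<in> {1..int n}" "int j + 1 \<le> T ! j ! m"
        using column_tail[of "T ! j" m] tail_entry_ge[OF T(1) j, of m] i tab_columnD[OF T(1)] j by auto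
      then have jn: "j < n" by simp
      then have "int j + 1 \<in> alphabet d" by (simp add: alphabet_eq)
      from eq[OF this] have "drop m (T ! j) = drop m (T' ! j)"
        unfolding line_weak[OF jn] using j l by (simp add: tableau_tail_def)
      then have "drop m (T ! j) ! (i - m) = drop m (T' ! j) ! (i - m)" by simp
      then show ?thesis using False i lj by simp
    qed
  qed
qed

lemma weight_take: "weight (take k C) = (\<Prod>i<k. if i < length C then p (C ! i) else 1)"
proof (induction k)
  case (Suc k)
  then show ?case by (cases "k < length C") (simp_all add: take_Suc_conv_app_nth)
qed simp

lemma weight_tableau_row: "weight (tableau_row T i) = prod_list (map (\<lambda>C. if i < length C then p (C ! i) else 1) T)"
  by (induction T) (simp_all add: tableau_row_def)

lemma weight_lines:
  assumes T: "tab T"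
  shows "weight (concat T) = (\<Prod>c\<in>alphabet d. weight (tableau_line T c))"
proof -
  have rows: "prod_list (map (\<lambda>C. weight (take k C)) T) = (\<Prod>i<k. weight (tableau_row T i))" for k
    unfolding weight_take weight_tableau_row by (induction T) (simp_all add: prod.distrib)
  have "weight (concat T) = prod_list (map (\<lambda>C. weight (take m C) * weight (drop m C)) T)"
  proof (induction T)
    case (Cons C T)
    have "weight C = weight (take m C) * weight (drop m C)"
      using weight_simps(3)[of "take m C" "drop m C"] by simp
    then show ?case using Cons by simp
  qed simp
  also have "\<dots> = prod_list (map (\<lambda>C. weight (take m C)) T) * prod_list (map (\<lambda>C. weight (drop m C)) T)"
    by (induction T) simp_all
  also have "prod_list (map (\<lambda>C. weight (drop m C)) T) = (\<Prod>j<length T. weight (tableau_tail T j))"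
    by (simp add: prod.list_conv_set_nth tableau_tail_def atLeast0LessThan)
  also have "\<dots> = (\<Prod>j<n. weight (tableau_tail T j))"
  proof -
    have z: "tableau_tail T j = []" if "n \<le> j" for j
    proof (rule ccontr)
      assume "tableau_tail T j \<noteq> []"
      then obtain a where "a \<in> set (tableau_tail T j)" by (cases "tableau_tail T j") auto
      from tableau_tail_entry[OF T this] that show False by simp
    qed
    have "(\<Prod>j<length T. weight (tableau_tail T j)) = (\<Prod>j<max n (length T). weight (tableau_tail T j))"
      by (rule prod.mono_neutral_left) (auto simp: tableau_tail_def)
    also have "\<dots> = (\<Prod>j<n. weight (tableau_tail T j))"
      by (rule prod.mono_neutral_right) (auto simp: z)
    finally show ?thesis .
  qed
  also have "prod_list (map (\<lambda>C. weight (take m C)) T) = (\<Prod>c\<in>{b..<b + int m}. weight (tableau_line T c))"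
    unfolding rows
    by (rule prod.reindex_bij_witness[of _ "\<lambda>c. nat (c - b)" "\<lambda>i. b + int i"]) (auto simp: line_strict)
  also have "(\<Prod>j<n. weight (tableau_tail T j)) = (\<Prod>c\<in>{1..int n}. weight (tableau_line T c))"
    by (rule prod.reindex_bij_witness[of _ "\<lambda>c. nat (c - 1)" "\<lambda>j. int j + 1"]) (auto simp: line_weak)
  also have "(\<Prod>c\<in>{b..<b + int m}. weight (tableau_line T c)) * (\<Prod>c\<in>{1..int n}. weight (tableau_line T c))
      = (\<Prod>c\<in>alphabet d. weight (tableau_line T c))"
    unfolding alphabet_eq by (rule prod.union_disjoint[symmetric]) (use disjoint_letters in auto)
  finally show ?thesis .
qed

lemma column_weight_le:
  "\<exists>K. \<forall>ls. admissible ls \<and> inside ls \<longrightarrow>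
      (\<Sum>T | tab T \<and> map length T = ls. weight (concat T)) \<le> K * (\<Prod>a\<in>alphabet d. p a ^ nat (vec ls a))"
proof -
  obtain K where K: "\<And>(X :: tableau set) line N. finite X \<Longrightarrow>
     (\<forall>T\<in>X. \<forall>T'\<in>X. (\<forall>c\<in>alphabet d. line T c = line T' c) \<longrightarrow> T = T') \<Longrightarrow>
     (\<forall>T\<in>X. weight (concat T) = (\<Prod>c\<in>alphabet d. weight (line T c))) \<Longrightarrow>
     (\<forall>T\<in>X. \<forall>c\<in>alphabet d. length (line T c) = N c \<and> sorted (line T c) \<and> set (line T c) \<subseteq> alphabet d \<and>
        (\<forall>a\<in>set (line T c). a = c \<or> p a < p c \<or> count (mset (line T c)) a \<le> 1)) \<Longrightarrow>
     (\<Sum>T\<in>X. weight (concat T)) \<le> K * (\<Prod>c\<in>alphabet d. p c ^ N c)"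
    using sum_weight_lines_le by blast
  have "(\<Sum>T | tab T \<and> map length T = ls. weight (concat T)) \<le> K * (\<Prod>a\<in>alphabet d. p a ^ nat (vec ls a))" for ls
  proof (rule K[of _ tableau_line])
    show "finite {T. tab T \<and> map length T = ls}" by (rule finite_tabs[OF finite_A])
    show "\<forall>T\<in>{T. tab T \<and> map length T = ls}. \<forall>T'\<in>{T. tab T \<and> map length T = ls}.
        (\<forall>c\<in>alphabet d. tableau_line T c = tableau_line T' c) \<longrightarrow> T = T'"
      using lines_inj by blast
    show "\<forall>T\<in>{T. tab T \<and> map length T = ls}. weight (concat T) = (\<Prod>c\<in>alphabet d. weight (tableau_line T c))"
      using weight_lines by blast
    show "\<forall>T\<in>{T. tab T \<and> map length T = ls}. \<forall>c\<in>alphabet d.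
        length (tableau_line T c) = nat (vec ls c) \<and> sorted (tableau_line T c) \<and>
        set (tableau_line T c) \<subseteq> alphabet d \<and>
        (\<forall>a\<in>set (tableau_line T c). a = c \<or> p a < p c \<or> count (mset (tableau_line T c)) a \<le> 1)"
      using line_length line_sorted line_letters by blast
  qed
  then show ?thesis by blast
qed

sublocale shaped_insertion d p column "\<lambda>a b. b \<le> a" column_adj column_stops column_bump inside vec decode
proof (unfold_locales, goal_cases)
  case 1 show ?case by (rule states)
next
  case (2 T) then show ?case by (rule tab_inside)
next
  case (3 T) show ?case by (rule tab_shape)
next
  case (4 ls) then show ?case by (rule tab_exists)
next
  case (5 ls j) then show ?case by (intro vec_grow)
next
  case (6 ls) then show ?case by (rule decode_vec)
next
  case (7 ls a) then show ?case by (rule decode_step)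
next
  case (8 ls a) show ?case by (rule vec_nonneg)
next
  case 9 show ?case by (rule vec_Nil)
next
  case (10 ls) then show ?case by (rule shrink)
next
  case 11 show ?case by (rule column_weight_le)
qed

end


section \<open>Insertion into hook words\<close>

text \<open>
  Rows are treated as functions on indices that start from \<open>0\<close>, so that statements about them are first-order
  statements of integer arithmetic with uninterpreted functions.  Here \<open>u\<close> has length \<open>n\<close> and its decreasing part has
  length \<open>k\<close>.
\<close>

definition hook_fun :: "(int \<Rightarrow> int) \<Rightarrow> int \<Rightarrow> int \<Rightarrow> bool" where
  "hook_fun u n k \<longleftrightarrow> 1 \<le> k \<and> k \<le> n \<and> (\<forall>i j. 0 \<le> i \<and> i < j \<and> j < k \<longrightarrow> u j \<le> u i)
     \<and> (\<forall>i j. k - 1 \<le> i \<and> i < j \<and> j < n \<longrightarrow> u i < u j)"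

text \<open>
  The letter \<open>x\<close> replaces the entry at \<open>r\<close> in the increasing part, and that entry replaces the one at \<open>q\<close> in the decreasing
  part, which is ejected.
\<close>

definition bump_fun :: "(int \<Rightarrow> int) \<Rightarrow> int \<Rightarrow> int \<Rightarrow> int \<Rightarrow> int \<Rightarrow> int \<Rightarrow> bool" where
  "bump_fun u n k x q r \<longleftrightarrow> k \<le> r \<and> r < n \<and> x \<le> u r \<and> (\<forall>i. k \<le> i \<and> i < r \<longrightarrow> u i < x)
    \<and> 0 \<le> q \<and> q < k \<and> u q < u r \<and> (\<forall>i. 0 \<le> i \<and> i < q \<longrightarrow> u r \<le> u i)"

text \<open>
  The local description of semistandard decomposition tableaux: \<open>v\<close>, of length \<open>s\<close>, may be the row below \<open>u\<close>.  Each
  excluded pattern would yield a hook subword of the word \<open>v u\<close> that is longer than \<open>u\<close>: in the first case \<open>v k\<close> followed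
  by \<open>u\<close>; in the second case the first \<open>j + 1\<close> letters of \<open>v\<close>, then \<open>v k\<close>, then \<open>u\<close> from \<open>j + 1\<close> on; in the third case the
  first \<open>k + 1\<close> letters of \<open>v\<close>, then \<open>u j\<close>, then \<open>u\<close> from \<open>k + 1\<close> on.
\<close>

definition adj_fun :: "(int \<Rightarrow> int) \<Rightarrow> (int \<Rightarrow> int) \<Rightarrow> int \<Rightarrow> bool" where
  "adj_fun u v s \<longleftrightarrow> (\<forall>k. 0 \<le> k \<and> k < s \<longrightarrow> v k < u 0)
    \<and> (\<forall>j k. 0 \<le> j \<and> j < k \<and> k < s \<and> v k \<le> v j \<longrightarrow> v k < u (j + 1))
    \<and> (\<forall>j k. 0 \<le> j \<and> j \<le> k \<and> k < s \<longrightarrow> \<not> (v k < u j \<and> u j < u (k + 1)))"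

definition bumped :: "(int \<Rightarrow> int) \<Rightarrow> int \<Rightarrow> int \<Rightarrow> int \<Rightarrow> int \<Rightarrow> int" where
  "bumped u x q r i = (if i = r then x else if i = q then u r else u i)"

text \<open>
  The decreasing part grows by one in two situations: \<open>x\<close> lands directly behind it without ascent, or its last entry
  becomes so large that the next entry no longer ascends.
\<close>

lemma hook_fun_bumped:
  assumes "hook_fun u n k" "bump_fun u n k x q r"
  shows "\<exists>k'. hook_fun (bumped u x q r) n k'"
proof (cases "r = k \<and> x \<le> bumped u x q r (k - 1)")
  case True
  have "hook_fun (bumped u x q r) n (k + 1)"
    using assms True unfolding hook_fun_def bump_fun_def bumped_def by (smt (z3))
  then show ?thesis ..
next
  case False
  show ?thesis
  proof (cases "q = k - 1 \<and> k < r")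
    case True
    have "hook_fun (bumped u x q r) n (k + 1)"
      using assms True unfolding hook_fun_def bump_fun_def bumped_def by (smt (z3))
    then show ?thesis ..
  next
    case False
    have "hook_fun (bumped u x q r) n k"
      using assms False \<open>\<not> (r = k \<and> x \<le> bumped u x q r (k - 1))\<close>
      unfolding hook_fun_def bump_fun_def bumped_def by (smt (z3))
    then show ?thesis ..
  qed
qed

text \<open>
  The heart of the matter for \<open>Queer\<close>: inserting \<open>x\<close> into \<open>u\<close> and the ejected letter into \<open>v\<close> turns admissible pairs of rows
  into admissible pairs, and no others.  A pattern that is excluded involves at most three entries, and insertion
  changes two entries of each row, so each direction reduces to instances of the hypotheses at the few indices
  that occur.
\<close>

lemma adj_fun_bump_bump:
  assumes "hook_fun u n k" "bump_fun u n k x q r" "hook_fun v s m" "bump_fun v s m (u q) q' r'" "s < n"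
  shows "adj_fun (bumped u x q r) (bumped v (u q) q' r') s \<longleftrightarrow> adj_fun u v s"
proof
  note A = assms[unfolded hook_fun_def bump_fun_def]
  show "adj_fun (bumped u x q r) (bumped v (u q) q' r') s" if "adj_fun u v s"
    unfolding adj_fun_def bumped_def
    by (intro conjI allI; use A that[unfolded adj_fun_def bumped_def] in \<open>smt (z3)\<close>)
  show "adj_fun u v s" if "adj_fun (bumped u x q r) (bumped v (u q) q' r') s"
    unfolding adj_fun_def bumped_def
    by (intro conjI allI; use A that[unfolded adj_fun_def bumped_def] in \<open>smt (z3)\<close>)
qed

text \<open>
  The same when the lower row accepts the letter.  An empty lower row (\<open>s = 0\<close>) stands for a new row, and
  \<open>s + 1 < n\<close> says that the shape remains strict.
\<close>

lemma adj_fun_bump_stops: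
  assumes "hook_fun u n k" "bump_fun u n k x q r" "0 \<le> s" "s < n"
    and v: "s = 0 \<or> hook_fun v s m \<and> (m = s \<or> v (s - 1) < u q)"
  shows "s + 1 < n \<and> adj_fun (bumped u x q r) (v(s := u q)) (s + 1) \<longleftrightarrow> (s = 0 \<or> adj_fun u v s)"
proof
  define va where "va = v(s := u q)"
  have va: "va i = (if i = s then u q else v i)" for i by (simp add: va_def)
  note A = assms[unfolded hook_fun_def bump_fun_def] va
  show "s + 1 < n \<and> adj_fun (bumped u x q r) (v(s := u q)) (s + 1)" if "s = 0 \<or> adj_fun u v s"
    unfolding adj_fun_def bumped_def va_def[symmetric]
    by (intro conjI allI; use A that[unfolded adj_fun_def bumped_def] in \<open>smt (z3)\<close>)
  show "s = 0 \<or> adj_fun u v s" if h: "s + 1 < n \<and> adj_fun (bumped u x q r) (v(s := u q)) (s + 1)"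
  proof (cases "s = 0")
    case False
    show ?thesis
      unfolding adj_fun_def
      by (intro disjI2 conjI allI; use A False h[unfolded adj_fun_def bumped_def va_def[symmetric]] in \<open>smt (z3)\<close>)
  qed simp
qed

lemma bump_fun_inj:
  assumes "hook_fun u n k" "bump_fun u n k x q r" "hook_fun v n l" "bump_fun v n l y q' r'"
    and "\<And>i. 0 \<le> i \<Longrightarrow> i < n \<Longrightarrow> bumped u x q r i = bumped v y q' r' i" and "u q = v q'"
  shows "q = q' \<and> r = r'"
  using assms unfolding hook_fun_def bump_fun_def bumped_def by (smt (z3))

text \<open>
  Where the exchange took place can be read off from the result \<open>w\<close> and the ejected letter \<open>z\<close>.  Entry \<open>q\<close> is the last
  entry of the decreasing part that exceeds \<open>z\<close>, unless the whole decreasing part does; then its last entry was in the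
  increasing part before, and \<open>q\<close> is the entry before it.  The letter \<open>x = w r\<close> is the largest one from the valley on
  that does not exceed \<open>w q\<close>.
\<close>

lemma unbump_fun:
  assumes w: "hook_fun w n k" and z: "z < w 0" "2 \<le> n" "w 1 \<le> w 0"
    and q: "0 \<le> q" "q + 1 < k" "z < w q" "w (k - 1) \<le> z \<Longrightarrow> w (q + 1) \<le> z" "z < w (k - 1) \<Longrightarrow> q = k - 2"
    and r: "k - 1 \<le> r" "r < n" "w r \<le> w q" "r + 1 < n \<Longrightarrow> w q < w (r + 1)"
    and l: "l = (if z < w (k - 1) \<or> r = k - 1 then k - 1 else k)"
    and u: "u = w(q := z, r := w q)"
  shows "hook_fun u n l \<and> bump_fun u n l (w r) q r"
proof -
  have u': "u i = (if i = r then w q else if i = q then z else w i)" for i by (simp add: u)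
  note A = w[unfolded hook_fun_def] z q r l u'
  show ?thesis unfolding hook_fun_def bump_fun_def
    by (intro conjI allI; use A in \<open>smt (z3)\<close>)
qed


abbreviation entry :: "int list \<Rightarrow> int \<Rightarrow> int" where
  "entry L i \<equiv> L ! nat i"

lemma hook_at_fun: "hook_at L k \<longleftrightarrow> hook_fun (entry L) (int (length L)) (int k)"
proof
  assume h: "hook_at L k"
  have "entry L j \<le> entry L i" if "0 \<le> i" "i < j" "j < int k" for i j
  proof -
    have "nat i < nat j" "nat j < k" using that by auto
    then show ?thesis using h by (auto simp: hook_at_def sorted_wrt_iff_nth_less)
  qed
  moreover have "entry L i < entry L j" if "int k - 1 \<le> i" "i < j" "j < int (length L)" for i j
  proof -
    have "drop (k - 1) L ! (nat i - (k - 1)) < drop (k - 1) L ! (nat j - (k - 1))"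
    proof (rule sorted_wrt_nth_less)
      show "sorted_wrt (<) (drop (k - 1) L)" using h by (simp add: hook_at_def)
    qed (use h that in \<open>auto simp: hook_at_def\<close>)
    moreover have "k - 1 \<le> length L" "k - 1 + (nat i - (k - 1)) = nat i" "k - 1 + (nat j - (k - 1)) = nat j"
      using h that by (auto simp: hook_at_def)
    ultimately show ?thesis by (simp only: nth_drop)
  qed
  ultimately show "hook_fun (entry L) (int (length L)) (int k)"
    using h by (auto simp: hook_fun_def hook_at_def)
next
  assume h: "hook_fun (entry L) (int (length L)) (int k)"
  have "L ! i \<ge> L ! j" if "i < j" "j < k" for i j
    using h that unfolding hook_fun_def by (metis nat_int of_nat_0_le_iff of_nat_less_iff)
  moreover have "L ! i < L ! j" if "k - 1 \<le> i" "i < j" "j < length L" for i j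
  proof -
    have "int k - 1 \<le> int i" using that by simp
    then show ?thesis using h that unfolding hook_fun_def by (metis nat_int of_nat_less_iff)
  qed
  ultimately show "hook_at L k"
    using h by (auto simp: hook_at_def hook_fun_def sorted_wrt_iff_nth_less)
qed

lemma hook_at_unique: "hook_at L k \<Longrightarrow> hook_at L l \<Longrightarrow> k = l"
proof (induction k l rule: linorder_wlog)
  case (le k l)
  show ?case
  proof (rule ccontr)
    assume "k \<noteq> l"
    then have "L ! (k - 1) < L ! k" "L ! k \<le> L ! (k - 1)"
      using le unfolding hook_at_fun hook_fun_def
      by (smt (verit) nat_int int_ops(6) nat_minus_as_int of_nat_less_iff of_nat_le_iff of_nat_1)+
    then show False by simp
  qed
qed (simp add: eq_commute)

lemma hook_parts:
  assumes "hook_at L k"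
  shows "decreasing_part L = take k L" "increasing_part L = drop k L"
proof -
  have "(THE k. hook_at L k) = k" using assms hook_at_unique by blast
  then show "decreasing_part L = take k L" "increasing_part L = drop k L"
    by (simp_all add: decreasing_part_def increasing_part_def)
qed

lemma hook_word_snoc:
  assumes "hook_at L k"
  shows "hook_word (L @ [x]) \<longleftrightarrow> k = length L \<or> last L < x"
proof -
  have L: "L \<noteq> []" "1 \<le> k" "k \<le> length L" using assms by (auto simp: hook_at_def)
  show ?thesis
  proof
    assume "hook_word (L @ [x])"
    then obtain k' where k': "hook_at (L @ [x]) k'" by (auto simp: hook_word_def)
    show "k = length L \<or> last L < x"
    proof (cases "k' \<le> length L")
      case True
      then have "sorted_wrt (<) (drop (k' - 1) L @ [x])" "drop (k' - 1) L \<noteq> []"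
        using k' L by (auto simp: hook_at_def)
      then have "last (drop (k' - 1) L) < x" using last_in_set by (auto simp only: sorted_wrt_append set_simps)
      then show ?thesis using \<open>drop (k' - 1) L \<noteq> []\<close> by simp
    next
      case False
      then have "hook_at L (length L)"
        using k' L by (cases L rule: rev_exhaust) (auto simp: hook_at_def sorted_wrt_append)
      then show ?thesis using hook_at_unique[OF assms] by simp
    qed
  next
    assume h: "k = length L \<or> last L < x"
    show "hook_word (L @ [x])"
    proof (cases "last L < x")
      case True
      have "\<forall>t\<in>set (drop (k - 1) L). t < x"
      proof
        fix t assume "t \<in> set (drop (k - 1) L)"
        moreover have "sorted (drop (k - 1) L)"
          using assms strict_sorted_imp_sorted by (auto simp: hook_at_def)
        ultimately have "t \<le> last (drop (k - 1) L)"
          by (cases "drop (k - 1) L" rule: rev_exhaust) (auto simp: sorted_append)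
        then show "t < x" using True L by simp
      qed
      then have "hook_at (L @ [x]) k"
        using assms by (auto simp: hook_at_def sorted_wrt_append)
      then show ?thesis by (auto simp: hook_word_def)
    next
      case False
      then have k: "k = length L" using h by simp
      obtain K t where Kt: "L = K @ [t]" using L(1) by (cases L rule: rev_exhaust) auto
      have "hook_at (L @ [x]) (Suc k)"
        using assms k False Kt by (auto simp: hook_at_def sorted_wrt_append; fastforce)
      then show ?thesis by (auto simp: hook_word_def)
    qed
  qed
qed

locale row_letters =
  fixes A :: "int set"
begin

definition row :: "int list \<Rightarrow> bool" where
  "row L \<longleftrightarrow> set L \<subseteq> A \<and> hook_word L"

definition row_adj :: "int list \<Rightarrow> int list \<Rightarrow> bool" where
  "row_adj U V \<longleftrightarrow> length V < length U \<and> adj_fun (entry U) (entry V) (int (length V))"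

definition row_stops :: "int \<Rightarrow> int list \<Rightarrow> bool" where
  "row_stops x L \<longleftrightarrow> hook_word (L @ [x])"

definition row_bump :: "int \<Rightarrow> int list \<Rightarrow> int list \<times> int" where
  "row_bump x L =
     (let y = Min {t \<in> set (increasing_part L). t \<ge> x};
          z = Max {t \<in> set (decreasing_part L). t < y}
      in (replace_first z y (decreasing_part L) @ replace_first y x (increasing_part L), z))"

lemma row_bump_at:
  assumes h: "hook_at L k" and b: "bump_fun (entry L) (int (length L)) (int k) x (int q) (int r)"
  shows "\<not> row_stops x L" "row_bump x L = (L[q := L ! r, r := x], L ! q)"
proof -
  have kr: "k \<le> r" "r < length L" "x \<le> L ! r" "q < k" "L ! q < L ! r"
    using b by (auto simp: bump_fun_def)
  have below_r: "L ! i < x" if "k \<le> i" "i < r" for i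
    using b that unfolding bump_fun_def by (metis nat_int of_nat_le_iff of_nat_less_iff)
  have before_q: "L ! r \<le> L ! i" if "i < q" for i
    using b that unfolding bump_fun_def by (metis nat_int of_nat_0_le_iff of_nat_less_iff)
  have dec: "L ! j \<le> L ! i" if "i < j" "j < k" for i j
    using h that by (auto simp: hook_at_def sorted_wrt_iff_nth_less)
  have inc: "L ! i < L ! j" if "k - 1 \<le> i" "i < j" "j < length L" for i j
    using h that unfolding hook_at_fun hook_fun_def
    by (smt (verit) nat_int int_ops(6) of_nat_less_iff of_nat_le_iff of_nat_1)
  have "L ! r \<le> last L"
    using inc[of r "length L - 1"] kr last_conv_nth[of L] by (cases "r = length L - 1") force+
  then show "\<not> row_stops x L"
    unfolding row_stops_def hook_word_snoc[OF h] using kr by auto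
  have ymin: "Min {t \<in> set (drop k L). t \<ge> x} = L ! r"
  proof (rule Min_eqI)
    fix t assume "t \<in> {t \<in> set (drop k L). t \<ge> x}"
    then obtain i where i: "k \<le> i" "i < length L" "t = L ! i" "x \<le> t"
      by (auto simp: in_set_conv_nth) (metis le_add1 less_diff_conv add.commute)
    then have "r \<le> i" using below_r[of i] by force
    then show "L ! r \<le> t" using inc[of r i] i kr by (cases "r = i") force+
  qed (use kr in \<open>auto simp: in_set_conv_nth intro!: exI[of _ "r - k"]\<close>)
  have zmax: "Max {t \<in> set (take k L). t < L ! r} = L ! q"
  proof (rule Max_eqI)
    fix t assume "t \<in> {t \<in> set (take k L). t < L ! r}"
    then obtain i where i: "i < k" "t = L ! i" "t < L ! r"
      by (auto simp: in_set_conv_nth)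
    then have "q \<le> i" using before_q[of i] by force
    then show "t \<le> L ! q" using dec[of q i] i by (cases "q = i") auto
  qed (use kr in \<open>auto simp: in_set_conv_nth intro!: exI[of _ q]\<close>)
  have "replace_first (take k L ! q) (L ! r) (take k L) = (take k L)[q := L ! r]"
    by (rule replace_first_nth) (use kr before_q in force)+
  moreover have "replace_first (drop k L ! (r - k)) x (drop k L) = (drop k L)[r - k := x]"
  proof (rule replace_first_nth)
    show "drop k L ! i \<noteq> drop k L ! (r - k)" if "i < r - k" for i
    proof -
      have "k + i < r" using that by simp
      then have "L ! (k + i) < x" by (intro below_r) auto
      then show ?thesis using kr by auto
    qed
  qed (use kr in simp)
  moreover have "(take k L)[q := L ! r] @ (drop k L)[r - k := x] = L[q := L ! r, r := x]"
  proof -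
    have "(P @ Q)[q := L ! r, r := x] = P[q := L ! r] @ Q[r - k := x]" if "length P = k" for P Q
      using kr that by (simp add: list_update_append)
    from this[of "take k L" "drop k L"] show ?thesis using kr by simp
  qed
  ultimately show "row_bump x L = (L[q := L ! r, r := x], L ! q)"
    unfolding row_bump_def hook_parts[OF h] using ymin zmax kr by simp
qed

lemma row_bumpE:
  assumes h: "hook_at L k" and st: "\<not> row_stops x L"
  obtains q r where "bump_fun (entry L) (int (length L)) (int k) x (int q) (int r)"
    "row_bump x L = (L[q := L ! r, r := x], L ! q)"
proof -
  have k: "1 \<le> k" "k < length L" "x \<le> last L" "L \<noteq> []"
    using h st hook_word_snoc[OF h, of x] by (auto simp: row_stops_def hook_at_def)
  have inc: "L ! i < L ! j" if "k - 1 \<le> i" "i < j" "j < length L" for i j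
    using h that unfolding hook_at_fun hook_fun_def
    by (smt (verit) nat_int int_ops(6) of_nat_less_iff of_nat_le_iff of_nat_1)
  have ex: "k \<le> length L - 1 \<and> length L - 1 < length L \<and> x \<le> L ! (length L - 1)"
    using k by (auto simp: last_conv_nth)
  define r where "r = (LEAST r. k \<le> r \<and> r < length L \<and> x \<le> L ! r)"
  have r: "k \<le> r" "r < length L" "x \<le> L ! r" using LeastI[of "\<lambda>r. k \<le> r \<and> r < length L \<and> x \<le> L ! r", OF ex] by (auto simp: r_def)
  have r': "L ! i < x" if "k \<le> i" "i < r" for i
    using not_less_Least[of i "\<lambda>r. k \<le> r \<and> r < length L \<and> x \<le> L ! r"] that r by (force simp: r_def)
  have exq: "L ! (k - 1) < L ! r" using inc[of "k - 1" r] r k by simp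
  define q where "q = (LEAST q. L ! q < L ! r)"
  have q: "L ! q < L ! r" "q \<le> k - 1" unfolding q_def
    by (rule LeastI[of "\<lambda>q. L ! q < L ! r", OF exq], rule Least_le[of "\<lambda>q. L ! q < L ! r", OF exq])
  have q': "L ! r \<le> L ! i" if "i < q" for i
    using not_less_Least[of i "\<lambda>q. L ! q < L ! r"] that by (force simp: q_def)
  have "bump_fun (entry L) (int (length L)) (int k) x (int q) (int r)"
    unfolding bump_fun_def
  proof (intro conjI allI impI)
    show "entry L i < x" if "int k \<le> i \<and> i < int r" for i
      by (rule r') (use that in auto)
    show "entry L (int r) \<le> entry L i" if "0 \<le> i \<and> i < int q" for i
      using q'[of "nat i"] that by auto
  qed (use k r q in auto)
  then show thesis using that row_bump_at(2)[OF h] by blast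
qed


lemma entry_update:
  assumes "q < length L" "r < length L" "0 \<le> i" "i < int (length L)"
  shows "entry (L[q := L ! r, r := x]) i = bumped (entry L) x (int q) (int r) i"
proof -
  have "nat i = r \<longleftrightarrow> i = int r" "nat i = q \<longleftrightarrow> i = int q" using assms(3) by auto
  then show ?thesis using assms by (auto simp: nth_list_update bumped_def)
qed

lemma hook_fun_cong:
  "(\<And>i. 0 \<le> i \<Longrightarrow> i < n \<Longrightarrow> u i = v i) \<Longrightarrow> hook_fun u n k \<longleftrightarrow> hook_fun v n k"
  unfolding hook_fun_def by (smt (verit))

lemma adj_fun_cong:
  assumes "s < n" "\<And>i. 0 \<le> i \<Longrightarrow> i < n \<Longrightarrow> u i = u' i" "\<And>i. 0 \<le> i \<Longrightarrow> i < s \<Longrightarrow> v i = v' i"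
  shows "adj_fun u v s \<longleftrightarrow> adj_fun u' v' s"
proof -
  have imp: "adj_fun u v s \<Longrightarrow> adj_fun u' v' s"
    if "\<And>i. 0 \<le> i \<Longrightarrow> i < n \<Longrightarrow> u i = u' i" "\<And>i. 0 \<le> i \<Longrightarrow> i < s \<Longrightarrow> v i = v' i" for u v u' v' :: "int \<Rightarrow> int"
    using assms(1) that unfolding adj_fun_def by (smt (verit))
  show ?thesis using imp[of u u' v v'] imp[of u' u v' v] assms by auto
qed

lemma hook_fun_index: "hook_fun u n k \<Longrightarrow> 1 \<le> k \<and> k \<le> n"
  by (simp add: hook_fun_def)

lemma row_hookE:
  assumes "row L"
  obtains k where "hook_at L k" "L \<noteq> []" "set L \<subseteq> A"
proof -
  obtain k where k: "hook_at L k" using assms by (auto simp: row_def hook_word_def)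
  moreover have "L \<noteq> []" using k by (auto simp: hook_at_def)
  ultimately show thesis using that assms by (auto simp: row_def)
qed

lemma row_bumped:
  assumes L: "row L" and x: "x \<in> A" and h: "hook_at L k"
    and b: "bump_fun (entry L) (int (length L)) (int k) x (int q) (int r)"
  shows "row (L[q := L ! r, r := x])"
    and "mset (L[q := L ! r, r := x]) + {#L ! q#} = mset L + {#x#}"
proof -
  have qr: "q < r" "r < length L" using b by (auto simp: bump_fun_def)
  let ?L = "L[q := L ! r, r := x]"
  obtain k' where "hook_fun (bumped (entry L) x (int q) (int r)) (int (length L)) k'"
    using hook_fun_bumped[OF h[unfolded hook_at_fun] b] by blast
  then have "hook_fun (entry ?L) (int (length ?L)) k'"
    using hook_fun_cong[of "int (length L)" "entry ?L" "bumped (entry L) x (int q) (int r)"]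
      entry_update[of q L r] qr by auto
  then have "hook_at ?L (nat k')" using hook_fun_index by (fastforce simp: hook_at_fun)
  then have hw: "hook_word ?L" by (auto simp: hook_word_def)
  have m: "mset ?L + {#L ! q#} = mset L + {#x#}"
  proof -
    have "mset ?L + {#L ! r#} = mset (L[q := L ! r]) + {#x#}"
      using mset_bump[of r "L[q := L ! r]" x] qr by simp
    moreover have "mset (L[q := L ! r]) + {#L ! q#} = mset L + {#L ! r#}"
      using mset_bump[of q L "L ! r"] qr by simp
    moreover have "a + q = l + x" if "a + c = b + x" "b + q = l + c" for a b c l q x :: "int multiset"
    proof -
      have "(a + q) + c = (a + c) + q" by (simp only: ac_simps)
      also have "\<dots> = (b + q) + x" unfolding that(1) by (simp only: ac_simps)
      also have "\<dots> = (l + x) + c" unfolding that(2) by (simp only: ac_simps)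
      finally show ?thesis by (simp only: add_right_cancel)
    qed
    ultimately show ?thesis by blast
  qed
  show "mset ?L + {#L ! q#} = mset L + {#x#}" by (rule m)
  have "set_mset (mset ?L + {#L ! q#}) \<subseteq> A" unfolding m using L x by (auto simp: row_def)
  then show "row ?L" using hw by (simp add: row_def)
qed

lemma row_adj_bump_bump:
  assumes U: "hook_at U k" "bump_fun (entry U) (int (length U)) (int k) x (int q) (int r)"
    and V: "hook_at V m" "bump_fun (entry V) (int (length V)) (int m) (U ! q) (int q') (int r')"
  shows "row_adj (U[q := U ! r, r := x]) (V[q' := V ! r', r' := U ! q]) \<longleftrightarrow> row_adj U V"
proof (cases "length V < length U")
  case True
  have qr: "q < length U" "r < length U" "q' < length V" "r' < length V"
    using U(2) V(2) by (auto simp: bump_fun_def)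
  have "adj_fun (entry (U[q := U ! r, r := x])) (entry (V[q' := V ! r', r' := U ! q])) (int (length V))
     \<longleftrightarrow> adj_fun (bumped (entry U) x (int q) (int r)) (bumped (entry V) (U ! q) (int q') (int r')) (int (length V))"
    by (rule adj_fun_cong[of _ "int (length U)"])
      (simp add: True, rule entry_update[OF qr(1,2)], assumption+, rule entry_update[OF qr(3,4)], assumption+)
  also have "\<dots> \<longleftrightarrow> adj_fun (entry U) (entry V) (int (length V))"
    using adj_fun_bump_bump[OF U(1)[unfolded hook_at_fun] U(2) V(1)[unfolded hook_at_fun], of "int q'" "int r'"] V(2) True
    by simp
  finally show ?thesis using True by (simp add: row_adj_def)
qed (simp add: row_adj_def)

lemma row_adj_bump_stops:
  assumes U: "hook_at U k" "bump_fun (entry U) (int (length U)) (int k) x (int q) (int r)"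
    and V: "V = [] \<or> hook_word V \<and> row_stops (U ! q) V"
    and len: "length V < length U"
  shows "row_adj (U[q := U ! r, r := x]) (V @ [U ! q]) \<longleftrightarrow> V = [] \<or> row_adj U V"
proof -
  have qr: "q < length U" "r < length U" using U(2) by (auto simp: bump_fun_def)
  let ?s = "int (length V)" and ?n = "int (length U)"
  obtain m where "V = [] \<or> hook_fun (entry V) ?s m \<and> (m = ?s \<or> entry V (?s - 1) < U ! q)"
  proof (cases "V = []")
    case False
    then obtain m where m: "hook_at V m" using V by (auto simp: hook_word_def)
    have "m = length V \<or> V ! (length V - 1) < U ! q"
      using V False hook_word_snoc[OF m, of "U ! q"] by (simp add: row_stops_def last_conv_nth)
    moreover have "nat (?s - 1) = length V - 1" by simp
    ultimately show thesis using that[of "int m"] m by (auto simp: hook_at_fun)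
  qed (use that in blast)
  then have core: "?s + 1 < ?n \<and>
      adj_fun (bumped (entry U) x (int q) (int r)) ((entry V)(?s := U ! q)) (?s + 1)
      \<longleftrightarrow> (V = [] \<or> adj_fun (entry U) (entry V) ?s)"
    using adj_fun_bump_stops[OF U(1)[unfolded hook_at_fun] U(2), of ?s "entry V" m] len by auto
  have "adj_fun (entry (U[q := U ! r, r := x])) (entry (V @ [U ! q])) (?s + 1)
     \<longleftrightarrow> adj_fun (bumped (entry U) x (int q) (int r)) ((entry V)(?s := U ! q)) (?s + 1)" if "?s + 1 < ?n"
  proof (rule adj_fun_cong[OF that])
    show "entry (V @ [U ! q]) i = ((entry V)(?s := U ! q)) i" if "0 \<le> i" "i < ?s + 1" for i
      using that by (auto simp: nth_append)
  qed (use qr entry_update in auto)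
  then show ?thesis using core len by (auto simp: row_adj_def add.commute)
qed

lemma row_unbump:
  assumes W: "row W" and z: "z \<in> A" "z < W ! 0" "2 \<le> length W" "W ! 1 \<le> W ! 0"
  obtains U k x q r where "row U" "x \<in> A" "hook_at U k" "length U = length W"
    "bump_fun (entry U) (int (length U)) (int k) x (int q) (int r)"
    "W = U[q := U ! r, r := x]" "U ! q = z"
proof -
  obtain k where hk: "hook_at W k" using W by (auto simp: row_def hook_word_def)
  note h = hk[unfolded hook_at_fun]
  have k2: "2 \<le> k"
  proof (rule ccontr)
    assume "\<not> 2 \<le> k"
    then have "k = 1" using hk by (simp add: hook_at_def)
    then have "\<forall>i j. 0 \<le> i \<and> i < j \<and> j < int (length W) \<longrightarrow> entry W i < entry W j"
      using h by (simp add: hook_fun_def)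
    from this[rule_format, of 0 1] have "W ! 0 < W ! 1" using z(3) by simp
    then show False using z(4) by simp
  qed
  have kn: "k \<le> length W" using hk by (simp add: hook_at_def)
  define q where "q = (if z < W ! (k - 1) then k - 2 else (GREATEST q. q < k \<and> z < W ! q))"
  have q: "q + 1 < k" "z < W ! q" "W ! (k - 1) \<le> z \<Longrightarrow> W ! (q + 1) \<le> z" "z < W ! (k - 1) \<Longrightarrow> q = k - 2"
  proof -
    have "q + 1 < k \<and> z < W ! q \<and> (W ! (k - 1) \<le> z \<longrightarrow> W ! (q + 1) \<le> z) \<and> (z < W ! (k - 1) \<longrightarrow> q = k - 2)"
    proof (cases "z < W ! (k - 1)")
      case True
      have "W ! (k - 1) \<le> W ! (k - 2)"
        using hk k2 by (auto simp: hook_at_def sorted_wrt_iff_nth_less)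
      then show ?thesis using True k2 by (auto simp: q_def)
    next
      case False
      let ?P = "\<lambda>q. q < k \<and> z < W ! q"
      have P0: "?P 0" using z(2) k2 by simp
      have bd: "\<And>y. ?P y \<Longrightarrow> y \<le> k" by simp
      have qP: "?P q" using GreatestI_nat[of ?P, OF P0 bd] False by (simp add: q_def)
      then have "q \<noteq> k - 1" using False by auto
      moreover have "q < k" using qP by blast
      ultimately have q1: "q + 1 < k" by arith
      have "\<not> ?P (q + 1)"
      proof
        assume "?P (q + 1)"
        from Greatest_le_nat[of ?P, OF this bd] show False using False by (simp add: q_def)
      qed
      then show ?thesis using q1 qP False by auto
    qed
    then show "q + 1 < k" "z < W ! q" "W ! (k - 1) \<le> z \<Longrightarrow> W ! (q + 1) \<le> z" "z < W ! (k - 1) \<Longrightarrow> q = k - 2"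
      by auto
  qed
  define r where "r = (GREATEST r. r < length W \<and> W ! r \<le> W ! q)"
  have r: "k - 1 \<le> r" "r < length W" "W ! r \<le> W ! q" "r + 1 < length W \<Longrightarrow> W ! q < W ! (r + 1)"
  proof -
    let ?P = "\<lambda>r. r < length W \<and> W ! r \<le> W ! q"
    have bd: "\<And>y. ?P y \<Longrightarrow> y \<le> length W" by simp
    have "W ! (k - 1) \<le> W ! q"
      using hk q(1) by (auto simp: hook_at_def sorted_wrt_iff_nth_less)
    then have P: "?P (k - 1)" using kn k2 by simp
    show "k - 1 \<le> r" unfolding r_def by (rule Greatest_le_nat[of ?P, OF P bd])
    show "r < length W" "W ! r \<le> W ! q" using GreatestI_nat[of ?P, OF P bd] by (auto simp: r_def)
    show "W ! q < W ! (r + 1)" if "r + 1 < length W"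
    proof (rule ccontr)
      assume "\<not> ?thesis"
      then have "?P (r + 1)" using that by simp
      from Greatest_le_nat[of ?P, OF this bd] show False by (simp add: r_def)
    qed
  qed
  define l where "l = (if z < W ! (k - 1) \<or> r = k - 1 then k - 1 else k)"
  define U where "U = W[q := z, r := W ! q]"
  have qr: "q < r" "q < length W" using q(1) r(1,2) by auto
  have nat_k: "nat (int k - 1) = k - 1" "nat (int k - 2) = k - 2" "nat (int q + 1) = q + 1" "nat (int r + 1) = r + 1"
    by auto
  have core: "hook_fun ((entry W)(int q := z, int r := W ! q)) (int (length W)) (int l) \<and>
    bump_fun ((entry W)(int q := z, int r := W ! q)) (int (length W)) (int l) (W ! r) (int q) (int r)"
    using unbump_fun[OF h, of z "int q" "int r" "int l" "(entry W)(int q := z, int r := W ! q)"]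
      z q r k2 by (auto simp: nat_k l_def)
  have ent: "entry U i = ((entry W)(int q := z, int r := W ! q)) i" if "0 \<le> i" for i
  proof -
    have "nat i = r \<longleftrightarrow> i = int r" "nat i = q \<longleftrightarrow> i = int q" using that by auto
    then show ?thesis using qr r(2) by (auto simp: U_def nth_list_update)
  qed
  have lU: "length U = length W" by (simp add: U_def)
  have hU: "hook_at U l"
    unfolding hook_at_fun lU
    by (rule hook_fun_cong[THEN iffD2, OF ent]) (use core in blast)+
  have WU: "W = U[q := U ! r, r := W ! r]" "U ! q = z"
    using qr r(2) by (auto simp: U_def list_eq_iff_nth_eq nth_list_update)
  have Ur: "U ! r = W ! q" using r(2) by (simp add: U_def)
  have bU: "bump_fun (entry U) (int (length U)) (int l) (W ! r) (int q) (int r)"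
    unfolding lU using core WU(2) Ur unfolding bump_fun_def by (auto simp: ent)
  have "set U \<subseteq> insert (W ! q) (set (W[q := z]))" unfolding U_def by (rule set_update_subset_insert)
  also have "\<dots> \<subseteq> insert (W ! q) (insert z (set W))" using set_update_subset_insert[of W q z] by blast
  also have "\<dots> \<subseteq> A" using W z(1) qr by (auto simp: row_def)
  finally have "row U" using hU by (auto simp: row_def hook_word_def)
  moreover have "W ! r \<in> A" using W r(2) by (auto simp: row_def)
  ultimately show thesis by (rule that[OF _ _ hU lU bU WU])
qed

text \<open>
  The first entry of the upper row exceeds all letters below it, and the row starts with a weak descent.  These are the
  conditions under which a letter \<open>t\<close> of the lower row can be passed back into the upper row.
\<close>

lemma row_adj_first:
  assumes "row_adj W D" "t \<in> set D"
  shows "t < W ! 0" "2 \<le> length W" "W ! 1 \<le> W ! 0"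
proof -
  have ne: "D \<noteq> []" using assms(2) by auto
  have adj: "length D < length W" "adj_fun (entry W) (entry D) (int (length D))"
    using assms(1) by (auto simp: row_adj_def)
  have top: "D ! i < W ! 0" if "i < length D" for i
    using adj(2) that unfolding adj_fun_def by (metis nat_int of_nat_0_le_iff of_nat_less_iff nat_0)
  show "t < W ! 0" using top assms(2) by (auto simp: in_set_conv_nth)
  show "2 \<le> length W" using adj(1) ne by (cases D) auto
  have "\<forall>j k. 0 \<le> j \<and> j \<le> k \<and> k < int (length D) \<longrightarrow> \<not> (entry D k < entry W j \<and> entry W j < entry W (k + 1))"
    using adj(2) by (simp add: adj_fun_def)
  from this[rule_format, of 0 0] have "\<not> (D ! 0 < W ! 0 \<and> W ! 0 < W ! 1)"
    using ne by simp
  then show "W ! 1 \<le> W ! 0" using top[of 0] ne by simp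
qed

lemma row_bump_inj:
  assumes C: "row C" "\<not> row_stops x C" and D: "row D" "\<not> row_stops y D" and eq: "row_bump x C = row_bump y D"
  shows "C = D \<and> x = y"
proof -
  obtain k where k: "hook_at C k" using C(1) row_hookE by blast
  obtain q r where q: "bump_fun (entry C) (int (length C)) (int k) x (int q) (int r)"
    "row_bump x C = (C[q := C ! r, r := x], C ! q)" using row_bumpE[OF k C(2)] by blast
  obtain l where l: "hook_at D l" using D(1) row_hookE by blast
  obtain q' r' where q': "bump_fun (entry D) (int (length D)) (int l) y (int q') (int r')"
    "row_bump y D = (D[q' := D ! r', r' := y], D ! q')" using row_bumpE[OF l D(2)] by blast
  have e: "C[q := C ! r, r := x] = D[q' := D ! r', r' := y]" "C ! q = D ! q'" using eq q q' by auto
  have len: "length C = length D" using e(1) by (metis length_list_update)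
  have b: "q < r" "r < length C" "q' < r'" "r' < length D" using q(1) q'(1) by (auto simp: bump_fun_def)
  have "int q = int q' \<and> int r = int r'"
  proof (rule bump_fun_inj[OF k[unfolded hook_at_fun] q(1)])
    show "hook_fun (entry D) (int (length C)) (int l)" "bump_fun (entry D) (int (length C)) (int l) y (int q') (int r')"
      using l q'(1) by (auto simp: len hook_at_fun)
    show "bumped (entry C) x (int q) (int r) i = bumped (entry D) y (int q') (int r') i"
      if "0 \<le> i" "i < int (length C)" for i
      using entry_update[of q C r i x] entry_update[of q' D r' i y] that b e(1) len by simp
  qed (use e in simp)
  then have [simp]: "q' = q" "r' = r" by auto
  have nth: "(C[q := C ! r, r := x]) ! i = (D[q := D ! r, r := y]) ! i" for i using e(1) by simp
  have "x = y" using nth[of r] b len by simp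
  moreover have "C ! r = D ! r" using nth[of q] b len by simp
  moreover have "C ! i = D ! i" if "i < length C" for i
    using nth[of i] e(2) \<open>C ! r = D ! r\<close> that len by (cases "i = q"; cases "i = r") auto
  ultimately show ?thesis using len by (simp add: list_eq_iff_nth_eq)
qed

end

locale row_insertion = row_letters +
  fixes ins :: "int \<Rightarrow> tableau \<Rightarrow> tableau"
  assumes row_ins_Nil: "ins x [] = [[x]]"
    and row_ins_Cons: "ins x (L # T) =
      (if row_stops x L then (L @ [x]) # T else fst (row_bump x L) # ins (snd (row_bump x L)) T)"
begin

sublocale line_insertion A row "\<lambda>a b. b < a" row_adj row_stops row_bump ins
proof
  show "ins x [] = [[x]]" for x by (rule row_ins_Nil)
  show "ins x (L # T) =
      (if row_stops x L then (L @ [x]) # T else fst (row_bump x L) # ins (snd (row_bump x L)) T)" for x L T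
    by (rule row_ins_Cons)
  show "L \<noteq> [] \<and> set L \<subseteq> A" if "row L" for L
    using that row_hookE by blast
  have single: "hook_word [x]" for x :: int
    by (auto simp: hook_word_def hook_at_def intro!: exI[of _ 1])
  then show "row [x]" if "x \<in> A" for x using that by (simp add: row_def)
  show "row (C @ [x]) \<longleftrightarrow> row C \<and> row_stops x C" if "C \<noteq> []" "x \<in> A" for C x
  proof
    assume r: "row (C @ [x])"
    then obtain k where k: "hook_at (C @ [x]) k" by (auto simp: row_def hook_word_def)
    have "hook_at C (if k = Suc (length C) then length C else k)"
    proof (cases "k = Suc (length C)")
      case True
      have "sorted_wrt (\<ge>) C" using k True by (simp add: hook_at_def sorted_wrt_append)
      moreover have "sorted_wrt (<) (drop (length C - 1) C)"
        using that(1) by (cases C rule: rev_exhaust) auto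
      ultimately show ?thesis using True that(1) by (cases C) (auto simp: hook_at_def)
    next
      case False
      then have "k \<le> length C" using k by (simp add: hook_at_def)
      then show ?thesis using k False by (auto simp: hook_at_def sorted_wrt_append)
    qed
    then show "row C \<and> row_stops x C" using r by (auto simp: row_def hook_word_def row_stops_def)
  qed (use that in \<open>auto simp: row_def row_stops_def\<close>)
  show "length D < length C" if "row_adj C D" for C D using that by (simp add: row_adj_def)
  show "row_adj (C @ [x]) D \<longleftrightarrow> row_adj C D" if "length D < length C" for C D x
  proof -
    have "adj_fun (entry (C @ [x])) (entry D) (int (length D)) \<longleftrightarrow> adj_fun (entry C) (entry D) (int (length D))"
      by (rule adj_fun_cong[of _ "int (length C)"]) (use that in \<open>auto simp: nth_append\<close>)
    then show ?thesis using that by (simp add: row_adj_def)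
  qed
next
  fix C C' x y assume C: "row C" "x \<in> A" "\<not> row_stops x C" "row_bump x C = (C', y)"
  obtain k where k: "hook_at C k" using C(1) row_hookE by blast
  obtain q r where q: "bump_fun (entry C) (int (length C)) (int k) x (int q) (int r)"
    "C' = C[q := C ! r, r := x]" "y = C ! q" using row_bumpE[OF k C(3)] C(4) by (metis fst_conv snd_conv)
  show "row C' \<and> length C' = length C \<and> mset C' + {#y#} = mset C + {#x#}"
    using row_bumped[OF C(1,2) k q(1)] by (simp add: q(2,3))
  have len: "0 < length C" using q(1) by (auto simp: bump_fun_def)
  show "row_adj C' [y]"
    using row_adj_bump_stops[OF k q(1), of "[]"] len by (simp add: q(2,3))
  show "row_adj C' (D @ [y])" if D: "row D" "row_stops y D" "row_adj C D" for D
    using row_adj_bump_stops[OF k q(1), of D] D by (simp add: q(2,3) row_def row_adj_def)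
  show "row_adj C' D'" if D: "row D" "\<not> row_stops y D" "row_bump y D = (D', z)" "row_adj C D" for D D' z
  proof -
    obtain m where m: "hook_at D m" using D(1) row_hookE by blast
    obtain q' r' where q': "bump_fun (entry D) (int (length D)) (int m) y (int q') (int r')"
      "D' = D[q' := D ! r', r' := y]" using row_bumpE[OF m D(2)] D(3) by (metis fst_conv)
    show ?thesis using row_adj_bump_bump[OF k q(1) m] q' D(4) by (simp add: q(2,3))
  qed
next
  fix C x D y
  assume "row C" "\<not> row_stops x C" "row D" "\<not> row_stops y D" "row_bump x C = row_bump y D"
  then show "C = D \<and> x = y" by (rule row_bump_inj)
next
  fix W y assume W: "row W" and y: "y \<in> A"
  show "\<exists>C x. row C \<and> x \<in> A \<and> \<not> row_stops x C \<and> row_bump x C = (W, y)" if adj: "row_adj W [y]"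
  proof -
    have f: "y < W ! 0" "2 \<le> length W" "W ! 1 \<le> W ! 0"
      using row_adj_first[OF adj, of y] by auto
    obtain U k x q r where U: "row U" "x \<in> A" "hook_at U k"
      "bump_fun (entry U) (int (length U)) (int k) x (int q) (int r)"
      "W = U[q := U ! r, r := x]" "U ! q = y"
      by (rule row_unbump[OF W y f]) blast
    moreover have "\<not> row_stops x U" "row_bump x U = (W, y)"
      using row_bump_at[OF U(3,4)] unfolding U(5)[symmetric] U(6) by blast+
    ultimately show ?thesis by blast
  qed
  show "\<exists>C x. row C \<and> x \<in> A \<and> \<not> row_stops x C \<and> row_bump x C = (W, y) \<and> row_adj C D"
    if D: "row D" "row_stops y D" "row_adj W (D @ [y])" for D
  proof -
    have hw: "hook_word D" and ne: "D \<noteq> []"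
      using D(1) by (simp add: row_def, blast elim: row_hookE)
    have f: "y < W ! 0" "2 \<le> length W" "W ! 1 \<le> W ! 0"
      using row_adj_first[OF D(3), of y] by auto
    obtain U k x q r where U: "row U" "x \<in> A" "hook_at U k" "length U = length W"
      "bump_fun (entry U) (int (length U)) (int k) x (int q) (int r)"
      "W = U[q := U ! r, r := x]" "U ! q = y"
      by (rule row_unbump[OF W y f]) blast
    have "length D < length U" using D(3) U(4) by (simp add: row_adj_def)
    then have "row_adj U D" using row_adj_bump_stops[OF U(3,5), of D] D(2,3) hw ne U(6,7) by simp
    moreover have "\<not> row_stops x U" "row_bump x U = (W, y)"
      using row_bump_at[OF U(3,5)] unfolding U(6)[symmetric] U(7) by blast+
    ultimately show ?thesis using U(1,2) by blast
  qed
  show "\<exists>C x. row C \<and> x \<in> A \<and> \<not> row_stops x C \<and> row_bump x C = (W, y) \<and> row_adj C D"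
    if D: "row D" "\<not> row_stops y D" "row_bump y D = (D', z)" "row_adj W D'" for D D' z
  proof -
    obtain m where m: "hook_at D m" using D(1) row_hookE by blast
    obtain q' r' where q': "bump_fun (entry D) (int (length D)) (int m) y (int q') (int r')"
      "D' = D[q' := D ! r', r' := y]" using row_bumpE[OF m D(2)] D(3) by (metis fst_conv)
    have "r' < length D" using q'(1) by (auto simp: bump_fun_def)
    then have "y \<in> set D'" unfolding q'(2) by (intro set_update_memI) simp
    then have f: "y < W ! 0" "2 \<le> length W" "W ! 1 \<le> W ! 0"
      using row_adj_first[OF D(4), of y] by auto
    obtain U k x q r where U: "row U" "x \<in> A" "hook_at U k" "length U = length W"
      "bump_fun (entry U) (int (length U)) (int k) x (int q) (int r)"
      "W = U[q := U ! r, r := x]" "U ! q = y"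
      by (rule row_unbump[OF W y f]) blast
    have "row_adj U D"
      using row_adj_bump_bump[OF U(3,5) m, of q' r'] q'(1) D(4) unfolding U(6)[symmetric] U(7) q'(2)[symmetric] by blast
    moreover have "\<not> row_stops x U" "row_bump x U = (W, y)"
      using row_bump_at[OF U(3,5)] unfolding U(6)[symmetric] U(7) by blast+
    ultimately show ?thesis using U(1,2) by blast
  qed
qed

end


section \<open>Strict partitions and decomposition tableaux\<close>

text \<open>
  If the decreasing part of \<open>v\<close> reached beyond that of \<open>u\<close>, the first ascent of \<open>u\<close> would form the third excluded pattern
  of \<open>adj_fun\<close> with the entry of \<open>v\<close> before it.
\<close>

lemma decreasing_parts_interlace:
  assumes "hook_fun u n k" "hook_fun v s m" "adj_fun u v s" "s < n" "0 \<le> i" "i < m"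
  shows "i < k \<and> v i < u i"
  using assms unfolding hook_fun_def adj_fun_def by (smt (z3))

lemma equal_conjugates:
  assumes "0 \<notin> set ls" "0 \<notin> set ks"
    and "successively (\<lambda>a b. b \<le> a) ls" "successively (\<lambda>a b. b \<le> a) ks"
    and "\<And>t. conjugate ls t = conjugate ks t"
  shows "ls = ks"
proof (rule part_inj[OF assms(1,2)], rule ext)
  fix j
  have "t < part ls j \<longleftrightarrow> t < part ks j" for t
    using less_conjugate_iff[OF assms(3), of j t] less_conjugate_iff[OF assms(4), of j t] assms(5) by simp
  then show "part ls j = part ks j" by (metis less_irrefl linorder_neqE_nat)
qed

text \<open>
  The factors are collected along the diagonals \<open>i + t = k\<close>.
\<close>

lemma prod_diagonals:
  fixes \<rho> :: "nat \<Rightarrow> real"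
  assumes "\<And>k. n \<le> k \<Longrightarrow> a k = 0"
  shows "(\<Prod>i<n. \<Prod>t<n. \<rho> t ^ a (i + t)) = (\<Prod>k<n. (\<Prod>t\<le>k. \<rho> t) ^ a k)"
proof -
  have "(\<Prod>i<n. \<rho> t ^ a (i + t)) = (\<Prod>k<n. if t \<le> k then \<rho> t ^ a k else 1)" if "t < n" for t
  proof -
    have "(\<Prod>i<n. \<rho> t ^ a (i + t)) = (\<Prod>k\<in>{t..<t + n}. \<rho> t ^ a k)"
      by (rule prod.reindex_bij_witness[of _ "\<lambda>k. k - t" "\<lambda>i. i + t"]) auto
    also have "\<dots> = (\<Prod>k\<in>{t..<n}. \<rho> t ^ a k)"
      by (rule prod.mono_neutral_right) (auto simp: assms)
    also have "\<dots> = (\<Prod>k\<in>{..<n}. if t \<le> k then \<rho> t ^ a k else 1)"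
      by (rule prod.mono_neutral_cong_left) auto
    finally show ?thesis .
  qed
  then have "(\<Prod>i<n. \<Prod>t<n. \<rho> t ^ a (i + t)) = (\<Prod>t<n. \<Prod>k<n. if t \<le> k then \<rho> t ^ a k else 1)"
    by (subst prod.swap) simp
  also have "\<dots> = (\<Prod>k<n. \<Prod>t<n. if t \<le> k then \<rho> t ^ a k else 1)" by (rule prod.swap)
  also have "\<dots> = (\<Prod>k<n. (\<Prod>t\<le>k. \<rho> t) ^ a k)"
  proof (rule prod.cong[OF refl])
    fix k assume "k \<in> {..<n}"
    then have "(\<Prod>t<n. if t \<le> k then \<rho> t ^ a k else 1) = (\<Prod>t\<le>k. \<rho> t ^ a k)"
      by (intro prod.mono_neutral_cong_right) auto
    then show "(\<Prod>t<n. if t \<le> k then \<rho> t ^ a k else 1) = (\<Prod>t\<le>k. \<rho> t) ^ a k"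
      by (simp add: prod_power_distrib)
  qed
  finally show ?thesis .
qed

text \<open>
  The alphabet is kept folded here, so that it matches the parameter of \<open>letter_law\<close>.
\<close>

declare alphabet.simps(3) [simp del]

locale hook_rows = letter_law "alphabet (Queer n)" p +
  row_insertion "alphabet (Queer n)" "insertion (Queer n)"
  for p :: "int \<Rightarrow> real" and n :: nat +
  assumes anti: "strict_antimono_on {1..int n} p"
begin

definition inside :: "nat list \<Rightarrow> bool" where
  "inside ls \<longleftrightarrow> length ls \<le> n"

definition vec :: "nat list \<Rightarrow> vector" where
  "vec ls = row_vector n (part ls)"

definition decode :: "vector \<Rightarrow> nat \<Rightarrow> nat" where
  "decode v j = (if j < n then nat (v (int j + 1)) else 0)"

lemma letter_iff: "a \<in> alphabet (Queer n) \<longleftrightarrow> 1 \<le> a \<and> a \<le> int n"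
  by (simp add: alphabet.simps(3))

lemma letterE:
  assumes "a \<in> alphabet (Queer n)"
  obtains j where "j < n" "a = int j + 1"
proof -
  have range: "1 \<le> a" "a \<le> int n" using assms by (simp_all add: letter_iff)
  have "int (nat (a - 1)) = a - 1" by (rule nat_0_le) (use range in linarith)
  then have "nat (a - 1) < n" "a = int (nat (a - 1)) + 1" using range by linarith+
  then show thesis by (rule that)
qed

lemma vec_nth: "j < n \<Longrightarrow> vec ls (int j + 1) = int (part ls j)"
  by (simp add: vec_def row_vector_def)

lemma vec_outside: "a \<notin> {1..int n} \<Longrightarrow> vec ls a = 0"
  unfolding vec_def row_vector_def by (simp only: if_False)

lemma vec_nonneg: "0 \<le> vec ls a"
  by (simp add: vec_def row_vector_def)

lemma vec_Nil: "vec [] = 0"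
  by (rule ext) (simp add: vec_def row_vector_def part_def)

lemma part_beyond: "inside ls \<Longrightarrow> n \<le> j \<Longrightarrow> part ls j = 0"
  by (simp add: part_def inside_def)

lemma decode_vec:
  assumes "inside ls"
  shows "decode (vec ls) = part ls"
  by (rule ext) (simp add: decode_def vec_nth part_beyond[OF assms])

lemma decode_step:
  assumes "inside ls" "a \<in> alphabet (Queer n)"
  shows "\<exists>j. decode (vec ls + unit_vector a) = (part ls)(j := Suc (part ls j))"
proof -
  obtain k where k: "k < n" "a = int k + 1" using assms(2) by (rule letterE)
  have "decode (vec ls + unit_vector a) j = ((part ls)(k := Suc (part ls k))) j" for j
    using k by (simp add: decode_def vec_nth part_beyond[OF assms(1)] unit_vector_def nat_add_distrib)
  then show ?thesis by blast
qed

lemma vec_grow: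
  assumes "j \<le> length ls" "inside (grow j ls)"
  shows "\<exists>a\<in>alphabet (Queer n). vec (grow j ls) = vec ls + unit_vector a"
proof -
  have j: "j < n" using assms by (auto simp: inside_def grow_def split: if_splits)
  have "vec (grow j ls) = vec ls + unit_vector (int j + 1)"
  proof
    fix c
    have "vec (grow j ls) c = vec ls c + unit_vector (int j + 1) c"
    proof (cases "c \<in> {1..int n}")
      case True
      then have "c \<in> alphabet (Queer n)" by (simp add: letter_iff)
      then obtain k where k: "k < n" "c = int k + 1" by (rule letterE)
      show ?thesis unfolding k(2) vec_nth[OF k(1)] part_grow[OF assms(1)] by (simp add: unit_vector_def)
    next
      case False
      then have "c \<noteq> int j + 1" using j by auto
      then show ?thesis unfolding vec_outside[OF False] unit_vector_def by simp
    qed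
    then show "vec (grow j ls) c = (vec ls + unit_vector (int j + 1)) c" by simp
  qed
  moreover have "int j + 1 \<in> alphabet (Queer n)" using j by (simp add: letter_iff)
  ultimately show ?thesis by blast
qed

lemma row_nonempty: "row L \<Longrightarrow> L \<noteq> []"
  using row_hookE by blast

lemma tab_rowD: "tab T \<Longrightarrow> L \<in> set T \<Longrightarrow> row L"
  by (simp add: tab_def)

lemma tab_adj: "tab T \<Longrightarrow> Suc j < length T \<Longrightarrow> row_adj (T ! j) (T ! Suc j)"
  by (simp add: tab_def successively_conv_nth)

text \<open>
  The first entries of the rows decrease strictly from top to bottom, so there are at most \<open>n\<close> rows.
\<close>

lemma tab_inside:
  assumes T: "tab T"
  shows "inside (map length T)"
proof -
  have first: "T ! j ! 0 \<in> {1..int n}" if "j < length T" for j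
  proof -
    have "row (T ! j)" by (rule tab_rowD[OF T]) (use that in simp)
    then have "T ! j ! 0 \<in> set (T ! j)" "set (T ! j) \<subseteq> alphabet (Queer n)"
      using row_nonempty by (auto simp: row_def)
    then show ?thesis using letter_iff by auto
  qed
  have "T ! (length T - Suc k) ! 0 \<ge> int k + 1" if "k < length T" for k
    using that
  proof (induction k)
    case 0
    then show ?case using first[of "length T - 1"] by simp
  next
    case (Suc k)
    let ?j = "length T - Suc (Suc k)"
    have j: "Suc ?j = length T - Suc k" "Suc ?j < length T" using Suc.prems by auto
    have "T ! Suc ?j \<noteq> []" using row_nonempty[OF tab_rowD[OF T]] j(2) by simp
    then have "T ! Suc ?j ! 0 < T ! ?j ! 0"
      using row_adj_first(1)[OF tab_adj[OF T j(2)]] by simp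
    moreover have "int k + 1 \<le> T ! Suc ?j ! 0" using Suc.IH Suc.prems unfolding j(1) by simp
    ultimately show ?case by simp
  qed
  from this[of "length T - 1"] show ?thesis
    using first[of 0] by (cases "length T") (auto simp: inside_def)
qed

lemma tab_shape: "shape (Queer n) T = vec (map length T)"
proof -
  have "row_lengths_of_rows T = part (map length T)"
    by (rule ext) (simp add: row_lengths_of_rows_def part_def)
  then show ?thesis by (simp add: vec_def)
qed

lemma admissible_nth:
  "admissible ls \<longleftrightarrow> 0 \<notin> set ls \<and> (\<forall>i. Suc i < length ls \<longrightarrow> ls ! Suc i < ls ! i)"
  by (simp add: admissible_def successively_conv_nth)

lemma states: "partitions_of (Queer n) = vec ` {ls. admissible ls \<and> inside ls}"
proof safe
  fix v assume "v \<in> partitions_of (Queer n)"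
  then have v: "v \<in> partition_vectors n" "\<And>a. a \<in> {1..<int n} \<Longrightarrow> v (a + 1) > 0 \<Longrightarrow> v a > v (a + 1)"
    by (auto simp: strict_partition_vectors_def)
  obtain w where w: "antimono w" "\<And>i. n \<le> i \<Longrightarrow> w i = 0" "v = row_vector n w"
    using v(1) unfolding partition_vectors_eq by auto
  have "{j. w j \<noteq> 0} \<subseteq> {..<n}" using w(2) by (metis (mono_tags) lessThan_iff mem_Collect_eq not_le subsetI)
  then have "finite {j. w j \<noteq> 0}" using finite_subset by blast
  then obtain ls where ls: "0 \<notin> set ls" "part ls = w" using ex_part[OF w(1)] by blast
  have vls: "v = vec ls" unfolding vec_def ls(2) w(3) ..
  have len: "length ls \<le> n"
  proof (rule ccontr)
    assume "\<not> length ls \<le> n"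
    then have "0 < part ls n" using part_pos_iff[OF ls(1)] by simp
    then show False by (simp add: ls(2) w(2))
  qed
  have "ls ! Suc i < ls ! i" if i: "Suc i < length ls" for i
  proof -
    have "0 < part ls (Suc i)" using part_pos_iff[OF ls(1)] i by simp
    then have pos: "0 < v (int i + 1 + 1)" using vec_nth[of "Suc i" ls] i len by (simp add: vls add.commute)
    have "int i + 1 \<in> {1..<int n}" using i len by simp
    from v(2)[OF this pos] have "part ls (Suc i) < part ls i"
      using vec_nth[of "Suc i" ls] vec_nth[of i ls] i len by (simp add: vls add.commute)
    then show ?thesis using i by (simp add: part_def)
  qed
  then have "admissible ls" using ls(1) by (simp add: admissible_nth)
  moreover note vls
  ultimately show "v \<in> vec ` {ls. admissible ls \<and> inside ls}" using len by (auto simp: inside_def)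
next
  fix ls assume ls: "admissible ls" "inside ls"
  have step: "part ls (Suc j) \<le> part ls j \<and> (0 < part ls (Suc j) \<longrightarrow> part ls (Suc j) < part ls j)" for j
    using ls(1) by (auto simp: admissible_nth part_def less_imp_le)
  have "vec ls (a + 1) \<le> vec ls a \<and> (0 < vec ls (a + 1) \<longrightarrow> vec ls (a + 1) < vec ls a)"
    if a: "a \<in> {1..<int n}" for a
  proof -
    have "a \<in> alphabet (Queer n)" using a by (simp add: letter_iff)
    then obtain j where j: "j < n" "a = int j + 1" by (rule letterE)
    then have "Suc j < n" "a + 1 = int (Suc j) + 1" using a by auto
    then show ?thesis using vec_nth[of "Suc j"] vec_nth[OF j(1)] step[of j] j(2) by simp
  qed
  then show "vec ls \<in> partitions_of (Queer n)"
    using vec_outside vec_nonneg by (auto simp: strict_partition_vectors_def partition_vectors_def)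
qed

lemma shrink:
  assumes "admissible ls" "inside ls" "ls \<noteq> []"
  shows "\<exists>ls0 j. admissible ls0 \<and> inside ls0 \<and> j \<le> length ls0 \<and> ls = grow j ls0"
proof -
  obtain ks c where ks: "ls = ks @ [c]" using assms(3) by (cases ls rule: rev_exhaust) auto
  have c: "0 < c" and adm: "0 \<notin> set ks" "successively (\<lambda>a b. b < a) ks" "ks \<noteq> [] \<Longrightarrow> c < last ks"
    using assms(1) by (auto simp: ks admissible_def successively_append_iff)
  show ?thesis
  proof (cases "c = 1")
    case True
    then have "grow (length ks) ks = ls" by (simp add: grow_def ks)
    moreover have "inside ks" using assms(2) by (simp add: inside_def ks)
    ultimately show ?thesis using adm by (intro exI[of _ ks] exI[of _ "length ks"]) (simp add: admissible_def)
  next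
    case False
    let ?ks = "ks @ [c - 1]"
    have "grow (length ks) ?ks = ls" using c by (simp add: grow_def ks)
    moreover have "inside ?ks" using assms(2) by (simp add: inside_def ks)
    moreover have "ks \<noteq> [] \<Longrightarrow> c - 1 < last ks" using adm(3) by fastforce
    then have "admissible ?ks" using adm(1,2) c False by (auto simp: admissible_def successively_append_iff)
    ultimately show ?thesis by (intro exI[of _ ?ks] exI[of _ "length ks"]) simp
  qed
qed

text \<open>
  Constant rows work: a row without ascents is a hook word, and every letter is smaller than all letters above it.
\<close>

lemma tab_exists:
  assumes "admissible ls" "inside ls"
  shows "\<exists>T. tab T \<and> map length T = ls"
proof -
  let ?T = "map (\<lambda>j. replicate (ls ! j) (int n - int j)) [0..<length ls]"
  have len: "length ls \<le> n" using assms(2) by (simp add: inside_def)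
  have pos: "0 < ls ! j" if "j < length ls" for j using assms(1) that by (metis admissible_def gr0I nth_mem)
  have rows: "row (replicate (ls ! j) (int n - int j))" if j: "j < length ls" for j
  proof -
    have "hook_at (replicate (ls ! j) (int n - int j)) (ls ! j)"
      using pos[OF j] by (auto simp: hook_at_def sorted_wrt_iff_nth_less)
    then show ?thesis using j len by (auto simp: row_def hook_word_def letter_iff)
  qed
  have "row_adj (?T ! j) (?T ! Suc j)" if j: "Suc j < length ?T" for j
  proof -
    have lt: "ls ! Suc j < ls ! j" using assms(1) j by (simp add: admissible_nth)
    have "adj_fun (\<lambda>i. int n - int j) (\<lambda>i. int n - int (Suc j)) (int (ls ! Suc j))"
      by (simp add: adj_fun_def)
    then have "adj_fun (entry (?T ! j)) (entry (?T ! Suc j)) (int (ls ! Suc j))"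
      by (rule iffD2[OF adj_fun_cong[of _ "int (ls ! j)"], rotated -1]) (use lt j in auto)
    then show ?thesis using lt j by (simp add: row_adj_def)
  qed
  then have "successively row_adj ?T" by (simp add: successively_conv_nth)
  then have "tab ?T" using rows by (auto simp: tab_def)
  moreover have "map length ?T = ls" by (intro nth_equalityI) auto
  ultimately show ?thesis by blast
qed

definition dec :: "tableau \<Rightarrow> nat \<Rightarrow> int list" where
  "dec T i = (if i < length T then decreasing_part (T ! i) else [])"

definition inc :: "tableau \<Rightarrow> nat \<Rightarrow> int list" where
  "inc T i = (if i < length T then increasing_part (T ! i) else [])"

text \<open>
  The number of entries greater than \<open>t\<close> in the decreasing part of row \<open>i\<close>.
\<close>

definition dec_count :: "tableau \<Rightarrow> nat \<Rightarrow> nat \<Rightarrow> nat" where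
  "dec_count T i t = conjugate (map nat (dec T i)) t"

lemma dec_inc:
  assumes "tab T"
  shows "i < length T \<Longrightarrow> T ! i = dec T i @ inc T i" "set (dec T i) \<subseteq> alphabet (Queer n)"
    "set (inc T i) \<subseteq> alphabet (Queer n)" "successively (\<lambda>a b. b \<le> a) (map nat (dec T i))"
    "0 \<notin> set (map nat (dec T i))" "sorted_wrt (<) (inc T i)"
proof -
  have "(i < length T \<longrightarrow> T ! i = dec T i @ inc T i) \<and> set (dec T i) \<subseteq> alphabet (Queer n) \<and>
    set (inc T i) \<subseteq> alphabet (Queer n) \<and> sorted_wrt (\<ge>) (dec T i) \<and> sorted_wrt (<) (inc T i)"
  proof (cases "i < length T")
    case True
    then have "row (T ! i)" using tab_rowD[OF assms] by simp
    then obtain k where k: "hook_at (T ! i) k" and sub: "set (T ! i) \<subseteq> alphabet (Queer n)" by (rule row_hookE)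
    have "sorted_wrt (<) (drop 1 (drop (k - 1) (T ! i)))" using k by (simp only: hook_at_def sorted_wrt_drop)
    moreover have "drop 1 (drop (k - 1) (T ! i)) = drop k (T ! i)" using k by (simp add: hook_at_def)
    moreover have "sorted_wrt (\<ge>) (take k (T ! i))" using k by (simp add: hook_at_def)
    ultimately show ?thesis
      using True sub set_take_subset[of k "T ! i"] set_drop_subset[of k "T ! i"]
      unfolding dec_def inc_def hook_parts[OF k] by (simp; blast)
  qed (simp add: dec_def inc_def)
  then have *: "i < length T \<longrightarrow> T ! i = dec T i @ inc T i" "set (dec T i) \<subseteq> alphabet (Queer n)"
    "set (inc T i) \<subseteq> alphabet (Queer n)" "sorted_wrt (\<ge>) (dec T i)" "sorted_wrt (<) (inc T i)" by blast+
  have "sorted_wrt (\<lambda>a b. b \<le> a) (map nat (dec T i))"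
    unfolding sorted_wrt_map by (rule sorted_wrt_mono_rel[OF _ *(4)]) (simp add: nat_mono)
  then show "successively (\<lambda>a b. b \<le> a) (map nat (dec T i))" using successively_conv_sorted_wrt[of "\<lambda>a b :: nat. b \<le> a"] by (simp add: transp_def)
  show "0 \<notin> set (map nat (dec T i))" using *(2) by (auto simp: alphabet.simps(3))
  show "i < length T \<Longrightarrow> T ! i = dec T i @ inc T i" "set (dec T i) \<subseteq> alphabet (Queer n)"
    "set (inc T i) \<subseteq> alphabet (Queer n)" "sorted_wrt (<) (inc T i)" using * by blast+
qed

lemma dec_count_0:
  assumes "tab T"
  shows "dec_count T i 0 = length (dec T i)"
proof -
  have "filter (\<lambda>c. 0 < c) (map nat (dec T i)) = map nat (dec T i)"
    using dec_inc(5)[OF assms, of i] by (intro filter_True) (metis gr0I)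
  then show ?thesis by (simp add: dec_count_def conjugate_def)
qed

text \<open>
  The decreasing parts, placed below each other, have strictly decreasing columns, so these numbers form a
  Gelfand--Tsetlin pattern.  It describes the tableau up to the increasing parts, which have at most \<open>n\<close> letters.
\<close>

lemma dec_count_interlace:
  assumes T: "tab T"
  shows "dec_count T (Suc i) t \<le> dec_count T i (Suc t)"
proof (cases "Suc i < length T")
  case True
  obtain k where k: "hook_at (T ! i) k" using row_hookE[OF tab_rowD[OF T]] True by (metis Suc_lessD nth_mem)
  obtain m where m: "hook_at (T ! Suc i) m" using row_hookE[OF tab_rowD[OF T]] True by (metis nth_mem)
  have adj: "length (T ! Suc i) < length (T ! i)"
    "adj_fun (entry (T ! i)) (entry (T ! Suc i)) (int (length (T ! Suc i)))"
    using tab_adj[OF T True] by (auto simp: row_adj_def)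
  have lower: "x < k \<and> T ! Suc i ! x < T ! i ! x" if "x < m" for x
    using decreasing_parts_interlace[OF k[unfolded hook_at_fun] m[unfolded hook_at_fun] adj(2), of "int x"] that adj(1)
    by simp
  have len: "k \<le> length (T ! i)" "m \<le> length (T ! Suc i)" using k m by (auto simp: hook_at_def)
  have "card {x. x < m \<and> t < nat (T ! Suc i ! x)} \<le> card {x. x < k \<and> Suc t < nat (T ! i ! x)}"
  proof (rule card_mono)
    show "{x. x < m \<and> t < nat (T ! Suc i ! x)} \<subseteq> {x. x < k \<and> Suc t < nat (T ! i ! x)}"
    proof safe
      fix x assume "x < m" "t < nat (T ! Suc i ! x)"
      then show "x < k" "Suc t < nat (T ! i ! x)" using lower[of x] by linarith+
    qed
  qed simp
  moreover have "dec_count T i s = card {x. x < k \<and> s < nat (T ! i ! x)}" for s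
    using True len by (simp add: dec_count_def conjugate_def dec_def hook_parts[OF k] length_filter_conv_card cong: conj_cong)
  moreover have "dec_count T (Suc i) s = card {x. x < m \<and> s < nat (T ! Suc i ! x)}" for s
    using True len by (simp add: dec_count_def conjugate_def dec_def hook_parts[OF m] length_filter_conv_card cong: conj_cong)
  ultimately show ?thesis by simp
next
  case False
  then show ?thesis by (simp add: dec_count_def conjugate_def dec_def)
qed

lemma dec_count_diagonal: "tab T \<Longrightarrow> dec_count T (i + t) 0 \<le> dec_count T i t"
proof (induction t arbitrary: i)
  case (Suc t)
  have "dec_count T (i + Suc t) 0 \<le> dec_count T (Suc i) t" using Suc.IH[of "Suc i"] Suc.prems by simp
  also have "\<dots> \<le> dec_count T i (Suc t)" by (rule dec_count_interlace[OF Suc.prems])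
  finally show ?case .
qed simp

lemma length_inc_le:
  assumes "tab T"
  shows "length (inc T i) \<le> n"
proof -
  have "distinct (inc T i)" using dec_inc(6)[OF assms] by (simp add: strict_sorted_iff)
  then have "length (inc T i) = card (set (inc T i))" by (simp add: distinct_card)
  also have "\<dots> \<le> card (alphabet (Queer n))" by (rule card_mono[OF finite_A dec_inc(3)[OF assms]])
  finally show ?thesis by (simp add: alphabet.simps(3))
qed

lemma part_dec_inc:
  assumes "tab T"
  shows "part (map length T) i = dec_count T i 0 + length (inc T i)"
proof (cases "i < length T")
  case True
  then show ?thesis using arg_cong[OF dec_inc(1)[OF assms True], of length] dec_count_0[OF assms, of i]
    by (simp add: part_def)
next
  case False
  then show ?thesis by (simp add: part_def dec_count_def conjugate_def dec_def inc_def)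
qed


text \<open>
  A letter \<open>j + 1\<close> has the weight \<open>ratio 0 * ... * ratio j\<close>.  The decreasing parts thereby have one factor \<open>ratio t\<close> for each
  entry greater than \<open>t\<close>, and these factors are less than \<open>1\<close> for \<open>t > 0\<close>.
\<close>

definition ratio :: "nat \<Rightarrow> real" where
  "ratio t = (if t = 0 then p 1 else p (int t + 1) / p (int t))"

lemma p_le_1: "a \<in> alphabet (Queer n) \<Longrightarrow> p a \<le> 1"
  using member_le_sum[of a "alphabet (Queer n)" p] finite_A p_pos p_sum by (auto intro: less_imp_le)

lemma ratio_pos: "t < n \<Longrightarrow> 0 < ratio t"
  using p_pos by (auto simp: ratio_def letter_iff)

lemma ratio_less_1:
  assumes "t < n" "0 < t"
  shows "ratio t < 1"
proof -
  have "p (int t + 1) < p (int t)" by (rule monotone_onD[OF anti]) (use assms in auto)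
  moreover have "0 < p (int t)" using assms by (intro p_pos) (simp add: letter_iff)
  ultimately show ?thesis using assms by (simp add: ratio_def)
qed

lemma prod_ratio: "j < n \<Longrightarrow> (\<Prod>t\<le>j. ratio t) = p (int j + 1)"
proof (induction j)
  case (Suc j)
  have "0 < p (int (Suc j))" using Suc.prems by (intro p_pos) (simp add: letter_iff)
  moreover have "(\<Prod>t\<le>Suc j. ratio t) = p (int (Suc j)) * ratio (Suc j)"
    using Suc by (simp add: add.commute)
  ultimately show ?case by (simp add: ratio_def)
qed (simp add: ratio_def)

lemma weight_ratio:
  assumes "set w \<subseteq> alphabet (Queer n)"
  shows "weight w = (\<Prod>t<n. ratio t ^ conjugate (map nat w) t)"
  using assms
proof (induction w)
  case Nil
  then show ?case by (simp add: conjugate_def)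
next
  case (Cons x w)
  then have "x \<in> alphabet (Queer n)" by simp
  then obtain j where j: "j < n" "x = int j + 1" by (rule letterE)
  have "nat x = Suc j" using j by simp
  then have "(\<Prod>t<n. ratio t ^ conjugate (map nat (x # w)) t)
      = (\<Prod>t<n. (if t \<le> j then ratio t else 1) * ratio t ^ conjugate (map nat w) t)"
    by (intro prod.cong) (auto simp: conjugate_def)
  also have "\<dots> = (\<Prod>t<n. if t \<le> j then ratio t else 1) * weight w"
    using Cons by (simp add: prod.distrib)
  also have "(\<Prod>t<n. if t \<le> j then ratio t else 1) = (\<Prod>t\<le>j. ratio t)"
    using j(1) by (intro prod.mono_neutral_cong_right) auto
  finally show ?case using prod_ratio[OF j(1)] j(2) by simp
qed

lemma weight_le_1: "set w \<subseteq> alphabet (Queer n) \<Longrightarrow> weight w \<le> 1"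
proof (induction w)
  case (Cons x w)
  have "p x * weight w \<le> 1 * 1"
    using Cons p_le_1[of x] weight_pos[of w] by (intro mult_mono) auto
  then show ?case by simp
qed simp

lemma weight_dec_inc:
  assumes T: "tab T"
  shows "weight (concat T) = (\<Prod>i<n. weight (dec T i) * weight (inc T i))"
proof -
  have len: "length T \<le> n" using tab_inside[OF T] by (simp add: inside_def)
  have "weight (concat T) = prod_list (map weight T)" by (induction T) simp_all
  also have "\<dots> = (\<Prod>i<length T. weight (T ! i))"
    by (simp add: prod.list_conv_set_nth atLeast0LessThan)
  also have "\<dots> = (\<Prod>i<length T. weight (dec T i) * weight (inc T i))"
  proof (rule prod.cong[OF refl])
    show "weight (T ! i) = weight (dec T i) * weight (inc T i)" if "i \<in> {..<length T}" for i
      using dec_inc(1)[OF T, of i] that weight_simps(3) by simp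
  qed
  also have "\<dots> = (\<Prod>i<n. weight (dec T i) * weight (inc T i))"
    using len by (intro prod.mono_neutral_left) (auto simp: dec_def inc_def)
  finally show ?thesis .
qed

text \<open>
  The defects of the inequalities of the Gelfand--Tsetlin pattern.  Given the shape and the increasing parts, they determine
  the pattern, starting from \<open>t = 0\<close>.
\<close>

definition excess :: "tableau \<Rightarrow> nat \<Rightarrow> nat \<Rightarrow> nat" where
  "excess T i t = (if t = 0 then 0 else dec_count T i t - dec_count T (Suc i) (t - 1))"

lemma excess_le: 
  assumes "tab T"
  shows "dec_count T (i + t) 0 + excess T i t \<le> dec_count T i t"
proof (cases t)
  case (Suc s)
  show ?thesis
    using dec_count_diagonal[OF assms, of "Suc i" s] dec_count_interlace[OF assms, of i s]
    by (simp add: Suc excess_def)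
qed (simp add: excess_def)

text \<open>
  By \<open>excess_le\<close> the entries of the pattern are at least those of the extremal pattern, which is constant along diagonals
  and has the monomial of its top row as weight, plus their defects.  As \<open>ratio t < 1\<close>, the weight is at most the monomial
  times a power of \<open>ratio t\<close> for each defect.
\<close>

lemma weight_dec_le:
  assumes T: "tab T"
  shows "(\<Prod>i<n. weight (dec T i)) \<le>
    (\<Prod>k<n. p (int k + 1) ^ dec_count T k 0) * (\<Prod>i<n. \<Prod>t<n. ratio t ^ excess T i t)"
proof -
  have beyond: "dec_count T k 0 = 0" if "n \<le> k" for k
    using that tab_inside[OF T] by (simp add: dec_count_def conjugate_def dec_def inside_def)
  have "(\<Prod>i<n. weight (dec T i)) = (\<Prod>i<n. \<Prod>t<n. ratio t ^ dec_count T i t)"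
    using dec_inc(2)[OF T] by (simp add: weight_ratio dec_count_def)
  also have "\<dots> \<le> (\<Prod>i<n. \<Prod>t<n. ratio t ^ dec_count T (i + t) 0 * ratio t ^ excess T i t)"
  proof (intro prod_mono conjI prod_nonneg)
    fix i t assume t: "t \<in> {..<n}"
    show "0 \<le> ratio t ^ dec_count T i t" using ratio_pos[of t] t by simp
    show "ratio t ^ dec_count T i t \<le> ratio t ^ dec_count T (i + t) 0 * ratio t ^ excess T i t"
    proof (cases "t = 0")
      case False
      then have "ratio t < 1" using ratio_less_1 t by simp
      then show ?thesis unfolding power_add[symmetric]
        using ratio_pos[of t] t by (intro power_decreasing excess_le[OF T]) auto
    qed (simp add: excess_def)
  qed (simp_all add: ratio_pos less_imp_le)
  also have "\<dots> = (\<Prod>i<n. \<Prod>t<n. ratio t ^ dec_count T (i + t) 0) * (\<Prod>i<n. \<Prod>t<n. ratio t ^ excess T i t)"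
    by (simp add: prod.distrib)
  also have "(\<Prod>i<n. \<Prod>t<n. ratio t ^ dec_count T (i + t) 0) = (\<Prod>k<n. (\<Prod>t\<le>k. ratio t) ^ dec_count T k 0)"
    by (rule prod_diagonals) (rule beyond)
  also have "\<dots> = (\<Prod>k<n. p (int k + 1) ^ dec_count T k 0)"
    by (intro prod.cong) (auto simp: prod_ratio)
  finally show ?thesis .
qed

text \<open>
  The lengths of the rows and of the increasing parts determine the pattern at \<open>t = 0\<close>, and the defects determine it at
  \<open>t + 1\<close> from its values at \<open>t\<close> in the next row.
\<close>

lemma tab_determined:
  assumes T: "tab T" "tab T'" and len: "map length T = map length T'"
    and exc: "\<And>i t. i < n \<Longrightarrow> t < n \<Longrightarrow> 0 < t \<Longrightarrow> excess T i t = excess T' i t"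
    and incs: "\<And>i. i < n \<Longrightarrow> inc T i = inc T' i"
  shows "T = T'"
proof -
  have l: "length T = length T'" using len by (metis length_map)
  have ln: "length T \<le> n" using tab_inside[OF T(1)] by (simp add: inside_def)
  have beyond: "dec T i = []" "dec T' i = []" if "length T \<le> i" for i
    using that l by (simp_all add: dec_def)
  have cnt: "dec_count T i t = dec_count T' i t" if "t < n" for i t
    using that
  proof (induction t arbitrary: i)
    case 0
    show ?case
    proof (cases "i < n")
      case True
      then show ?thesis using part_dec_inc[OF T(1), of i] part_dec_inc[OF T(2), of i] len incs[OF True] by simp
    next
      case False
      then show ?thesis using beyond[of i] ln by (simp add: dec_count_def)
    qed
  next
    case (Suc t)
    show ?case
    proof (cases "i < n")
      case True
      have "dec_count T (Suc i) t = dec_count T' (Suc i) t" using Suc by simp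
      moreover have "excess T i (Suc t) = excess T' i (Suc t)" using exc[OF True Suc.prems] by simp
      ultimately show ?thesis
        using dec_count_interlace[OF T(1), of i t] dec_count_interlace[OF T(2), of i t]
        by (simp add: excess_def)
    next
      case False
      then show ?thesis using beyond[of i] ln by (simp add: dec_count_def)
    qed
  qed
  have high: "conjugate (map nat (dec S i)) t = 0" if "tab S" "n \<le> t" for S i t
    using dec_inc(2)[OF that(1), of i] that(2) by (fastforce simp: conjugate_def letter_iff filter_empty_conv)
  have decs: "dec T i = dec T' i" for i
  proof -
    have "map nat (dec T i) = map nat (dec T' i)"
    proof (rule equal_conjugates)
      show "conjugate (map nat (dec T i)) t = conjugate (map nat (dec T' i)) t" for t
        using cnt[of t i] high[OF T(1), of t i] high[OF T(2), of t i] by (cases "t < n") (auto simp: dec_count_def)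
    qed (use dec_inc(4,5)[OF T(1), of i] dec_inc(4,5)[OF T(2), of i] in simp_all)
    moreover have "inj_on nat (set (dec T i) \<union> set (dec T' i))"
    proof (rule inj_on_subset)
      show "inj_on nat {0..}" by (auto simp: inj_on_def)
      show "set (dec T i) \<union> set (dec T' i) \<subseteq> {0..}"
        using dec_inc(2)[OF T(1), of i] dec_inc(2)[OF T(2), of i] letter_iff by fastforce
    qed
    ultimately show ?thesis using map_inj_on by blast
  qed
  show ?thesis
  proof (rule nth_equalityI[OF l])
    show "T ! i = T' ! i" if "i < length T" for i
      using dec_inc(1)[OF T(1) that] dec_inc(1)[OF T(2), of i] that l ln decs[of i] incs[of i] by simp
  qed
qed

text \<open>
  The code of a tableau consists of the defects, which contribute geometric series, and of the increasing parts,
  which have finitely many values.  The constant \<open>c\<close> makes up for the difference of at most \<open>n\<close> between the length of a row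
  and the length of its decreasing part.
\<close>

lemma row_weight_le:
  "\<exists>K. \<forall>ls. admissible ls \<and> inside ls \<longrightarrow>
      (\<Sum>T | tab T \<and> map length T = ls. weight (concat T)) \<le> K * (\<Prod>a\<in>alphabet (Queer n). p a ^ nat (vec ls a))"
proof -
  define I :: "(nat \<times> nat + nat \<times> int) set" where
    "I = ({..<n} \<times> {1..<n}) <+> ({..<n} \<times> alphabet (Queer n))"
  define e where "e T = case_sum (\<lambda>(i, t). excess T i t) (\<lambda>(i, a). count (mset (inc T i)) a)" for T
  define f :: "nat \<times> nat + nat \<times> int \<Rightarrow> nat \<Rightarrow> real" where
    "f = case_sum (\<lambda>(i, t) k. ratio t ^ k) (\<lambda>_ k. if k \<le> 1 then 1 else 0)"
  define B :: "nat \<times> nat + nat \<times> int \<Rightarrow> real" where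
    "B = case_sum (\<lambda>(i, t). 1 / (1 - ratio t)) (\<lambda>_. 2)"
  define c where "c = (\<Prod>k<n. 1 / p (int k + 1) ^ n)"
  have finI: "finite I" unfolding I_def using finite_A by simp
  have p_k: "0 < p (int k + 1)" "p (int k + 1) \<le> 1" if "k < n" for k
    using that p_pos p_le_1 by (simp_all add: letter_iff)
  have c_pos: "0 \<le> c" unfolding c_def by (intro prod_nonneg) (simp add: p_k less_imp_le)
  have monomial: "(\<Prod>a\<in>alphabet (Queer n). p a ^ nat (vec ls a)) = (\<Prod>k<n. p (int k + 1) ^ part ls k)" for ls
  proof (rule prod.reindex_bij_witness[of _ "\<lambda>k. int k + 1" "\<lambda>a. nat (a - 1)"])
    fix a assume "a \<in> alphabet (Queer n)"
    then obtain j where j: "j < n" "a = int j + 1" by (rule letterE)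
    show "int (nat (a - 1)) + 1 = a" "nat (a - 1) \<in> {..<n}"
      "p (int (nat (a - 1)) + 1) ^ part ls (nat (a - 1)) = p a ^ nat (vec ls a)"
      using j by (simp_all add: vec_nth)
  qed (auto simp: letter_iff)
  have "(\<Sum>T | tab T \<and> map length T = ls. weight (concat T))
      \<le> (c * (\<Prod>k<n. p (int k + 1) ^ part ls k)) * (\<Prod>i\<in>I. B i)" for ls
  proof (rule sum_le_prod_of_code[where e = e and f = f])
    show "finite {T. tab T \<and> map length T = ls}" by (rule finite_tabs[OF finite_A])
    show "finite I" by (rule finI)
    show "0 \<le> f i k" if "i \<in> I" for i k
      using that ratio_pos by (auto simp: I_def f_def less_imp_le)
    show "(\<Sum>k\<le>M. f i k) \<le> B i" if "i \<in> I" for i M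
    proof (cases i)
      case (Inl x)
      obtain j t where x: "x = (j, t)" by (cases x)
      then have t: "0 < t" "t < n" using that Inl by (auto simp: I_def)
      show ?thesis using geometric_sum_le[of "ratio t" M] ratio_pos[OF t(2)] ratio_less_1[OF t(2,1)]
        by (simp add: f_def B_def Inl x)
    next
      case (Inr x)
      have "(\<Sum>k\<le>M. f i k) \<le> (\<Sum>k\<le>max M 1. f i k)"
        by (rule sum_mono2) (auto simp: f_def Inr)
      also have "\<dots> = (\<Sum>k\<in>{0, 1}. f i k)"
        by (rule sum.mono_neutral_right) (auto simp: f_def Inr)
      finally show ?thesis by (simp add: f_def B_def Inr)
    qed
    show "0 \<le> c * (\<Prod>k<n. p (int k + 1) ^ part ls k)"
      using c_pos by (intro mult_nonneg_nonneg prod_nonneg) (auto simp: p_k less_imp_le)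
    show "T = T'" if "T \<in> {T. tab T \<and> map length T = ls}" "T' \<in> {T. tab T \<and> map length T = ls}"
      and eq: "\<And>i. i \<in> I \<Longrightarrow> e T i = e T' i" for T T'
    proof (rule tab_determined)
      show T: "tab T" "tab T'" "map length T = map length T'" using that by auto
      show "excess T i t = excess T' i t" if "i < n" "t < n" "0 < t" for i t
      proof -
        have "Inl (i, t) \<in> I" unfolding I_def using that by (intro InlI) simp
        from eq[OF this] show ?thesis by (simp add: e_def)
      qed
      show "inc T i = inc T' i" if "i < n" for i
      proof -
        have "count (mset (inc T i)) a = count (mset (inc T' i)) a" for a
        proof (cases "a \<in> alphabet (Queer n)")
          case True
          then have "Inr (i, a) \<in> I" unfolding I_def using \<open>i < n\<close> by (intro InrI) simp
          from eq[OF this] show ?thesis by (simp add: e_def)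
        next
          case False
          then have "a \<notin> set (inc T i)" "a \<notin> set (inc T' i)" using dec_inc(3) T by blast+
          then show ?thesis by (metis count_eq_zero_iff set_mset_mset)
        qed
        then have "mset (inc T i) = mset (inc T' i)" by (rule multiset_eqI)
        moreover have "sorted (inc T i)" "sorted (inc T' i)"
          using dec_inc(6) T strict_sorted_imp_sorted by blast+
        ultimately show ?thesis by (metis properties_for_sort)
      qed
    qed
    show "weight (concat T) \<le> c * (\<Prod>k<n. p (int k + 1) ^ part ls k) * (\<Prod>i\<in>I. f i (e T i))"
      if "T \<in> {T. tab T \<and> map length T = ls}" for T
    proof -
      have T: "tab T" and ls: "ls = map length T" using that by auto
      have inc_one: "f (Inr x) (e T (Inr x)) = 1" for x
      proof -
        obtain i a where x: "x = (i, a)" by (cases x)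
        have "distinct (inc T i)" using dec_inc(6)[OF T] by (simp add: strict_sorted_iff)
        then have "count (mset (inc T i)) a \<le> 1" by (simp add: distinct_count_atmost_1)
        then show ?thesis by (simp add: f_def e_def x)
      qed
      have "(\<Prod>i\<in>I. f i (e T i)) = (\<Prod>x\<in>{..<n} \<times> {1..<n}. f (Inl x) (e T (Inl x)))"
        unfolding I_def using finite_A by (subst prod.Plus) (auto simp: inc_one)
      also have "\<dots> = (\<Prod>i<n. \<Prod>t\<in>{1..<n}. ratio t ^ excess T i t)"
        by (simp add: f_def e_def prod.cartesian_product split_def)
      also have "\<dots> = (\<Prod>i<n. \<Prod>t<n. ratio t ^ excess T i t)"
      proof (rule prod.cong[OF refl])
        show "(\<Prod>t\<in>{1..<n}. ratio t ^ excess T i t) = (\<Prod>t<n. ratio t ^ excess T i t)" for i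
          by (rule prod.mono_neutral_left) (auto simp: excess_def)
      qed
      finally have code: "(\<Prod>i\<in>I. f i (e T i)) = (\<Prod>i<n. \<Prod>t<n. ratio t ^ excess T i t)" .
      then have code_nonneg: "0 \<le> (\<Prod>i\<in>I. f i (e T i))"
        by (auto intro!: prod_nonneg simp: ratio_pos less_imp_le)
      have "weight (concat T) = (\<Prod>i<n. weight (dec T i)) * (\<Prod>i<n. weight (inc T i))"
        unfolding weight_dec_inc[OF T] by (simp add: prod.distrib)
      also have "\<dots> \<le> (\<Prod>i<n. weight (dec T i)) * 1"
      proof (rule mult_left_mono)
        show "(\<Prod>i<n. weight (inc T i)) \<le> 1"
          using weight_le_1[OF dec_inc(3)[OF T]] weight_pos[OF dec_inc(3)[OF T]]
          by (intro prod_le_1) (auto simp: less_imp_le)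
        show "0 \<le> (\<Prod>i<n. weight (dec T i))"
          using weight_pos[OF dec_inc(2)[OF T]] by (intro prod_nonneg) (simp add: less_imp_le)
      qed
      also have "\<dots> \<le> (\<Prod>k<n. p (int k + 1) ^ dec_count T k 0) * (\<Prod>i\<in>I. f i (e T i))"
        using weight_dec_le[OF T] code by simp
      also have "\<dots> \<le> (\<Prod>k<n. 1 / p (int k + 1) ^ n * p (int k + 1) ^ part ls k) * (\<Prod>i\<in>I. f i (e T i))"
      proof (rule mult_right_mono[OF _ code_nonneg], rule prod_mono, intro conjI)
        fix k assume "k \<in> {..<n}"
        then have k: "k < n" by simp
        show "0 \<le> p (int k + 1) ^ dec_count T k 0" using p_k[OF k] by simp
        have "part ls k \<le> n + dec_count T k 0"
          unfolding ls part_dec_inc[OF T] using length_inc_le[OF T, of k] by simp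
        then have "p (int k + 1) ^ (n + dec_count T k 0) \<le> p (int k + 1) ^ part ls k"
          using p_k[OF k] by (intro power_decreasing) auto
        then show "p (int k + 1) ^ dec_count T k 0 \<le> 1 / p (int k + 1) ^ n * p (int k + 1) ^ part ls k"
          using p_k[OF k] by (simp add: power_add field_simps)
      qed
      also have "(\<Prod>k<n. 1 / p (int k + 1) ^ n * p (int k + 1) ^ part ls k) = c * (\<Prod>k<n. p (int k + 1) ^ part ls k)"
        by (simp only: prod.distrib c_def)
      finally show ?thesis .
    qed
  qed
  then show ?thesis unfolding monomial
    by (intro exI[of _ "c * (\<Prod>i\<in>I. B i)"]) (simp add: mult_ac)
qed

sublocale shaped_insertion "Queer n" p row "\<lambda>a b. b < a" row_adj row_stops row_bump inside vec decode
proof (unfold_locales, goal_cases)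
  case 1 show ?case by (rule states)
next
  case (2 T) then show ?case by (rule tab_inside)
next
  case (3 T) show ?case by (rule tab_shape)
next
  case (4 ls) then show ?case by (rule tab_exists)
next
  case (5 ls j) then show ?case by (intro vec_grow)
next
  case (6 ls) then show ?case by (intro decode_vec)
next
  case (7 ls a) then show ?case by (intro decode_step)
next
  case (8 ls a) show ?case by (rule vec_nonneg)
next
  case 9 show ?case by (rule vec_Nil)
next
  case (10 ls) then show ?case by (rule shrink)
next
  case 11 show ?case by (rule row_weight_le)
qed

end

declare alphabet.simps(3) [simp]


section \<open>The three families\<close>

lemma letter_law_alphabet:
  assumes "\<forall>i\<in>alphabet d. 0 < p i \<and> p i < 1" "(\<Sum>i\<in>alphabet d. p i) = 1"
  shows "letter_law (alphabet d) p"
proof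
  show "finite (alphabet d)" by (cases d) auto
qed (use assms in auto)

lemma hook_columns_GL:
  assumes law: "letter_law (alphabet (GL n)) p" and n: "0 < n" and p: "strict_antimono_on {1..int n} p"
  shows "hook_columns (GL n) p 1 n 0"
proof -
  interpret letter_law "alphabet (GL n)" p by (rule law)
  interpret column_letters "{1..int n}" "\<lambda>a. 1 + int n \<le> a" .
  have below_less: "below t x \<longleftrightarrow> t < x" if "t \<in> {1..int n}" for t x
    using that by (auto simp: below_def)
  show ?thesis
  proof
    show "insertion (GL n) x [] = [[x]]" for x by simp
    show "insertion (GL n) x (C # T) = (if column_letters.column_stops (\<lambda>a. 1 + int n \<le> a) x C then (C @ [x]) # T
       else fst (column_letters.column_bump (\<lambda>a. 1 + int n \<le> a) x C) #
         insertion (GL n) (snd (column_letters.column_bump (\<lambda>a. 1 + int n \<le> a) x C)) T)"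
      if "column_letters.column (alphabet (GL n)) (\<lambda>a. 1 + int n \<le> a) C" for C x T
    proof -
      have sub: "t \<in> {1..int n}" if "t \<in> set C" for t
        using \<open>column_letters.column (alphabet (GL n)) (\<lambda>a. 1 + int n \<le> a) C\<close> that
        by (auto simp: column_letters.column_def)
      have "column_stops x C \<longleftrightarrow> (\<forall>t\<in>set C. t < x)"
        unfolding column_stops_def using below_less[OF sub] by blast
      moreover have "{t \<in> set C. \<not> below t x} = {t \<in> set C. t \<ge> x}"
        using below_less[OF sub] by (auto simp: not_less)
      ultimately show ?thesis by (simp add: column_bump_def Let_def)
    qed
    show "alphabet (GL n) = {1..<1 + int n} \<union> {1..int 0}" by auto
    show "strict_antimono_on {1..<1 + int n} p" using p by (rule monotone_on_subset) auto
    show "strict_antimono_on {1..int 0} p" by (simp add: monotone_on_def)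
    have coords: "hook_coordinates 1 n 0 lam = row_vector n lam" for lam
      by (rule ext) (auto simp: hook_coordinates_def row_vector_def)
    have "hook_partitions n 0 = {w. antimono w \<and> (\<forall>i\<ge>n. w i = 0)}"
    proof -
      have "finite {i. w i \<noteq> 0}" if "\<forall>i\<ge>n. w i = 0" for w :: "nat \<Rightarrow> nat"
      proof (rule finite_subset)
        show "{i. w i \<noteq> 0} \<subseteq> {..<n}" using that by (metis (mono_tags) lessThan_iff mem_Collect_eq not_le subsetI)
      qed simp
      then show ?thesis by (auto simp: hook_partitions_def)
    qed
    then show "partitions_of (GL n) = hook_coordinates 1 n 0 ` hook_partitions n 0"
      unfolding coords by (simp add: partition_vectors_eq)
    show "shape (GL n) T = hook_coordinates 1 n 0 (row_lengths_of_columns T)" for T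
      by (simp add: coords)
  qed (use n in auto)
qed

lemma hook_columns_GLsuper:
  assumes law: "letter_law (alphabet (GLsuper m n)) p" and m: "0 < m"
    and p: "strict_antimono_on {- int m..-1} p" "strict_antimono_on {1..int n} p"
  shows "hook_columns (GLsuper m n) p (- int m) m n"
proof -
  interpret letter_law "alphabet (GLsuper m n)" p by (rule law)
  show ?thesis
  proof
    show "insertion (GLsuper m n) x [] = [[x]]" for x by simp
    show "insertion (GLsuper m n) x (C # T) = (if column_letters.column_stops (\<lambda>a. - int m + int m \<le> a) x C then (C @ [x]) # T
       else fst (column_letters.column_bump (\<lambda>a. - int m + int m \<le> a) x C) #
         insertion (GLsuper m n) (snd (column_letters.column_bump (\<lambda>a. - int m + int m \<le> a) x C)) T)" for C x T
    proof (cases "x < 0")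
      case True
      then have "column_letters.below ((\<le>) 0) t x \<longleftrightarrow> t < x" for t
        by (auto simp: column_letters.below_def)
      then show ?thesis
        using True by (auto simp: column_letters.column_stops_def column_letters.column_bump_def Let_def not_less)
    next
      case False
      then have "column_letters.below ((\<le>) 0) t x \<longleftrightarrow> t \<le> x" for t
        by (auto simp: column_letters.below_def)
      then show ?thesis
        using False by (auto simp: column_letters.column_stops_def column_letters.column_bump_def Let_def not_le)
    qed
    have barred: "{- int m..< - int m + int m} = {- int m..-1}" by auto
    show "alphabet (GLsuper m n) = {- int m..< - int m + int m} \<union> {1..int n}" unfolding barred by simp
    show "strict_antimono_on {- int m..< - int m + int m} p" unfolding barred by (rule p(1))
    show "strict_antimono_on {1..int n} p" by (rule p(2))
    have coords: "hook_coordinates (- int m) m n = hook_vector m n"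
      unfolding hook_coordinates_def hook_vector_def barred
      by (intro ext) (simp only: diff_minus_eq_add add.commute)
    show "partitions_of (GLsuper m n) = hook_coordinates (- int m) m n ` hook_partitions m n"
      "shape (GLsuper m n) T = hook_coordinates (- int m) m n (row_lengths_of_columns T)" for T
      by (simp_all add: coords)
  qed (use m in auto)
qed

lemma hook_rows_Queer:
  assumes law: "letter_law (alphabet (Queer n)) p" and p: "strict_antimono_on {1..int n} p"
  shows "hook_rows p n"
proof -
  interpret letter_law "alphabet (Queer n)" p by (rule law)
  interpret row_letters "alphabet (Queer n)" .
  show ?thesis
  proof
    show "insertion (Queer n) x [] = [[x]]" for x by simp
    show "insertion (Queer n) x (L # T) = (if row_letters.row_stops x L then (L @ [x]) # T
       else fst (row_letters.row_bump x L) # insertion (Queer n) (snd (row_letters.row_bump x L)) T)" for x L T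
      by (simp add: row_stops_def row_bump_def Let_def)
  qed (rule p)
qed

theorem theorem6p2p3:
  fixes d :: family and p :: "int \<Rightarrow> real"
  assumes "positive_ranks d"
    and "\<forall>i\<in>alphabet d. 0 < p i \<and> p i < 1"
    and "(\<Sum>i\<in>alphabet d. p i) = 1"
    and "decreasing_weights d p"
  shows "markov_chain (word_space d p) (partitions_of d)
           (transition_matrix (word_space d p) (shape_process d)) (shape_process d)
       \<and> stochastic_on (partitions_of d) (conditioned_walk_matrix d p)
       \<and> (\<forall>u\<in>partitions_of d. \<forall>v\<in>partitions_of d.
            transition_matrix (word_space d p) (shape_process d) u v
              = conditioned_walk_matrix d p u v)"
proof -
  note law = letter_law_alphabet[OF assms(2,3)]
  show ?thesis
  proof (cases d)
    case (GL n)
    interpret hook_columns d p 1 n 0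
      using hook_columns_GL law assms(1,4) unfolding GL by simp
    show ?thesis by (rule shape_process_is_conditioned_walk)
  next
    case (GLsuper m n)
    interpret hook_columns d p "- int m" m n
      using hook_columns_GLsuper law assms(1,4) unfolding GLsuper by simp
    show ?thesis by (rule shape_process_is_conditioned_walk)
  next
    case (Queer n)
    interpret hook_rows p n
      using hook_rows_Queer law assms(4) unfolding Queer by simp
    show ?thesis unfolding Queer by (rule shape_process_is_conditioned_walk)
  qed
qed

end
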